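(* Let $p\in(1,\infty)$. Then every $p$-elastica is analytic if and only if $p=\frac{2m}{2m-1}$ for some integer $m\ge1$, that is, $p\in\{\frac21,\frac43,\frac65,\frac87,\dots\}$.
   Context: For an immersed curve $\gamma\in W^{2,p}(0,1;\mathbb{R}^2)$ (i.e. $\gamma'\ne0$ on $[0,1]$), let $\mathcal{B}_p[\gamma]=\int_\gamma|k|^p\,ds$ ($s$ arclength, $k$ signed curvature) and let $\mathcal{L}[\gamma]$ be the length. The curve $\gamma$ is a $p$-elastica if there is $\lambda\in\mathbb{R}$ such that $\frac{d}{d\varepsilon}\big(\mathcal{B}_p[\gamma+\varepsilon\eta]+\lambda\mathcal{L}[\gamma+\varepsilon\eta]\big)\big|_{\varepsilon=0}=0$ for all $\eta\in C^\infty_{\rm c}(0,1;\mathbb{R}^2)$. A $p$-elastica is said to be analytic if its arclength parametrization $[0,L]\to\mathbb{R}^2$ is (real-)analytic on $[0,L]$, $L$ being its length. *)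

theory Defs
  imports "HOL-Analysis.Analysis"
begin

section \<open>Test functions and Sobolev spaces on the unit interval\<close>

definition smooth :: "(real \<Rightarrow> 'a::real_normed_vector) \<Rightarrow> bool" where
  "smooth f \<longleftrightarrow>
    (\<forall>n x. ((\<lambda>g t. vector_derivative g (at t)) ^^ n) f differentiable at x)"

text \<open>Elements of $C^\infty_c(0,1)$ are extended by zero to the whole real line.\<close>

definition test_function :: "(real \<Rightarrow> 'a::real_normed_vector) \<Rightarrow> bool" where
  "test_function f \<longleftrightarrow> smooth f \<and> closure {t. f t \<noteq> 0} \<subseteq> {0<..<1}"

definition locally_integrable :: "(real \<Rightarrow> 'a::euclidean_space) \<Rightarrow> bool" where
  "locally_integrable f \<longleftrightarrow>
    (\<forall>K. compact K \<longrightarrow> K \<subseteq> {0<..<1} \<longrightarrow> f absolutely_integrable_on K)"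

definition has_weak_derivative ::
    "(real \<Rightarrow> 'a::euclidean_space) \<Rightarrow> (real \<Rightarrow> 'a) \<Rightarrow> bool" where
  "has_weak_derivative f g \<longleftrightarrow> locally_integrable f \<and> locally_integrable g \<and>
    (\<forall>\<phi> :: real \<Rightarrow> real. test_function \<phi> \<longrightarrow>
      (LINT t:{0<..<1}|lebesgue. vector_derivative \<phi> (at t) *\<^sub>R f t) =
      - (LINT t:{0<..<1}|lebesgue. \<phi> t *\<^sub>R g t))"

text \<open>Weak derivatives are unique only almost everywhere on $(0,1)$. The choice made here is
  harmless because the result is only used under Lebesgue integrals over $(0,1)$.\<close>

definition weak_derivative :: "(real \<Rightarrow> 'a::euclidean_space) \<Rightarrow> real \<Rightarrow> 'a" where
  "weak_derivative f = (SOME g. has_weak_derivative f g)"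

definition Lp :: "real \<Rightarrow> (real \<Rightarrow> 'a::euclidean_space) set" where
  "Lp p = {f. f \<in> borel_measurable (lebesgue_on {0<..<1}) \<and>
              integrable (lebesgue_on {0<..<1}) (\<lambda>t. norm (f t) powr p)}"

fun Sobolev :: "nat \<Rightarrow> real \<Rightarrow> (real \<Rightarrow> 'a::euclidean_space) set" where
  "Sobolev 0 p = Lp p"
| "Sobolev (Suc k) p = {f \<in> Lp p. \<exists>g \<in> Sobolev k p. has_weak_derivative f g}"


section \<open>Immersed curves, bending energy and length\<close>

text \<open>A curve is a function on the whole real line of which only the values on $[0,1]$ matter.
  At the endpoints the derivative is one-sided.\<close>

abbreviation curve_deriv :: "(real \<Rightarrow> real^2) \<Rightarrow> real \<Rightarrow> real^2" where
  "curve_deriv \<gamma> t \<equiv> vector_derivative \<gamma> (at t within {0..1})"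

text \<open>Each class in $W^{2,p}(0,1;\mathbb{R}^2)$ has a unique representative on $[0,1]$ that is
  continuously differentiable there. The second and third conditions select this representative;
  it is the one that gives meaning to $\gamma' \neq 0$ on $[0,1]$.\<close>

definition immersed_curve :: "real \<Rightarrow> (real \<Rightarrow> real^2) \<Rightarrow> bool" where
  "immersed_curve p \<gamma> \<longleftrightarrow>
    \<gamma> \<in> Sobolev 2 p \<and>
    \<gamma> differentiable_on {0..1} \<and>
    continuous_on {0..1} (curve_deriv \<gamma>) \<and>
    (\<forall>t\<in>{0..1}. curve_deriv \<gamma> t \<noteq> 0)"

text \<open>The signed curvature $\det(\gamma',\gamma'')/|\gamma'|^3$, with $\gamma''$ the weak
  derivative of $\gamma'$.\<close>

definition curvature :: "(real \<Rightarrow> real^2) \<Rightarrow> real \<Rightarrow> real" where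
  "curvature \<gamma> t =
    (let v = curve_deriv \<gamma> t; a = weak_derivative (curve_deriv \<gamma>) t
     in (v $ 1 * a $ 2 - v $ 2 * a $ 1) / norm v ^ 3)"

definition bending_energy :: "real \<Rightarrow> (real \<Rightarrow> real^2) \<Rightarrow> real" where
  "bending_energy p \<gamma> =
    (LINT t:{0<..<1}|lebesgue. \<bar>curvature \<gamma> t\<bar> powr p * norm (curve_deriv \<gamma> t))"

definition arclength :: "(real \<Rightarrow> real^2) \<Rightarrow> real \<Rightarrow> real" where
  "arclength \<gamma> t = (LINT u:{0..t}|lebesgue. norm (curve_deriv \<gamma> u))"

definition curve_length :: "(real \<Rightarrow> real^2) \<Rightarrow> real" where
  "curve_length \<gamma> = arclength \<gamma> 1"

text \<open>For an immersed curve, the arclength function is a bijection from $[0,1]$ onto $[0,L]$.\<close>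

definition arclength_param :: "(real \<Rightarrow> real^2) \<Rightarrow> real \<Rightarrow> real^2" where
  "arclength_param \<gamma> s = \<gamma> (inv_into {0..1} (arclength \<gamma>) s)"


section \<open>p-elasticae and analyticity\<close>

definition p_elastica :: "real \<Rightarrow> (real \<Rightarrow> real^2) \<Rightarrow> bool" where
  "p_elastica p \<gamma> \<longleftrightarrow> immersed_curve p \<gamma> \<and>
    (\<exists>lam::real. \<forall>\<eta> :: real \<Rightarrow> real^2. test_function \<eta> \<longrightarrow>
      ((\<lambda>\<epsilon>. bending_energy p (\<lambda>t. \<gamma> t + \<epsilon> *\<^sub>R \<eta> t)
             + lam * curve_length (\<lambda>t. \<gamma> t + \<epsilon> *\<^sub>R \<eta> t))
        has_real_derivative 0) (at 0))"

text \<open>Power series expansions are required at every point of the set, including boundary points,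
  where they only have to represent the function on the part of the neighbourhood inside the set.\<close>

definition real_analytic_on :: "(real \<Rightarrow> 'a::real_normed_vector) \<Rightarrow> real set \<Rightarrow> bool" where
  "real_analytic_on f S \<longleftrightarrow>
    (\<forall>x\<in>S. \<exists>r>0. \<exists>a :: nat \<Rightarrow> 'a. \<forall>y\<in>S. \<bar>y - x\<bar> < r \<longrightarrow>
      (\<lambda>n. (y - x) ^ n *\<^sub>R a n) sums f y)"

definition analytic_curve :: "(real \<Rightarrow> real^2) \<Rightarrow> bool" where
  "analytic_curve \<gamma> \<longleftrightarrow> real_analytic_on (arclength_param \<gamma>) {0..curve_length \<gamma>}"

end

theory Submission
  imports Defs
begin

text \<open>Write $\omega = |k|^{p-2} k$. The first variation and the lemma of du Bois-Reymond give, in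
  arclength and without any a priori regularity, $p\,\omega_s = \langle c, N \rangle$ for a constant
  vector $c$, while $T_s = k N$ and $k = |\omega|^{1/(p-1)} \mathrm{sgn}\, \omega$. If $1/(p-1)$ is an odd
  integer, this is a polynomial system for $(T, \omega)$, whose solutions are analytic up to the
  boundary because all derivatives are polynomials in the solution with controlled coefficients.

  Otherwise consider $\lambda = 0$. The elastica whose curvature satisfies $\omega = - \alpha^{p-1} y$
  in terms of the height $y$, where $\alpha = p/(p-1)$, is an explicit graph over the $y$-axis with
  $x_s = |y|^\alpha$. At $y = 0$ one has $y_s = 1$, so analyticity of $x$ in $s$ would force
  $\alpha$ to be an even integer, that is, $1/(p-1) = \alpha - 1$ to be odd.\<close>

subsection \<open>Smooth functions and test functions\<close>

text \<open>The obstacle is low regularity: gamma'' is only in L^p, so the Euler-Lagrange equation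
  cannot be differentiated out. Testing with scalar test functions times fixed vectors, a
  second-order du Bois-Reymond lemma gives an absolutely continuous representative F of P J gamma',
  where J is the rotation by 90 degrees and P = \<open>bend_P\<close>. The vector c is the constant
  of integration, the momentum conserved by translation invariance. Pairing F with the normal
  removes the multiplier lambda together with all other tangential terms. The condition p =
  2m/(2m-1) says exactly that 1/(p-1) = 2m-1, that is, that k is an odd power of omega.

  The explicit curve comes from the conserved vector: for lambda = 0 let omega be a multiple of the
  height y. Since (alpha-1)(p-1) = 1, the factor -alpha^(p-1) gives k = -alpha |y|^(alpha-1) sgn y,
  so the tangent angle theta satisfies (cos theta)_s = -k y_s = (|y|^alpha)_s. This integrates to
  cos theta = |y|^alpha with coefficient exactly 1.\<close>

lemma smooth_coinduct:
  fixes f :: "real \<Rightarrow> 'a::real_normed_vector"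
  assumes "P f"
    and step: "\<And>g. P g \<Longrightarrow> \<exists>g'. P g' \<and> (\<forall>x. (g has_vector_derivative g' x) (at x))"
  shows "smooth f"
proof -
  \<comment> \<open>All iterated derivatives stay in the class P, which is why closure under one
    differentiation suffices and no Leibniz formula for higher orders is needed.\<close>
  have P: "P (((\<lambda>g t. vector_derivative g (at t)) ^^ n) f)" for n
  proof (induction n)
    case 0
    then show ?case using assms(1) by simp
  next
    case (Suc n)
    then obtain g' where g': "P g'"
      "\<forall>x. (((\<lambda>g t. vector_derivative g (at t)) ^^ n) f has_vector_derivative g' x) (at x)"
      using step by blast
    then have "(\<lambda>t. vector_derivative (((\<lambda>g t. vector_derivative g (at t)) ^^ n) f) (at t)) = g'"
      by (auto intro!: ext vector_derivative_at)
    then show ?case using g'(1) by simp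
  qed
  show ?thesis
    unfolding smooth_def using step[OF P] by (metis differentiableI_vector)
qed

lemma smooth_imp_has_vector_derivative:
  assumes "smooth f"
  shows "(f has_vector_derivative vector_derivative f (at x)) (at x)"
proof -
  have "((\<lambda>g t. vector_derivative g (at t)) ^^ 0) f differentiable at x"
    using assms unfolding smooth_def by blast
  then show ?thesis by (simp add: vector_derivative_works)
qed

lemma smooth_deriv:
  assumes "smooth f"
  shows "smooth (\<lambda>t. vector_derivative f (at t))"
  unfolding smooth_def
proof (intro allI)
  fix n x
  have "((\<lambda>g t. vector_derivative g (at t)) ^^ Suc n) f differentiable at x"
    using assms unfolding smooth_def by blast
  then show "((\<lambda>g t. vector_derivative g (at t)) ^^ n) (\<lambda>t. vector_derivative f (at t))
      differentiable at x"
    by (simp add: funpow_Suc_right del: funpow.simps)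
qed

lemma smooth_continuous_on:
  assumes "smooth f"
  shows "continuous_on S f"
  by (meson assms continuous_at_imp_continuous_on has_vector_derivative_continuous
      smooth_imp_has_vector_derivative)

lemma smooth_linear_image:
  assumes "smooth f" "bounded_linear L"
  shows "smooth (\<lambda>t. L (f t))"
proof (rule smooth_coinduct[where P = "\<lambda>h. \<exists>g. smooth g \<and> h = (\<lambda>t. L (g t))"])
  show "\<exists>g. smooth g \<and> (\<lambda>t. L (f t)) = (\<lambda>t. L (g t))" using assms by blast
next
  fix h assume "\<exists>g. smooth g \<and> h = (\<lambda>t. L (g t))"
  then obtain g where g: "smooth g" "h = (\<lambda>t. L (g t))" by blast
  show "\<exists>g'. (\<exists>g. smooth g \<and> g' = (\<lambda>t. L (g t))) \<and> (\<forall>x. (h has_vector_derivative g' x) (at x))"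
    using smooth_deriv[OF g(1)] smooth_imp_has_vector_derivative[OF g(1)] g(2)
      bounded_linear.has_vector_derivative[OF assms(2)]
    by (intro exI[of _ "\<lambda>t. L (vector_derivative g (at t))"]) blast
qed

text \<open>The derivative of one product is a sum of two products, so sums of products form a class
  to which \<open>smooth_coinduct\<close> applies. Sums of smooth functions are covered too, by
  taking one factor equal to 1.\<close>

inductive smooth_alg :: "(real \<Rightarrow> real) \<Rightarrow> bool" where
  prod: "smooth f \<Longrightarrow> smooth g \<Longrightarrow> smooth_alg (\<lambda>t. f t * g t)"
| sum: "smooth_alg f \<Longrightarrow> smooth_alg g \<Longrightarrow> smooth_alg (\<lambda>t. f t + g t)"

lemma smooth_alg_deriv:
  "smooth_alg f \<Longrightarrow> \<exists>f'. smooth_alg f' \<and> (\<forall>x. (f has_vector_derivative f' x) (at x))"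
proof (induction rule: smooth_alg.induct)
  case (prod f g)
  let ?f = "\<lambda>t. vector_derivative f (at t)" and ?g = "\<lambda>t. vector_derivative g (at t)"
  have "smooth_alg (\<lambda>t. f t * ?g t + ?f t * g t)"
    by (intro smooth_alg.intros prod smooth_deriv)
  moreover have "((\<lambda>t. f t * g t) has_vector_derivative (f x * ?g x + ?f x * g x)) (at x)" for x
    by (intro has_vector_derivative_mult smooth_imp_has_vector_derivative prod)
  ultimately show ?case by (intro exI[of _ "\<lambda>t. f t * ?g t + ?f t * g t"]) simp
next
  case (sum f g)
  then obtain f' g' where "smooth_alg f'" "smooth_alg g'"
    "\<And>x. (f has_vector_derivative f' x) (at x)" "\<And>x. (g has_vector_derivative g' x) (at x)"
    by blast
  then show ?case
    by (intro exI[of _ "\<lambda>t. f' t + g' t"]) (simp add: smooth_alg.sum has_vector_derivative_add)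
qed

lemma smooth_const [simp]: "smooth (\<lambda>t. c)"
  by (rule smooth_coinduct[where P = "\<lambda>h. \<exists>c. h = (\<lambda>t. c)"])
    (use has_vector_derivative_const in blast)+

lemma smooth_mult:
  fixes f g :: "real \<Rightarrow> real"
  assumes "smooth f" "smooth g"
  shows "smooth (\<lambda>t. f t * g t)"
  by (rule smooth_coinduct[where P = smooth_alg, OF smooth_alg.prod[OF assms]])
    (rule smooth_alg_deriv)

lemma smooth_add:
  fixes f g :: "real \<Rightarrow> real"
  assumes "smooth f" "smooth g"
  shows "smooth (\<lambda>t. f t + g t)"
proof (rule smooth_coinduct[where P = smooth_alg, OF _ smooth_alg_deriv])
  show "smooth_alg (\<lambda>t. f t + g t)"
    using smooth_alg.sum[OF smooth_alg.prod[OF assms(1) smooth_const[of 1]]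
        smooth_alg.prod[OF assms(2) smooth_const[of 1]]]
    by simp
qed

lemma smooth_cmult:
  fixes f :: "real \<Rightarrow> real"
  shows "smooth f \<Longrightarrow> smooth (\<lambda>t. c * f t)"
  by (rule smooth_mult[OF smooth_const])

lemma smooth_antideriv:
  assumes "\<And>x. (f has_vector_derivative g x) (at x)" "smooth g"
  shows "smooth f"
proof (rule smooth_coinduct[where P = "\<lambda>h. h = f \<or> smooth h"])
  fix h assume "h = f \<or> smooth h"
  then show "\<exists>g'. (g' = f \<or> smooth g') \<and> (\<forall>x. (h has_vector_derivative g' x) (at x))"
    using assms smooth_deriv smooth_imp_has_vector_derivative by blast
qed simp

lemma smooth_ident: "smooth (\<lambda>t::real. t)"
  by (rule smooth_antideriv[OF has_vector_derivative_id smooth_const])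

lemma smooth_affine_comp:
  assumes "smooth f"
  shows "smooth (\<lambda>t. f (a * t + b))"
\<comment> \<open>The factor c in the invariant absorbs the powers of a produced by the chain
  rule.\<close>
proof (rule smooth_coinduct[where P = "\<lambda>h. \<exists>g c. smooth g \<and> h = (\<lambda>t. c *\<^sub>R g (a * t + b))"])
  show "\<exists>g c. smooth g \<and> (\<lambda>t. f (a * t + b)) = (\<lambda>t. c *\<^sub>R g (a * t + b))"
    using assms by (intro exI[of _ f] exI[of _ 1]) simp
next
  fix h assume "\<exists>g c. smooth g \<and> h = (\<lambda>t. c *\<^sub>R g (a * t + b))"
  then obtain g c where g: "smooth g" "h = (\<lambda>t. c *\<^sub>R g (a * t + b))" by blast
  let ?g = "\<lambda>t. vector_derivative g (at t)"
  have "((\<lambda>t. g (a * t + b)) has_vector_derivative a *\<^sub>R ?g (a * x + b)) (at x)" for x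
  proof -
    have 1: "((\<lambda>t. a * t + b) has_vector_derivative a) (at x)"
      by (auto simp: has_real_derivative_iff_has_vector_derivative[symmetric] intro!: derivative_eq_intros)
    show ?thesis
      using vector_diff_chain_at[OF 1 smooth_imp_has_vector_derivative[OF g(1)]] by (simp add: o_def)
  qed
  then have "(h has_vector_derivative (c * a) *\<^sub>R ?g (a * x + b)) (at x)" for x
    unfolding g(2) using has_vector_derivative_scaleR[OF DERIV_const] by fastforce
  then show "\<exists>g'. (\<exists>g c. smooth g \<and> g' = (\<lambda>t. c *\<^sub>R g (a * t + b))) \<and>
      (\<forall>x. (h has_vector_derivative g' x) (at x))"
    using smooth_deriv[OF g(1)] by (intro exI[of _ "\<lambda>t. (c * a) *\<^sub>R ?g (a * t + b)"]) blast
qed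

lemma smooth_real_polynomial_function:
  assumes "real_polynomial_function f"
  shows "smooth (f :: real \<Rightarrow> real)"
  using assms
proof (induction rule: real_polynomial_function.induct)
  case (linear f)
  then obtain c where "f = (\<lambda>x. x * c)" using real_bounded_linear by blast
  then show ?case using smooth_mult[OF smooth_ident smooth_const] by simp
next
  case (const c)
  show ?case by (rule smooth_const)
next
  case (add f g)
  then show ?case by (intro smooth_add)
next
  case (mult f g)
  then show ?case by (intro smooth_mult)
qed

text \<open>The polynomial factor in $1/x$ makes this family closed under differentiation.\<close>

definition flat_exp :: "real poly \<Rightarrow> real \<Rightarrow> real" where
  "flat_exp q x = (if x > 0 then poly q (1 / x) * exp (- 1 / x) else 0)"

lemma poly_exp_tendsto_0: "((\<lambda>y::real. poly q y * exp (- y)) \<longlongrightarrow> 0) at_top"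
proof -
  have "((\<lambda>y. \<Sum>i\<le>degree q. coeff q i * (y ^ i / exp y)) \<longlongrightarrow> (\<Sum>i\<le>degree q. coeff q i * 0)) at_top"
    by (intro tendsto_intros tendsto_power_div_exp_0)
  then show ?thesis
    by (simp add: poly_altdef sum_distrib_right exp_minus field_simps sum_divide_distrib)
qed

lemma flat_exp_tendsto_0: "(flat_exp q \<longlongrightarrow> 0) (at 0)"
proof -
  have "((\<lambda>x. poly q (1 / x) * exp (- 1 / x)) \<longlongrightarrow> 0) (at_right 0)"
    using filterlim_compose[OF poly_exp_tendsto_0[of q] filterlim_inverse_at_top_right]
    by (simp add: field_simps inverse_eq_divide)
  then have "(flat_exp q \<longlongrightarrow> 0) (at_right 0)"
    by (rule Lim_transform_eventually)
      (auto simp: eventually_at_right_field flat_exp_def intro!: exI[of _ 1])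
  moreover have "(flat_exp q \<longlongrightarrow> 0) (at_left 0)"
    by (rule Lim_transform_eventually[OF tendsto_const])
      (auto simp: eventually_at_left_field flat_exp_def intro!: exI[of _ "-1"])
  ultimately show ?thesis by (simp add: filterlim_at_split)
qed

text \<open>With u = 1/x, d/dx = -u^2 d/du turns q(u) exp(-u) into u^2 (q - q')(u) exp(-u). At x = 0
  the difference quotient is again a member of the family, with polynomial u q(u), and so tends to
  0.\<close>

lemma flat_exp_deriv:
  "(flat_exp q has_vector_derivative flat_exp ([:0, 0, 1:] * (q - pderiv q)) x) (at x)"
proof -
  consider "x > 0" | "x < 0" | "x = 0" by linarith
  then show ?thesis
  proof cases
    case 1
    have "((\<lambda>x. poly q (1 / x) * exp (- 1 / x)) has_real_derivative
        flat_exp ([:0, 0, 1:] * (q - pderiv q)) x) (at x)"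
      using 1 by (auto intro!: derivative_eq_intros DERIV_chain2[OF poly_DERIV]
          simp: flat_exp_def field_simps power2_eq_square)
    then have "(flat_exp q has_real_derivative flat_exp ([:0, 0, 1:] * (q - pderiv q)) x) (at x)"
      by (rule DERIV_cong_ev[THEN iffD1, rotated -1])
        (use 1 in \<open>auto simp: flat_exp_def eventually_nhds intro!: exI[of _ "{0<..}"]\<close>)
    then show ?thesis by (simp add: has_real_derivative_iff_has_vector_derivative)
  next
    case 2
    have "((\<lambda>x. 0) has_real_derivative 0) (at x)" by simp
    then have "(flat_exp q has_real_derivative 0) (at x)"
      by (rule DERIV_cong_ev[THEN iffD1, rotated -1])
        (use 2 in \<open>auto simp: flat_exp_def eventually_nhds intro!: exI[of _ "{..<0}"]\<close>)
    then show ?thesis using 2 by (simp add: has_real_derivative_iff_has_vector_derivative flat_exp_def)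
  next
    case 3
    have "((\<lambda>y. (flat_exp q y - flat_exp q 0) / (y - 0)) \<longlongrightarrow> 0) (at 0)"
    proof (rule Lim_transform_eventually[OF flat_exp_tendsto_0[of "[:0, 1:] * q"]])
      show "\<forall>\<^sub>F y in at 0. flat_exp ([:0, 1:] * q) y = (flat_exp q y - flat_exp q 0) / (y - 0)"
        by (rule always_eventually) (auto simp: flat_exp_def)
    qed
    then show ?thesis
      using 3 by (simp add: has_real_derivative_iff_has_vector_derivative[symmetric] has_field_derivative_iff flat_exp_def)
  qed
qed

lemma smooth_flat_exp: "smooth (flat_exp q)"
  by (rule smooth_coinduct[where P = "\<lambda>h. \<exists>q. h = flat_exp q"]) (use flat_exp_deriv in blast)+

text \<open>The support lies at distance at least 1/(n+1) from both endpoints and exhausts (0,1).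
  There is no plateau of value 1: bounded pointwise convergence to 1 is enough for dominated
  convergence. For n <= 1 the two factors have disjoint supports.\<close>

definition cutoff :: "nat \<Rightarrow> real \<Rightarrow> real" where
  "cutoff n t = flat_exp 1 (real (Suc n) * t - 1) * flat_exp 1 (real (Suc n) * (1 - t) - 1)"

lemma flat_exp_1_bounds: "0 \<le> flat_exp 1 x" "flat_exp 1 x \<le> 1"
  by (auto simp: flat_exp_def)

lemma cutoff_bounds: "0 \<le> cutoff n t" "cutoff n t \<le> 1"
  by (auto simp: cutoff_def flat_exp_1_bounds intro!: mult_le_one mult_nonneg_nonneg)

section \<open>Supports of test functions and convergence of the cutoffs\<close>

lemma test_functionI:
  assumes "smooth f" "0 < a" "b < 1" "\<And>t. f t \<noteq> 0 \<Longrightarrow> a \<le> t \<and> t \<le> b"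
  shows "test_function f"
proof -
  have "{t. f t \<noteq> 0} \<subseteq> {a..b}" using assms(4) by auto
  then have "closure {t. f t \<noteq> 0} \<subseteq> {a..b}" by (rule closure_minimal) simp
  then show ?thesis using assms unfolding test_function_def by auto
qed

lemma test_function_supportE:
  assumes "test_function f"
  obtains a b where "0 < a" "a < b" "b < 1" "\<And>t. f t \<noteq> 0 \<Longrightarrow> a < t \<and> t < b"
proof -
  let ?K = "closure {t. f t \<noteq> 0}"
  have K: "?K \<subseteq> {0<..<1}" using assms by (simp add: test_function_def)
  have "compact ?K"
    using bounded_subset[of "{0..1}" ?K] K by (force simp: compact_eq_bounded_closed)
  show thesis
  proof (cases "?K = {}")
    case True
    then have "f t = 0" for t using closure_subset by fastforce
    then show thesis using that[of "1/3" "1/2"] by simp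
  next
    case False
    obtain x where x: "x \<in> ?K" "\<And>t. t \<in> ?K \<Longrightarrow> x \<le> t"
      using compact_attains_inf[OF \<open>compact ?K\<close> False] by blast
    obtain y where y: "y \<in> ?K" "\<And>t. t \<in> ?K \<Longrightarrow> t \<le> y"
      using compact_attains_sup[OF \<open>compact ?K\<close> False] by blast
    have "0 < x" "x < 1" "0 < y" "y < 1" using x(1) y(1) K by auto
    moreover have "x \<le> y" using x y by blast
    moreover have "x \<le> t \<and> t \<le> y" if "f t \<noteq> 0" for t
      using that x(2) y(2) closure_subset[of "{t. f t \<noteq> 0}"] by blast
    ultimately show thesis using that[of "x/2" "(1+y)/2"] by force
  qed
qed

lemma test_function_smooth: "test_function f \<Longrightarrow> smooth f"
  by (simp add: test_function_def)

lemma test_function_mono: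
  assumes "test_function f" "smooth g" "\<And>t. f t = 0 \<Longrightarrow> g t = 0"
  shows "test_function g"
proof -
  obtain a b where "0 < a" "a < b" "b < 1" "\<And>t. f t \<noteq> 0 \<Longrightarrow> a < t \<and> t < b"
    using test_function_supportE[OF assms(1)] by metis
  then show ?thesis
    by (intro test_functionI[OF assms(2), of a b]) (use assms(3) in force)+
qed

lemma test_function_cutoff: "test_function (cutoff n)"
proof (rule test_functionI[where a = "1 / real (Suc n)" and b = "1 - 1 / real (Suc n)"])
  have "smooth (\<lambda>t. flat_exp 1 (real (Suc n) * t + (-1)) * flat_exp 1 ((- real (Suc n)) * t + real n))"
    by (intro smooth_mult smooth_affine_comp smooth_flat_exp)
  then show "smooth (cutoff n)" by (simp add: cutoff_def[abs_def] algebra_simps)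
  fix t assume "cutoff n t \<noteq> 0"
  then have "0 < real (Suc n) * t - 1" "0 < real (Suc n) * (1 - t) - 1"
    by (auto simp: cutoff_def flat_exp_def split: if_splits)
  then show "1 / real (Suc n) \<le> t \<and> t \<le> 1 - 1 / real (Suc n)"
    by (simp add: field_simps del: of_nat_Suc)
qed (simp_all del: of_nat_Suc)

lemma cutoff_tendsto_1:
  assumes "0 < t" "t < 1"
  shows "(\<lambda>n. cutoff n t) \<longlonglongrightarrow> 1"
proof -
  have *: "(\<lambda>n. flat_exp 1 (real (Suc n) * s - 1)) \<longlonglongrightarrow> 1" if "0 < s" for s
  proof -
    have "filterlim (\<lambda>n. - 1 + s * real (Suc n)) at_top sequentially"
      by (intro filterlim_tendsto_add_at_top[OF tendsto_const]
          filterlim_tendsto_pos_mult_at_top[OF tendsto_const that]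
          filterlim_compose[OF filterlim_real_sequentially filterlim_Suc])
    then have lim: "filterlim (\<lambda>n. real (Suc n) * s - 1) at_top sequentially"
      by (simp add: mult.commute)
    have "((\<lambda>x::real. - 1 / x) \<longlongrightarrow> 0) at_top"
      by (rule tendsto_divide_0[OF tendsto_const filterlim_at_top_imp_at_infinity[OF filterlim_ident]])
    then have "((\<lambda>x::real. exp (- 1 / x)) \<longlongrightarrow> exp 0) at_top"
      by (intro tendsto_intros)
    then have "((\<lambda>x::real. exp (- 1 / x)) \<longlongrightarrow> 1) at_top" by simp
    then have "(flat_exp 1 \<longlongrightarrow> 1) at_top"
      by (rule Lim_transform_eventually)
        (auto simp: flat_exp_def eventually_at_top_dense intro!: exI[of _ 0])
    from filterlim_compose[OF this lim] show ?thesis by simp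
  qed
  show ?thesis
    unfolding cutoff_def using tendsto_mult[OF *[of t] *[of "1 - t"]] assms by simp
qed

subsection \<open>Absolutely continuous functions\<close>

text \<open>The integral form of absolute continuity on $[0,1]$, with density \<open>f'\<close>; it avoids
  differentiation almost everywhere.\<close>

definition abs_cont :: "(real \<Rightarrow> real) \<Rightarrow> (real \<Rightarrow> real) \<Rightarrow> bool" where
  "abs_cont f f' \<longleftrightarrow> f' absolutely_integrable_on {0..1} \<and>
    (\<forall>t\<in>{0..1}. f t = f 0 + integral {0..t} f')"

lemma abs_contD1: "abs_cont f f' \<Longrightarrow> f' absolutely_integrable_on {0..1}"
  by (simp add: abs_cont_def)

lemma abs_contD2: "abs_cont f f' \<Longrightarrow> 0 \<le> t \<Longrightarrow> t \<le> 1 \<Longrightarrow> f t = f 0 + integral {0..t} f'"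
  unfolding abs_cont_def by (meson atLeastAtMost_iff)

lemma abs_contI:
  "f' absolutely_integrable_on {0..1} \<Longrightarrow>
    (\<And>t. 0 \<le> t \<Longrightarrow> t \<le> 1 \<Longrightarrow> f t = c + integral {0..t} f') \<Longrightarrow> abs_cont f f'"
  unfolding abs_cont_def by simp

lemma absolutely_integrable_sub:
  fixes f :: "real \<Rightarrow> real"
  assumes "f absolutely_integrable_on {0..1}" "0 \<le> s" "t \<le> 1"
  shows "f absolutely_integrable_on {s..t}"
  using absolutely_integrable_on_subinterval[OF assms(1), of s t] assms by auto

lemma abs_cont_integrable:
  assumes "abs_cont f f'" "0 \<le> s" "t \<le> 1"
  shows "f' integrable_on {s..t}"
  by (rule set_lebesgue_integral_eq_integral(1)[OF
        absolutely_integrable_sub[OF abs_contD1[OF assms(1)] assms(2,3)]])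

lemma abs_cont_diff_eq:
  assumes "abs_cont f f'" "0 \<le> s" "s \<le> t" "t \<le> 1"
  shows "f t - f s = integral {s..t} f'"
proof -
  have "integral {0..s} f' + integral {s..t} f' = integral {0..t} f'"
    using assms by (intro Henstock_Kurzweil_Integration.integral_combine abs_cont_integrable) auto
  then show ?thesis using abs_contD2[OF assms(1), of s] abs_contD2[OF assms(1), of t] assms(2-) by linarith
qed

lemma abs_cont_continuous:
  assumes "abs_cont f f'"
  shows "continuous_on {0..1} f"
proof -
  have "continuous_on {0..1} (\<lambda>t. f 0 + integral {0..t} f')"
    using assms by (intro continuous_intros indefinite_integral_continuous_1 abs_cont_integrable) auto
  then show ?thesis
    by (rule continuous_on_eq) (use abs_contD2[OF assms, symmetric] in simp)
qed

lemma abs_cont_C1: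
  assumes "\<And>t. t \<in> {0..1} \<Longrightarrow> (f has_vector_derivative f' t) (at t within {0..1})"
    "continuous_on {0..1} f'"
  shows "abs_cont f f'"
proof (rule abs_contI[where c = "f 0"])
  show "f' absolutely_integrable_on {0..1}"
    using assms(2) by (rule absolutely_integrable_continuous_real)
  fix t :: real assume t: "0 \<le> t" "t \<le> 1"
  have "(f' has_integral f t - f 0) {0..t}"
    using t by (intro fundamental_theorem_of_calculus)
      (auto intro!: has_vector_derivative_within_subset[OF assms(1)])
  then show "f t = f 0 + integral {0..t} f'" by (simp add: integral_unique)
qed

lemma abs_cont_smooth:
  "smooth f \<Longrightarrow> abs_cont f (\<lambda>t. vector_derivative f (at t))"
  by (rule abs_cont_C1)
    (auto intro: has_vector_derivative_at_within smooth_imp_has_vector_derivative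
      smooth_continuous_on smooth_deriv)

text \<open>The regularity upgrade used throughout: once a density has been replaced, off a null
  set, by a continuous function (\<open>abs_cont_cong_ae\<close>), the integral relation becomes a
  classical derivative, one-sided at 0 and 1.\<close>

lemma abs_cont_deriv:
  assumes "abs_cont f f'" "continuous_on {0..1} f'" "t \<in> {0..1}"
  shows "(f has_vector_derivative f' t) (at t within {0..1})"
proof -
  have "((\<lambda>t. f 0 + integral {0..t} f') has_vector_derivative f' t) (at t within {0..1})"
    using integral_has_vector_derivative[OF assms(2,3)]
    by (auto intro!: derivative_eq_intros)
  then show ?thesis
    by (rule has_vector_derivative_transform[OF assms(3), rotated])
      (use abs_contD2[OF assms(1), symmetric] in simp)
qed

lemma abs_cont_cong_ae:
  assumes "abs_cont f f'" "negligible N" "\<And>t. t \<in> {0..1} - N \<Longrightarrow> g t = f' t"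
  shows "abs_cont f g"
proof (rule abs_contI[where c = "f 0"])
  show "g absolutely_integrable_on {0..1}"
    using absolutely_integrable_spike[OF abs_contD1[OF assms(1)] assms(2,3)] .
  fix t :: real assume t: "0 \<le> t" "t \<le> 1"
  have "integral {0..t} g = integral {0..t} f'"
    using t assms(3) by (intro integral_spike[OF assms(2)]) force
  then show "f t = f 0 + integral {0..t} g" using abs_contD2[OF assms(1) t] by simp
qed

lemma abs_cont_cong:
  assumes "abs_cont f f'" "\<And>t. t \<in> {0..1} \<Longrightarrow> g t = f t"
  shows "abs_cont g f'"
proof (rule abs_contI[where c = "f 0", OF abs_contD1[OF assms(1)]])
  fix t :: real assume "0 \<le> t" "t \<le> 1"
  then show "g t = f 0 + integral {0..t} f'" using abs_contD2[OF assms(1), of t] assms(2)[of t] by simp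
qed

lemma abs_cont_indefinite:
  assumes "f absolutely_integrable_on {0..1}"
  shows "abs_cont (\<lambda>t. integral {0..t} f) f"
  by (rule abs_contI[where c = 0, OF assms]) simp

lemma absolutely_integrable_mult_continuous:
  fixes f g :: "real \<Rightarrow> real"
  assumes "f absolutely_integrable_on {a..b}" "continuous_on {a..b} g"
  shows "(\<lambda>t. g t * f t) absolutely_integrable_on {a..b}"
proof (rule absolutely_integrable_bounded_measurable_product_real[OF _ _ _ assms(1)])
  show "g \<in> borel_measurable (lebesgue_on {a..b})"
    using assms(2) by (intro continuous_imp_measurable_on_sets_lebesgue) auto
  show "bounded (g ` {a..b})"
    by (intro compact_imp_bounded compact_continuous_image assms(2)) simp
qed simp

lemma abs_cont_add:
  assumes "abs_cont f f'" "abs_cont g g'"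
  shows "abs_cont (\<lambda>t. f t + g t) (\<lambda>t. f' t + g' t)"
proof (rule abs_contI[where c = "f 0 + g 0"])
  show "(\<lambda>t. f' t + g' t) absolutely_integrable_on {0..1}"
    by (intro set_integral_add(1) abs_contD1[OF assms(1)] abs_contD1[OF assms(2)])
  fix t :: real assume t: "0 \<le> t" "t \<le> 1"
  have "integral {0..t} (\<lambda>t. f' t + g' t) = integral {0..t} f' + integral {0..t} g'"
    using t by (intro Henstock_Kurzweil_Integration.integral_add abs_cont_integrable[OF assms(1)]
        abs_cont_integrable[OF assms(2)]) auto
  then show "f t + g t = f 0 + g 0 + integral {0..t} (\<lambda>t. f' t + g' t)"
    using abs_contD2[OF assms(1) t] abs_contD2[OF assms(2) t] by linarith
qed

lemma abs_cont_cmult: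
  assumes "abs_cont f f'"
  shows "abs_cont (\<lambda>t. c * f t) (\<lambda>t. c * f' t)"
proof (rule abs_contI[where c = "c * f 0"])
  show "(\<lambda>t. c * f' t) absolutely_integrable_on {0..1}"
    using abs_contD1[OF assms] by simp
  fix t :: real assume "0 \<le> t" "t \<le> 1"
  from abs_contD2[OF assms this] have "c * f t = c * (f 0 + integral {0..t} f')" by simp
  then show "c * f t = c * f 0 + integral {0..t} (\<lambda>t. c * f' t)" by (simp add: distrib_left)
qed

lemma abs_cont_diff:
  assumes "abs_cont f f'" "abs_cont g g'"
  shows "abs_cont (\<lambda>t. f t - g t) (\<lambda>t. f' t - g' t)"
  using abs_cont_add[OF assms(1) abs_cont_cmult[OF assms(2), of "-1"]] by simp

text \<open>Summing the local bound over a fine uniform partition shows that $F - \int F'$ is constant.\<close>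

lemma abs_cont_criterion:
  assumes F': "F' absolutely_integrable_on {0..1}" and m: "m absolutely_integrable_on {0..1}"
    and est: "\<And>e. e > 0 \<Longrightarrow> \<exists>d>0. \<forall>s t. 0 \<le> s \<longrightarrow> s \<le> t \<longrightarrow> t \<le> 1 \<longrightarrow> t - s < d \<longrightarrow>
      \<bar>F t - F s - integral {s..t} F'\<bar> \<le> e * integral {s..t} m"
  shows "abs_cont F F'"
proof (rule abs_contI[where c = "F 0", OF F'])
  fix b :: real assume b: "0 \<le> b" "b \<le> 1"
  let ?P = "\<lambda>t. F t - F 0 - integral {0..t} F'"
  have int: "f integrable_on {s..t}" if "f absolutely_integrable_on {0..1}" "0 \<le> s" "t \<le> 1"
    for f :: "real \<Rightarrow> real" and s t
    using absolutely_integrable_sub[OF that] set_lebesgue_integral_eq_integral(1) by blast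
  have *: "\<bar>?P b\<bar> \<le> e * integral {0..b} m" if e: "e > 0" for e
  proof -
    obtain d where d: "d > 0" "\<And>s t. 0 \<le> s \<Longrightarrow> s \<le> t \<Longrightarrow> t \<le> 1 \<Longrightarrow> t - s < d \<Longrightarrow>
      \<bar>F t - F s - integral {s..t} F'\<bar> \<le> e * integral {s..t} m"
      using est[OF e] by blast
    obtain n :: nat where n: "n > 0" "1 / real n < d"
      using d(1) by (metis nat_approx_posE zero_less_Suc)
    have step: "real i * b / n \<le> b" if "i \<le> n" for i
      using that n b by (simp add: field_simps mult_mono)
    have "\<bar>?P (real i * b / n)\<bar> \<le> e * integral {0..real i * b / n} m" if "i \<le> n" for i
      using that
    proof (induction i)
      case 0
      then show ?case by simp
    next
      case (Suc i)
      define s where "s = real i * b / n"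
      define t where "t = real (Suc i) * b / n"
      have st: "0 \<le> s" "s \<le> t" "t \<le> 1" "t - s < d"
      proof -
        show "0 \<le> s" "s \<le> t" using b n by (auto simp: s_def t_def field_simps)
        show "t \<le> 1" using step[OF Suc.prems] b by (simp add: t_def)
        have "t - s = b / n" by (simp add: s_def t_def distrib_right add_divide_distrib)
        also have "\<dots> \<le> 1 / n" using b by (simp add: divide_right_mono)
        finally show "t - s < d" using n by simp
      qed
      have c: "integral {0..t} f = integral {0..s} f + integral {s..t} f"
        if "f absolutely_integrable_on {0..1}" for f :: "real \<Rightarrow> real"
        using st
        by (intro Henstock_Kurzweil_Integration.integral_combine[symmetric] int that) auto
      have "\<bar>?P t\<bar> \<le> \<bar>?P s\<bar> + \<bar>F t - F s - integral {s..t} F'\<bar>"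
        using c[OF F'] by linarith
      also have "\<dots> \<le> e * integral {0..s} m + e * integral {s..t} m"
        using Suc d(2)[OF st] by (simp add: s_def)
      also have "\<dots> = e * integral {0..t} m" using c[OF m] by (simp add: distrib_left)
      finally show ?case by (simp add: t_def)
    qed
    from this[of n] show ?thesis using n by simp
  qed
  have "\<bar>?P b\<bar> \<le> 0"
  proof (rule field_le_epsilon)
    fix e :: real assume e: "e > 0"
    let ?I = "integral {0..b} m"
    \<comment> \<open>The absolute value is there because m carries no sign assumption, the summand
      1 because its integral may vanish.\<close>
    have "\<bar>?P b\<bar> \<le> e / (\<bar>?I\<bar> + 1) * ?I" using e by (intro *) auto
    also have "\<dots> \<le> e / (\<bar>?I\<bar> + 1) * (\<bar>?I\<bar> + 1)" using e by (intro mult_left_mono) auto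
    also have "\<dots> = e" by (simp add: add_nonneg_eq_0_iff)
    finally show "\<bar>?P b\<bar> \<le> 0 + e" by simp
  qed
  then show "F b = F 0 + integral {0..b} F'" by simp
qed

lemma uniformly_small_increments:
  fixes f :: "real \<Rightarrow> real"
  assumes "continuous_on {0..1} f" "e > 0"
  obtains d where "d > 0"
    "\<And>s t. s \<in> {0..1} \<Longrightarrow> t \<in> {0..1} \<Longrightarrow> \<bar>t - s\<bar> < d \<Longrightarrow> \<bar>f t - f s\<bar> < e"
  using compact_uniformly_continuous[OF assms(1)] assms(2)
  unfolding uniformly_continuous_on_def dist_real_def by (metis compact_Icc)

text \<open>On a short interval [s,t] the increment of the product is exactly the integral of g(t)
  f' + f(s) g', with both factors frozen. Unfreezing them costs at most the oscillations of f and g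
  times |f'| + |g'|.\<close>

lemma abs_cont_mult:
  assumes f: "abs_cont f f'" and g: "abs_cont g g'"
  shows "abs_cont (\<lambda>t. f t * g t) (\<lambda>t. g t * f' t + f t * g' t)"
proof (rule abs_cont_criterion[where m = "\<lambda>t. \<bar>f' t\<bar> + \<bar>g' t\<bar>"])
  have f': "f' absolutely_integrable_on {0..1}" and g': "g' absolutely_integrable_on {0..1}"
    by (rule abs_contD1[OF f], rule abs_contD1[OF g])
  note cf = abs_cont_continuous[OF f] and cg = abs_cont_continuous[OF g]
  show "(\<lambda>t. g t * f' t + f t * g' t) absolutely_integrable_on {0..1}"
    by (intro set_integral_add(1) absolutely_integrable_mult_continuous f' g' cf cg)
  show m: "(\<lambda>t. \<bar>f' t\<bar> + \<bar>g' t\<bar>) absolutely_integrable_on {0..1}"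
    by (intro set_integral_add(1) set_integrable_abs f' g')
  fix e :: real assume "e > 0"
  obtain d1 where d1: "d1 > 0" 
    "\<And>s t. s \<in> {0..1} \<Longrightarrow> t \<in> {0..1} \<Longrightarrow> \<bar>t - s\<bar> < d1 \<Longrightarrow> \<bar>f t - f s\<bar> < e"
    using uniformly_small_increments[OF cf \<open>e > 0\<close>] by metis
  obtain d2 where d2: "d2 > 0" 
    "\<And>s t. s \<in> {0..1} \<Longrightarrow> t \<in> {0..1} \<Longrightarrow> \<bar>t - s\<bar> < d2 \<Longrightarrow> \<bar>g t - g s\<bar> < e"
    using uniformly_small_increments[OF cg \<open>e > 0\<close>] by metis
  show "\<exists>d>0. \<forall>s t. 0 \<le> s \<longrightarrow> s \<le> t \<longrightarrow> t \<le> 1 \<longrightarrow> t - s < d \<longrightarrow>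
      \<bar>f t * g t - f s * g s - integral {s..t} (\<lambda>t. g t * f' t + f t * g' t)\<bar>
      \<le> e * integral {s..t} (\<lambda>t. \<bar>f' t\<bar> + \<bar>g' t\<bar>)"
  proof (intro exI[of _ "min d1 d2"] conjI allI impI)
    show "min d1 d2 > 0" using d1(1) d2(1) by simp
    fix s t :: real assume st: "0 \<le> s" "s \<le> t" "t \<le> 1" "t - s < min d1 d2"
    have sub: "{s..t} \<subseteq> {0..1}" using st by auto
    have i: "h integrable_on {s..t}" if "h absolutely_integrable_on {0..1}" for h :: "real \<Rightarrow> real"
      using absolutely_integrable_sub[OF that st(1,3)] set_lebesgue_integral_eq_integral(1) by blast
    have i1: "(\<lambda>u. g t * f' u + f s * g' u) integrable_on {s..t}"
      and i2: "(\<lambda>t. g t * f' t + f t * g' t) integrable_on {s..t}"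
      by (intro i set_integral_add(1) absolutely_integrable_mult_continuous f' g' cf cg
        continuous_on_const)+
    have "f t * g t - f s * g s = g t * (f t - f s) + f s * (g t - g s)"
      by (simp add: algebra_simps)
    also have "\<dots> = g t * integral {s..t} f' + f s * integral {s..t} g'"
      using st by (simp add: abs_cont_diff_eq[OF f] abs_cont_diff_eq[OF g])
    also have "\<dots> = integral {s..t} (\<lambda>u. g t * f' u + f s * g' u)"
      using Henstock_Kurzweil_Integration.integral_add[OF
          integrable_on_mult_right[OF i[OF f'], of "g t"] integrable_on_mult_right[OF i[OF g'], of "f s"]]
      by simp
    finally have "f t * g t - f s * g s - integral {s..t} (\<lambda>t. g t * f' t + f t * g' t) =
        integral {s..t} (\<lambda>u. g t * f' u + f s * g' u - (g u * f' u + f u * g' u))"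
      by (simp add: Henstock_Kurzweil_Integration.integral_diff[OF i1 i2])
    also have "\<bar>\<dots>\<bar> \<le> integral {s..t} (\<lambda>u. e * (\<bar>f' u\<bar> + \<bar>g' u\<bar>))"
      unfolding real_norm_def[symmetric]
    proof (rule Henstock_Kurzweil_Integration.integral_norm_bound_integral)
      show "(\<lambda>u. g t * f' u + f s * g' u - (g u * f' u + f u * g' u)) integrable_on {s..t}"
        by (rule Henstock_Kurzweil_Integration.integrable_diff[OF i1 i2])
      show "(\<lambda>u. e * (norm (f' u) + norm (g' u))) integrable_on {s..t}"
        using integrable_on_mult_right[OF i[OF m], of e] by simp
      fix u assume u: "u \<in> {s..t}"
      have a: "\<bar>g t - g u\<bar> \<le> e" "\<bar>f s - f u\<bar> \<le> e"
        using d1(2)[of u s] d2(2)[of u t] u st by (auto intro!: less_imp_le)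
      have "g t * f' u + f s * g' u - (g u * f' u + f u * g' u) =
          (g t - g u) * f' u + (f s - f u) * g' u" by (simp add: algebra_simps)
      then show "norm (g t * f' u + f s * g' u - (g u * f' u + f u * g' u))
          \<le> e * (norm (f' u) + norm (g' u))"
        using a by (auto simp: abs_mult distrib_left intro!: order_trans[OF abs_triangle_ineq]
            add_mono mult_right_mono)
    qed
    finally show "\<bar>f t * g t - f s * g s - integral {s..t} (\<lambda>t. g t * f' t + f t * g' t)\<bar>
      \<le> e * integral {s..t} (\<lambda>t. \<bar>f' t\<bar> + \<bar>g' t\<bar>)" by simp
  qed
qed

text \<open>The mean value theorem writes the increment of h(f) as h'(x) times that of f, with x
  between f(s) and f(t). Uniform continuity of h' then lets h'(x) be replaced by h'(f(u)) under the
  integral.\<close>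

lemma abs_cont_compose:
  assumes f: "abs_cont f f'" and rng: "f ` {0..1} \<subseteq> {a..b}"
    and h: "\<And>x. x \<in> {a..b} \<Longrightarrow> (h has_real_derivative h' x) (at x)"
    and h': "continuous_on {a..b} h'"
  shows "abs_cont (\<lambda>t. h (f t)) (\<lambda>t. h' (f t) * f' t)"
proof (rule abs_cont_criterion[where m = "\<lambda>t. \<bar>f' t\<bar>"])
  have f': "f' absolutely_integrable_on {0..1}" by (rule abs_contD1[OF f])
  note cf = abs_cont_continuous[OF f]
  have ch: "continuous_on {0..1} (\<lambda>t. h' (f t))"
    by (rule continuous_on_compose2[OF h' cf rng])
  show "(\<lambda>t. h' (f t) * f' t) absolutely_integrable_on {0..1}"
    by (intro absolutely_integrable_mult_continuous f' ch)
  show m: "(\<lambda>t. \<bar>f' t\<bar>) absolutely_integrable_on {0..1}"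
    by (intro set_integrable_abs f')
  fix e :: real assume "e > 0"
  then obtain r where r: "r > 0"
    "\<And>x y. x \<in> {a..b} \<Longrightarrow> y \<in> {a..b} \<Longrightarrow> \<bar>y - x\<bar> < r \<Longrightarrow> \<bar>h' y - h' x\<bar> < e"
    using compact_uniformly_continuous[OF h'] 
    unfolding uniformly_continuous_on_def dist_real_def by (metis compact_Icc)
  \<comment> \<open>Half of r, because x and f(u) are compared through f(s).\<close>
  obtain d where d: "d > 0" 
    "\<And>s t. s \<in> {0..1} \<Longrightarrow> t \<in> {0..1} \<Longrightarrow> \<bar>t - s\<bar> < d \<Longrightarrow> \<bar>f t - f s\<bar> < r / 2"
    using uniformly_small_increments[OF cf, of "r / 2"] r(1) by (metis half_gt_zero)
  show "\<exists>d>0. \<forall>s t. 0 \<le> s \<longrightarrow> s \<le> t \<longrightarrow> t \<le> 1 \<longrightarrow> t - s < d \<longrightarrow>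
      \<bar>h (f t) - h (f s) - integral {s..t} (\<lambda>t. h' (f t) * f' t)\<bar> \<le> e * integral {s..t} (\<lambda>t. \<bar>f' t\<bar>)"
  proof (intro exI[of _ d] conjI allI impI d(1))
    fix s t :: real assume st: "0 \<le> s" "s \<le> t" "t \<le> 1" "t - s < d"
    have i: "k integrable_on {s..t}" if "k absolutely_integrable_on {0..1}" for k :: "real \<Rightarrow> real"
      using absolutely_integrable_sub[OF that st(1,3)] set_lebesgue_integral_eq_integral(1) by blast
    have fst: "f s \<in> {a..b}" "f t \<in> {a..b}"
      by (rule subsetD[OF rng], use st in simp)+
    obtain x where x: "x \<in> {a..b}" "\<bar>x - f s\<bar> \<le> \<bar>f t - f s\<bar>" "h (f t) - h (f s) = h' x * (f t - f s)"
    proof -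
      consider "f s < f t" | "f t < f s" | "f s = f t" by linarith
      then show thesis
      proof cases
        case 1
        then have "\<exists>x. f s < x \<and> x < f t \<and> h (f t) - h (f s) = (f t - f s) * h' x"
          using fst by (intro MVT2 h) auto
        then obtain x where x: "f s < x" "x < f t" "h (f t) - h (f s) = (f t - f s) * h' x" by blast
        then show thesis using fst by (intro that[of x]) (auto simp: algebra_simps)
      next
        case 2
        then have "\<exists>x. f t < x \<and> x < f s \<and> h (f s) - h (f t) = (f s - f t) * h' x"
          using fst by (intro MVT2 h) auto
        then obtain x where x: "f t < x" "x < f s" "h (f s) - h (f t) = (f s - f t) * h' x" by blast
        then show thesis using fst by (intro that[of x]) (auto simp: algebra_simps)
      next
        case 3
        then show thesis using that[of "f s"] fst by auto
      qed
    qed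
    have i1: "(\<lambda>u. h' x * f' u) integrable_on {s..t}"
      and i2: "(\<lambda>t. h' (f t) * f' t) integrable_on {s..t}"
      by (intro i absolutely_integrable_mult_continuous f' ch continuous_on_const)+
    have "h (f t) - h (f s) - integral {s..t} (\<lambda>t. h' (f t) * f' t) =
        integral {s..t} (\<lambda>u. h' x * f' u - h' (f u) * f' u)"
      using st by (simp add: x(3) abs_cont_diff_eq[OF f] Henstock_Kurzweil_Integration.integral_diff[OF i1 i2])
    also have "\<bar>\<dots>\<bar> \<le> integral {s..t} (\<lambda>u. e * \<bar>f' u\<bar>)"
      unfolding real_norm_def[symmetric]
    proof (rule Henstock_Kurzweil_Integration.integral_norm_bound_integral)
      show "(\<lambda>u. h' x * f' u - h' (f u) * f' u) integrable_on {s..t}"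
        by (rule Henstock_Kurzweil_Integration.integrable_diff[OF i1 i2])
      show "(\<lambda>u. e * norm (f' u)) integrable_on {s..t}"
        using integrable_on_mult_right[OF i[OF m], of e] by simp
      fix u assume u: "u \<in> {s..t}"
      have "\<bar>f t - f s\<bar> < r / 2" "\<bar>f u - f s\<bar> < r / 2" using d(2)[of s t] d(2)[of s u] u st by auto
      then have "\<bar>x - f u\<bar> < r" using x(2) by linarith
      then have "\<bar>h' x - h' (f u)\<bar> \<le> e" 
        using r(2)[OF subsetD[OF rng imageI] x(1), of u] u st by simp
      then have "\<bar>(h' x - h' (f u)) * f' u\<bar> \<le> e * \<bar>f' u\<bar>"
        by (simp add: abs_mult mult_right_mono)
      then show "norm (h' x * f' u - h' (f u) * f' u) \<le> e * norm (f' u)"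
        by (simp add: left_diff_distrib)
    qed
    finally show "\<bar>h (f t) - h (f s) - integral {s..t} (\<lambda>t. h' (f t) * f' t)\<bar>
        \<le> e * integral {s..t} (\<lambda>t. \<bar>f' t\<bar>)" by simp
  qed
qed

lemma test_function_endpoints:
  assumes "test_function f"
  shows "f 0 = 0" "f 1 = 0"
  using test_function_supportE[OF assms] by (metis not_less_iff_gr_or_eq order_less_trans)+

lemma integral_by_parts_test:
  assumes f: "abs_cont f f'" and \<phi>: "test_function \<phi>"
  shows "integral {0..1} (\<lambda>t. vector_derivative \<phi> (at t) * f t) = - integral {0..1} (\<lambda>t. \<phi> t * f' t)"
proof -
  let ?d = "\<lambda>t. vector_derivative \<phi> (at t)"
  have s: "smooth \<phi>" using \<phi> by (rule test_function_smooth)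
  have d: "abs_cont \<phi> ?d" using s by (rule abs_cont_smooth)
  have i1: "(\<lambda>t. f t * ?d t) integrable_on {0..1}"
    by (intro integrable_continuous_real continuous_on_mult abs_cont_continuous[OF f]
      smooth_continuous_on smooth_deriv s)
  have i2: "(\<lambda>t. \<phi> t * f' t) integrable_on {0..1}"
    using absolutely_integrable_mult_continuous[OF _ abs_cont_continuous[OF d], of f'] f
    by (meson abs_cont_def set_lebesgue_integral_eq_integral(1))
  have "\<phi> 1 * f 1 - \<phi> 0 * f 0 = integral {0..1} (\<lambda>t. f t * ?d t + \<phi> t * f' t)"
    using abs_cont_diff_eq[OF abs_cont_mult[OF d f]] by simp
  then show ?thesis
    using Henstock_Kurzweil_Integration.integral_add[OF i1 i2] test_function_endpoints[OF \<phi>]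
    by (simp add: mult.commute)
qed

subsection \<open>The fundamental lemma of the calculus of variations\<close>

text \<open>Testing with polynomial approximations of the sign of $f$, cut off near the endpoints,
  yields $\int |f| = 0$.\<close>

lemma fundamental_lemma:
  assumes f: "f absolutely_integrable_on {0..1}"
    and orth: "\<And>\<phi>. test_function \<phi> \<Longrightarrow> integral {0..1} (\<lambda>t. \<phi> t * f t) = 0"
  shows "negligible {t\<in>{0..1}. f t \<noteq> (0::real)}"
proof -
  define F where "F t = (if t \<in> {0..1} then f t else 0)" for t
  have "F absolutely_integrable_on UNIV"
    unfolding F_def using absolutely_integrable_restrict_UNIV[of "{0..1}" f] f by simp
  then have "F \<in> borel_measurable lebesgue"
    using absolutely_integrable_measurable[of UNIV F] by (simp add: lebesgue_on_UNIV_eq)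
  then have "(\<lambda>t. sgn (F t)) \<in> borel_measurable lebesgue" by measurable
  then have "(\<lambda>t. sgn (F t)) measurable_on UNIV"
    by (intro lebesgue_measurable_imp_measurable_on) auto
  then obtain N g where N: "negligible N" and g: "\<And>n. continuous_on UNIV (g n)"
    and lim: "\<And>x. x \<notin> N \<Longrightarrow> (\<lambda>n. g n x) \<longlonglongrightarrow> sgn (F x)"
    unfolding measurable_on_def by auto
  \<comment> \<open>Clipping to [-1,1] does not disturb the limit, which is a sign. It bounds the
    polynomials within 1/(n+1) by 2, whence the dominating function 2 |f|.\<close>
  define c where "c n x = max (- 1) (min 1 (g n x))" for n x
  have c: "continuous_on {0..1} (c n)" for n
    unfolding c_def by (intro continuous_intros continuous_on_subset[OF g]) auto
  have "\<exists>q. real_polynomial_function q \<and> (\<forall>x\<in>{0..1}. \<bar>c n x - q x\<bar> < 1 / real (Suc n))" for n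
    by (rule Stone_Weierstrass_real_polynomial_function[OF _ c, of "1 / real (Suc n)" n]) auto
  then obtain q where q: "\<And>n. real_polynomial_function (q n)"
    "\<And>n x. x \<in> {0..1} \<Longrightarrow> \<bar>c n x - q n x\<bar> < 1 / real (Suc n)" by metis
  have cb: "\<bar>c n x\<bar> \<le> 1" for n x by (simp add: c_def)
  have qb: "\<bar>q n x\<bar> \<le> 2" if "x \<in> {0..1}" for n x
  proof -
    have "1 / real (Suc n) \<le> 1" by simp
    then show ?thesis using q(2)[OF that, of n] cb[of n x] by linarith
  qed
  have qlim: "(\<lambda>n. q n x) \<longlonglongrightarrow> sgn (F x)" if "x \<in> {0..1} - N" for x
  proof -
    have "(\<lambda>n. c n x) \<longlonglongrightarrow> max (- 1) (min 1 (sgn (F x)))"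
      unfolding c_def using that by (intro tendsto_intros lim) auto
    then have 1: "(\<lambda>n. c n x) \<longlonglongrightarrow> sgn (F x)" by (simp add: sgn_if)
    have "(\<lambda>n. c n x - q n x) \<longlonglongrightarrow> 0"
      by (rule Lim_null_comparison[OF _ LIMSEQ_Suc[OF lim_1_over_n]])
        (use q(2)[of x] that in \<open>auto intro!: always_eventually less_imp_le simp: inverse_eq_divide\<close>)
    from tendsto_diff[OF 1 this] show ?thesis by simp
  qed
  \<comment> \<open>The endpoints are discarded because every cutoff vanishes there and does not
    tend to 1.\<close>
  define M where "M = N \<union> {0, 1}"
  have M: "negligible M" unfolding M_def using N by simp
  define G where "G n x = (if x \<in> M then 0 else cutoff n x * q n x * f x)" for n x
  define G' where "G' x = (if x \<in> M then 0 else \<bar>f x\<bar>)" for x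
  have test: "test_function (\<lambda>x. cutoff n x * q n x)" for n
    by (rule test_function_mono[OF test_function_cutoff[of n]])
      (simp_all add: smooth_mult test_function_smooth test_function_cutoff
        smooth_real_polynomial_function q(1))
  have G0: "integral {0..1} (G n) = 0" for n
  proof -
    have "integral {0..1} (G n) = integral {0..1} (\<lambda>x. cutoff n x * q n x * f x)"
      by (rule integral_spike[OF M]) (auto simp: G_def)
    then show ?thesis using orth[OF test] by simp
  qed
  have "(\<lambda>n. integral {0..1} (G n)) \<longlonglongrightarrow> integral {0..1} G'"
  proof (rule dominated_convergence(2))
    show "(\<lambda>x. 2 * \<bar>f x\<bar>) integrable_on {0..1}"
      using f by (auto simp: absolutely_integrable_on_def)
    show "G n integrable_on {0..1}" for n
    proof (rule integrable_spike[OF _ M])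
      show "(\<lambda>x. cutoff n x * q n x * f x) integrable_on {0..1}"
        by (intro set_lebesgue_integral_eq_integral(1) absolutely_integrable_mult_continuous f
          smooth_continuous_on test_function_smooth test)
    qed (auto simp: G_def)
    show "norm (G n x) \<le> 2 * \<bar>f x\<bar>" if "x \<in> {0..1}" for n x
    proof -
      have "\<bar>cutoff n x * q n x\<bar> \<le> 1 * 2"
        unfolding abs_mult using cutoff_bounds[of n x] qb[OF that, of n] by (intro mult_mono) auto
      then show ?thesis by (auto simp: G_def abs_mult intro!: mult_right_mono)
    qed
    show "(\<lambda>n. G n x) \<longlonglongrightarrow> G' x" if "x \<in> {0..1}" for x
    proof (cases "x \<in> M")
      case False
      then have x: "0 < x" "x < 1" "x \<in> {0..1} - N" using that by (auto simp: M_def less_le)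
      have "(\<lambda>n. cutoff n x * q n x * f x) \<longlonglongrightarrow> 1 * sgn (F x) * f x"
        by (intro tendsto_intros cutoff_tendsto_1 qlim x)
      moreover have "1 * sgn (F x) * f x = \<bar>f x\<bar>" using that by (simp add: F_def abs_sgn mult.commute)
      ultimately show ?thesis using False by (simp add: G_def G'_def)
    qed (simp add: G_def G'_def)
  qed
  then have "integral {0..1} G' = 0" using G0 by (simp add: LIMSEQ_const_iff)
  moreover have "integral {0..1} G' = integral {0..1} (\<lambda>x. \<bar>f x\<bar>)"
    by (rule integral_spike[OF M]) (auto simp: G'_def)
  ultimately have 0: "integral {0..1} (\<lambda>x. \<bar>f x\<bar>) = 0" by simp
  let ?h = "\<lambda>x. indicat_real {0..1} x *\<^sub>R \<bar>f x\<bar>"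
  have abs: "(\<lambda>x. \<bar>f x\<bar>) absolutely_integrable_on {0..1}" by (intro set_integrable_abs f)
  have "integrable lebesgue ?h" using abs unfolding set_integrable_def .
  moreover have "integral\<^sup>L lebesgue ?h = 0"
    using set_lebesgue_integral_eq_integral(2)[OF abs] 0 unfolding set_lebesgue_integral_def by metis
  moreover have "AE x in lebesgue. 0 \<le> ?h x" by (rule AE_I2) simp
  ultimately have "AE x in lebesgue. ?h x = 0"
    using integral_nonneg_eq_0_iff_AE by blast
  then have "AE x in lebesgue. x \<notin> {t\<in>{0..1}. f t \<noteq> 0}"
    by (rule eventually_mono) (auto simp: indicator_def split: if_splits)
  then show ?thesis
    unfolding negligible_iff_null_sets completion.null_sets_iff_AE by simp
qed

text \<open>The primitive starting at 0 vanishes to the left of the support of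
  \<open>\<psi>\<close>, and to its right because the total integral is 0.\<close>

lemma test_function_antiderivative:
  assumes \<psi>: "test_function \<psi>" and int: "integral {0..1} \<psi> = (0::real)"
  obtains \<phi> where "test_function \<phi>" "\<And>t. (\<phi> has_vector_derivative \<psi> t) (at t)"
proof -
  obtain a b where ab: "0 < a" "a < b" "b < 1" and supp: "\<And>t. \<psi> t \<noteq> 0 \<Longrightarrow> a < t \<and> t < b"
    using test_function_supportE[OF \<psi>] by metis
  define \<phi> where "\<phi> t = integral {0..t} \<psi>" for t
  have c: "continuous_on S \<psi>" for S using \<psi> by (intro smooth_continuous_on test_function_smooth)
  have z1: "\<phi> t = 0" if "t \<le> a" for t
    unfolding \<phi>_def by (rule integral_unique[OF has_integral_is_0]) (use supp that in force)
  have z2: "\<phi> t = 0" if "b \<le> t" for t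
  proof -
    have int_bt: "integral {b..s} \<psi> = 0" for s
      by (rule integral_unique[OF has_integral_is_0]) (use supp in force)
    have i: "\<psi> integrable_on {0..s}" for s by (intro integrable_continuous_real c)
    have "\<phi> s = integral {0..b} \<psi>" if "b \<le> s" for s
      using Henstock_Kurzweil_Integration.integral_combine[OF _ that i] ab int_bt by (simp add: \<phi>_def)
    from this[of t] this[of 1] show ?thesis using int that ab by (simp add: \<phi>_def)
  qed
  have d: "(\<phi> has_vector_derivative \<psi> t) (at t)" for t
  proof (cases "t < a")
    case True
    have "(\<phi> has_vector_derivative 0) (at t)"
      by (rule has_vector_derivative_transform_within_open[of "\<lambda>_. 0" _ _ "{..<a}"])
        (use True z1 in auto)
    moreover have "\<psi> t = 0" using supp[of t] True by force
    ultimately show ?thesis by simp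
  next
    case False
    \<comment> \<open>Integration starts at 0, so the fundamental theorem gives a two-sided
      derivative only for t > 0. The remaining t lie to the left of the support and belong to the
      previous case.\<close>
    then have t: "t \<in> {0<..<t + 1}" using ab by auto
    have "(\<phi> has_vector_derivative \<psi> t) (at t within {0..t + 1})"
      unfolding \<phi>_def by (rule integral_has_vector_derivative[OF c]) (use t in auto)
    then have "(\<phi> has_vector_derivative \<psi> t) (at t within {0<..<t + 1})"
      by (rule has_vector_derivative_within_subset) auto
    then show ?thesis using has_vector_derivative_within_open[OF t open_greaterThanLessThan] by blast
  qed
  show thesis
  proof (rule that[OF _ d])
    show "test_function \<phi>"
    proof (rule test_functionI[OF smooth_antideriv[OF d test_function_smooth[OF \<psi>]] ab(1,3)])
      show "a \<le> t \<and> t \<le> b" if "\<phi> t \<noteq> 0" for t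
        using that z1[of t] z2[of t] by (meson le_cases)
    qed
  qed
qed

lemma test_function_unit_integral:
  obtains \<psi> :: "real \<Rightarrow> real" where "test_function \<psi>" "integral {0..1} \<psi> = 1"
proof -
  \<comment> \<open>The index 2 is the least one for which the cutoff is not identically zero; its
    support is [1/3, 2/3].\<close>
  have "cutoff 2 (1/2) \<noteq> 0" by (simp add: cutoff_def flat_exp_def)
  moreover have "(1/2::real) \<in> {0..1}" by simp
  ultimately have "integral {0..1} (cutoff 2) \<noteq> 0"
    using integral_eq_0_iff[of 0 1 "cutoff 2"] cutoff_bounds
      smooth_continuous_on[OF test_function_smooth[OF test_function_cutoff]] by (metis zero_less_one)
  moreover have "test_function (\<lambda>t. (1 / integral {0..1} (cutoff 2)) * cutoff 2 t)"
    by (rule test_function_mono[OF test_function_cutoff[of 2]])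
      (simp_all add: smooth_cmult test_function_smooth test_function_cutoff
        del: times_divide_eq_left)
  ultimately show thesis
    using that[of "\<lambda>t. (1 / integral {0..1} (cutoff 2)) * cutoff 2 t"] by simp
qed

lemma test_function_add:
  fixes f g :: "real \<Rightarrow> real"
  assumes "test_function f" "test_function g"
  shows "test_function (\<lambda>t. f t + c * g t)"
proof -
  obtain a b where 1: "0 < a" "a < b" "b < 1" "\<And>t. f t \<noteq> 0 \<Longrightarrow> a < t \<and> t < b"
    using test_function_supportE[OF assms(1)] by metis
  obtain a' b' where 2: "0 < a'" "a' < b'" "b' < 1" "\<And>t. g t \<noteq> 0 \<Longrightarrow> a' < t \<and> t < b'"
    using test_function_supportE[OF assms(2)] by metis
  show ?thesis
  proof (rule test_functionI[of _ "min a a'" "max b b'"])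
    show "smooth (\<lambda>t. f t + c * g t)"
      by (intro smooth_add smooth_cmult test_function_smooth assms)
    fix t assume "f t + c * g t \<noteq> 0"
    then have "f t \<noteq> 0 \<or> g t \<noteq> 0" by auto
    then show "min a a' \<le> t \<and> t \<le> max b b'" using 1(4)[of t] 2(4)[of t] by auto
  qed (use 1 2 in auto)
qed

lemma integral_test_mult_linear:
  fixes f :: "real \<Rightarrow> real"
  assumes f: "f absolutely_integrable_on {0..1}"
    and "test_function \<phi>" "test_function \<psi>"
  shows "integral {0..1} (\<lambda>t. (\<phi> t + c * \<psi> t) * f t) =
    integral {0..1} (\<lambda>t. \<phi> t * f t) + c * integral {0..1} (\<lambda>t. \<psi> t * f t)"
proof -
  have i: "(\<lambda>t. \<rho> t * f t) integrable_on {0..1}" if "test_function \<rho>" for \<rho>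
    by (intro set_lebesgue_integral_eq_integral(1) absolutely_integrable_mult_continuous f
          smooth_continuous_on test_function_smooth that)
  have "(\<lambda>t. (\<phi> t + c * \<psi> t) * f t) = (\<lambda>t. \<phi> t * f t + c * (\<psi> t * f t))"
    by (simp add: algebra_simps)
  then show ?thesis
    using Henstock_Kurzweil_Integration.integral_add[OF i[OF assms(2)]
        integrable_on_mult_right[OF i[OF assms(3)], of c]] by simp
qed

text \<open>Subtracting a multiple of a fixed test function of integral $1$ turns any test function into
  a derivative of a test function.\<close>

lemma functional_on_derivatives:
  fixes T :: "(real \<Rightarrow> real) \<Rightarrow> real"
  assumes lin: "\<And>\<phi> \<psi> c. test_function \<phi> \<Longrightarrow> test_function \<psi> \<Longrightarrow>
      T (\<lambda>t. \<phi> t + c * \<psi> t) = T \<phi> + c * T \<psi>"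
    and zero: "\<And>\<phi>. test_function \<phi> \<Longrightarrow> T (\<lambda>t. vector_derivative \<phi> (at t)) = 0"
  obtains c where "\<And>\<phi>. test_function \<phi> \<Longrightarrow> T \<phi> = c * integral {0..1} \<phi>"
proof -
  obtain \<psi> :: "real \<Rightarrow> real" where \<psi>: "test_function \<psi>" "integral {0..1} \<psi> = 1"
    using test_function_unit_integral by metis
  have "T \<phi> = T \<psi> * integral {0..1} \<phi>" if \<phi>: "test_function \<phi>" for \<phi>
  proof -
    let ?c = "- integral {0..1} \<phi>"
    let ?h = "\<lambda>t. \<phi> t + ?c * \<psi> t"
    have h: "test_function ?h" by (rule test_function_add[OF \<phi> \<psi>(1)])
    have "integral {0..1} (\<lambda>t. ?h t * 1) = integral {0..1} (\<lambda>t. \<phi> t * 1) + ?c * integral {0..1} (\<lambda>t. \<psi> t * 1)"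
      by (rule integral_test_mult_linear[OF _ \<phi> \<psi>(1)]) simp
    then have "integral {0..1} ?h = 0" using \<psi>(2) by simp
    then obtain \<rho> where \<rho>: "test_function \<rho>" "\<And>t. (\<rho> has_vector_derivative ?h t) (at t)"
      using test_function_antiderivative[OF h] by metis
    then have "T ?h = 0" using zero[OF \<rho>(1)] vector_derivative_at[OF \<rho>(2)] by simp
    then show ?thesis using lin[OF \<phi> \<psi>(1), of ?c] by simp
  qed
  then show thesis using that by blast
qed

lemma test_function_deriv:
  assumes "test_function \<phi>"
  shows "test_function (\<lambda>t. vector_derivative \<phi> (at t))"
proof -
  obtain a b where ab: "0 < a" "a < b" "b < 1" "\<And>t. \<phi> t \<noteq> 0 \<Longrightarrow> a < t \<and> t < b"
    using test_function_supportE[OF assms] by metis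
  show ?thesis
  proof (rule test_functionI[OF smooth_deriv[OF test_function_smooth[OF assms]] ab(1,3)])
    fix t assume t: "vector_derivative \<phi> (at t) \<noteq> 0"
    show "a \<le> t \<and> t \<le> b"
    proof (rule ccontr)
      assume "\<not> (a \<le> t \<and> t \<le> b)"
      then have "t \<in> - {a..b}" by auto
      have "(\<phi> has_vector_derivative 0) (at t)"
        by (rule has_vector_derivative_transform_within_open[of "\<lambda>_. 0" _ _ "- {a..b}"])
          (use \<open>t \<in> - {a..b}\<close> ab(4) in force)+
      then show False using t vector_derivative_at by blast
    qed
  qed
qed

text \<open>The functional sending \<open>\<phi>\<close> to the integral of \<open>\<phi>\<close> f
  kills derivatives, hence equals c times the integral of \<open>\<phi>\<close>. The fundamental
  lemma then applies to f - c.\<close>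

lemma du_bois_reymond:
  assumes f: "f absolutely_integrable_on {0..1}"
    and orth: "\<And>\<phi>. test_function \<phi> \<Longrightarrow>
      integral {0..1} (\<lambda>t. vector_derivative \<phi> (at t) * f t) = 0"
  obtains c :: real where "negligible {t\<in>{0..1}. f t \<noteq> c}"
proof -
  obtain c where c: "\<And>\<phi>. test_function \<phi> \<Longrightarrow>
      integral {0..1} (\<lambda>t. \<phi> t * f t) = c * integral {0..1} \<phi>"
  proof (rule functional_on_derivatives[of "\<lambda>\<phi>. integral {0..1} (\<lambda>t. \<phi> t * f t)",
          OF integral_test_mult_linear[OF f] orth])
    fix c assume c: "\<And>\<phi>. test_function \<phi> \<Longrightarrow>
      integral {0..1} (\<lambda>t. \<phi> t * f t) = c * integral {0..1} \<phi>"
    show thesis by (rule that[OF c])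
  qed
  have "negligible {t\<in>{0..1}. f t - c \<noteq> 0}"
  proof (rule fundamental_lemma)
    show "(\<lambda>t. f t - c) absolutely_integrable_on {0..1}"
      by (intro set_integral_diff(1) f) simp
    fix \<phi> :: "real \<Rightarrow> real" assume \<phi>: "test_function \<phi>"
    have i: "(\<lambda>t. \<phi> t * f t) integrable_on {0..1}"
      by (intro set_lebesgue_integral_eq_integral(1) absolutely_integrable_mult_continuous f
          smooth_continuous_on test_function_smooth \<phi>)
    have i': "(\<lambda>t. \<phi> t * c) integrable_on {0..1}"
      by (intro integrable_continuous_real continuous_intros smooth_continuous_on test_function_smooth \<phi>)
    show "integral {0..1} (\<lambda>t. \<phi> t * (f t - c)) = 0"
      using Henstock_Kurzweil_Integration.integral_diff[OF i i'] c[OF \<phi>]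
      by (simp add: right_diff_distrib mult.commute)
  qed
  then show thesis using that[of c] by simp
qed

text \<open>Now it is the integral of \<open>\<phi>'\<close> f that kills derivatives and hence
  equals d times the integral of \<open>\<phi>\<close>. By parts, this is minus the integral of
  \<open>\<phi>'\<close> d t, so f + d t satisfies the first-order lemma.\<close>

lemma du_bois_reymond_2:
  assumes f: "f absolutely_integrable_on {0..1}"
    and orth: "\<And>\<phi>. test_function \<phi> \<Longrightarrow>
      integral {0..1} (\<lambda>t. vector_derivative (\<lambda>s. vector_derivative \<phi> (at s)) (at t) * f t) = 0"
  obtains c d :: real where "negligible {t\<in>{0..1}. f t \<noteq> c + d * t}"
proof -
  let ?T = "\<lambda>\<phi>. integral {0..1} (\<lambda>t. vector_derivative \<phi> (at t) * f t)"
  obtain d where d: "\<And>\<phi>. test_function \<phi> \<Longrightarrow> ?T \<phi> = d * integral {0..1} \<phi>"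
  proof (rule functional_on_derivatives[of ?T])
    fix \<phi> \<psi> :: "real \<Rightarrow> real" and c assume t: "test_function \<phi>" "test_function \<psi>"
    have "vector_derivative (\<lambda>t. \<phi> t + c * \<psi> t) (at t) =
        vector_derivative \<phi> (at t) + c * vector_derivative \<psi> (at t)" for t
      by (rule vector_derivative_at)
        (intro has_vector_derivative_add has_vector_derivative_mult_right
          smooth_imp_has_vector_derivative test_function_smooth t)
    then show "?T (\<lambda>t. \<phi> t + c * \<psi> t) = ?T \<phi> + c * ?T \<psi>"
      using integral_test_mult_linear[OF f test_function_deriv[OF t(1)] test_function_deriv[OF t(2)]]
      by simp
  next
    fix \<phi> :: "real \<Rightarrow> real" assume "test_function \<phi>"
    then show "?T (\<lambda>t. vector_derivative \<phi> (at t)) = 0" by (rule orth)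
  qed blast
  have lin: "abs_cont (\<lambda>t. d * t) (\<lambda>t. d)"
    by (rule abs_cont_C1) (auto intro!: derivative_eq_intros)
  obtain c where "negligible {t\<in>{0..1}. f t + d * t \<noteq> c}"
  proof (rule du_bois_reymond)
    have dt: "(\<lambda>t. d * t) absolutely_integrable_on {0..1}"
      by (intro absolutely_integrable_continuous_real continuous_intros)
    then show "(\<lambda>t. f t + d * t) absolutely_integrable_on {0..1}"
      by (intro set_integral_add(1) f)
    fix \<phi> :: "real \<Rightarrow> real" assume \<phi>: "test_function \<phi>"
    have i: "(\<lambda>t. vector_derivative \<phi> (at t) * g t) integrable_on {0..1}"
      if "g absolutely_integrable_on {0..1}" for g
      by (intro set_lebesgue_integral_eq_integral(1) absolutely_integrable_mult_continuous that
          smooth_continuous_on smooth_deriv test_function_smooth \<phi>)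
    have "integral {0..1} (\<lambda>t. vector_derivative \<phi> (at t) * (d * t)) = - integral {0..1} (\<lambda>t. \<phi> t * d)"
      by (rule integral_by_parts_test[OF lin \<phi>])
    also have "\<dots> = - d * integral {0..1} \<phi>" by (simp add: mult.commute)
    finally show "integral {0..1} (\<lambda>t. vector_derivative \<phi> (at t) * (f t + d * t)) = 0"
      using Henstock_Kurzweil_Integration.integral_add[OF i[OF f] i[OF dt]] d[OF \<phi>]
      by (simp add: distrib_left)
  qed
  moreover have "{t\<in>{0..1}. f t + d * t \<noteq> c} = {t\<in>{0..1}. f t \<noteq> c + (- d) * t}" by auto
  ultimately show thesis using that[of c "- d"] by simp
qed

subsection \<open>Weak derivatives\<close>

text \<open>The bridge from the Lebesgue integrals over (0,1) in the definitions to the gauge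
  integrals over [0,1] used in the calculus here. The null set N accommodates
  \<open>weak_derivative\<close>, which is known only almost everywhere.\<close>

lemma lebesgue_integral_Ioo_eq_ae:
  fixes F E :: "real \<Rightarrow> 'a::euclidean_space"
  assumes E: "E absolutely_integrable_on {0..1}" and N: "negligible N"
    and eq: "\<And>t. t \<in> {0<..<1} - N \<Longrightarrow> F t = E t"
  shows "(LINT t:{0<..<1}|lebesgue. F t) = integral {0..1} E"
proof -
  have "E absolutely_integrable_on {0<..<1}" using E by (simp add: absolutely_integrable_on_Icc_iff_Ioo)
  then have "F absolutely_integrable_on {0<..<1}"
    by (rule absolutely_integrable_spike[OF _ N eq])
  then have "(LINT t:{0<..<1}|lebesgue. F t) = integral {0<..<1} F"
    by (rule set_lebesgue_integral_eq_integral)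
  also have "\<dots> = integral {0<..<1} E"
    by (rule integral_spike[OF N]) (use eq in auto)
  also have "\<dots> = integral {0..1} E"
    by (rule integral_open_interval_real[symmetric])
  finally show ?thesis .
qed

lemma test_mult_locally_integrable:
  fixes f :: "real \<Rightarrow> 'a::euclidean_space" and \<phi> :: "real \<Rightarrow> real"
  assumes f: "locally_integrable f" and \<phi>: "test_function \<phi>"
  shows "(\<lambda>t. \<phi> t *\<^sub>R f t) absolutely_integrable_on {0..1}"
proof -
  obtain a b where ab: "0 < a" "a < b" "b < 1" "\<And>t. \<phi> t \<noteq> 0 \<Longrightarrow> a < t \<and> t < b"
    using test_function_supportE[OF \<phi>] by metis
  have "f absolutely_integrable_on {a..b}"
    using f ab(1-3) unfolding locally_integrable_def
    by (auto elim!: allE[of _ "{a..b}"])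
  moreover have c: "continuous_on {a..b} \<phi>"
    by (intro smooth_continuous_on test_function_smooth \<phi>)
  ultimately have i: "(\<lambda>t. \<phi> t *\<^sub>R f t) absolutely_integrable_on {a..b}"
    by (intro absolutely_integrable_bounded_measurable_product[where h = scaleR]
        continuous_imp_measurable_on_sets_lebesgue compact_imp_bounded compact_continuous_image)
      (auto simp: bilinear_conv_bounded_bilinear bounded_bilinear_scaleR)
  have e1: "{t \<in> {0..1} - {a..b}. \<phi> t *\<^sub>R f t \<noteq> 0} = {}" using ab(4) by force
  have e2: "{t \<in> {a..b} - {0..1}. \<phi> t *\<^sub>R f t \<noteq> 0} = {}" using ab(1-3) by auto
  show ?thesis
    by (rule absolutely_integrable_spike_set[OF i]; subst e1 e2; rule negligible_empty)
qed

lemma absolutely_integrable_vec_nth: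
  fixes f :: "real \<Rightarrow> real^'n"
  shows "f absolutely_integrable_on S \<longleftrightarrow> (\<forall>i. (\<lambda>t. f t $ i) absolutely_integrable_on S)"
  unfolding absolutely_integrable_componentwise_iff[where f = f]
  by (auto simp: Basis_vec_def inner_axis)

lemma LINT_test_mult_nth:
  fixes f :: "real \<Rightarrow> real^'n"
  assumes f: "locally_integrable f" and \<phi>: "test_function \<phi>"
  shows "(LINT t:{0<..<1}|lebesgue. \<phi> t *\<^sub>R f t) $ i = integral {0..1} (\<lambda>t. \<phi> t * f t $ i)"
proof -
  have i: "(\<lambda>t. \<phi> t *\<^sub>R f t) absolutely_integrable_on {0..1}"
    by (rule test_mult_locally_integrable[OF f \<phi>])
  have "(LINT t:{0<..<1}|lebesgue. \<phi> t *\<^sub>R f t) = integral {0..1} (\<lambda>t. \<phi> t *\<^sub>R f t)"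
    by (rule lebesgue_integral_Ioo_eq_ae[OF i negligible_empty]) simp
  then show ?thesis
    using integral_component_eq_cart[OF set_lebesgue_integral_eq_integral(1)[OF i], of i] by simp
qed

lemma has_weak_derivativeD:
  fixes f g :: "real \<Rightarrow> real^'n"
  assumes "has_weak_derivative f g" and \<phi>: "test_function \<phi>"
  shows "integral {0..1} (\<lambda>t. vector_derivative \<phi> (at t) * f t $ i) =
    - integral {0..1} (\<lambda>t. \<phi> t * g t $ i)"
proof -
  have l: "locally_integrable f" "locally_integrable g"
    and eq: "(LINT t:{0<..<1}|lebesgue. vector_derivative \<phi> (at t) *\<^sub>R f t) =
      - (LINT t:{0<..<1}|lebesgue. \<phi> t *\<^sub>R g t)"
    using assms unfolding has_weak_derivative_def by auto
  show ?thesis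
    using arg_cong[OF eq, of "\<lambda>x. x $ i"] LINT_test_mult_nth[OF l(1) test_function_deriv[OF \<phi>], of i]
      LINT_test_mult_nth[OF l(2) \<phi>, of i] by simp
qed

lemma locally_integrableI:
  assumes "f absolutely_integrable_on {0..1}"
  shows "locally_integrable f"
  unfolding locally_integrable_def
proof (intro allI impI)
  fix K :: "real set" assume K: "compact K" "K \<subseteq> {0<..<1}"
  then have "K \<in> sets lebesgue" using lmeasurable_compact by blast
  then show "f absolutely_integrable_on K"
    by (rule set_integrable_subset[OF assms]) (use K in auto)
qed

lemma has_weak_derivativeI:
  fixes f g :: "real \<Rightarrow> real^'n"
  assumes l: "locally_integrable f" "locally_integrable g"
    and "\<And>\<phi> i. test_function \<phi> \<Longrightarrow> integral {0..1} (\<lambda>t. vector_derivative \<phi> (at t) * f t $ i) =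
    - integral {0..1} (\<lambda>t. \<phi> t * g t $ i)"
  shows "has_weak_derivative f g"
  unfolding has_weak_derivative_def
proof (intro conjI allI impI l)
  fix \<phi> :: "real \<Rightarrow> real" assume \<phi>: "test_function \<phi>"
  show "(LINT t:{0<..<1}|lebesgue. vector_derivative \<phi> (at t) *\<^sub>R f t) =
      - (LINT t:{0<..<1}|lebesgue. \<phi> t *\<^sub>R g t)"
    using assms(3)[OF \<phi>]
    by (simp add: vec_eq_iff LINT_test_mult_nth[OF l(1) test_function_deriv[OF \<phi>]] LINT_test_mult_nth[OF l(2) \<phi>])
qed

text \<open>The difference g - h is only locally integrable, so the fundamental lemma is applied to
  its products with the cutoffs. At each interior point some cutoff is positive, and the union of
  the exceptional sets is countable.\<close>

lemma weak_derivative_unique: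
  fixes f g h :: "real \<Rightarrow> real^'n"
  assumes g: "has_weak_derivative f g" and h: "has_weak_derivative f h"
  shows "negligible {t\<in>{0<..<1}. g t \<noteq> h t}"
proof -
  have lg: "locally_integrable g" and lh: "locally_integrable h"
    using g h unfolding has_weak_derivative_def by auto
  let ?N = "\<lambda>n i. {t\<in>{0..1}. cutoff n t * g t $ i - cutoff n t * h t $ i \<noteq> 0}"
  have li: "(\<lambda>t. \<phi> t * u t $ i) absolutely_integrable_on {0..1}"
    if "locally_integrable u" "test_function \<phi>" for u :: "real \<Rightarrow> real^'n" and \<phi> i
    using test_mult_locally_integrable[OF that] absolutely_integrable_vec_nth[where f = "\<lambda>t. \<phi> t *\<^sub>R u t"] by simp
  have "negligible (?N n i)" for n i
  proof (rule fundamental_lemma)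
    show "(\<lambda>t. cutoff n t * g t $ i - cutoff n t * h t $ i) absolutely_integrable_on {0..1}"
      by (intro set_integral_diff(1) li lg lh test_function_cutoff)
    fix \<phi> :: "real \<Rightarrow> real" assume \<phi>: "test_function \<phi>"
    have t: "test_function (\<lambda>t. \<phi> t * cutoff n t)"
      by (rule test_function_mono[OF \<phi>])
        (simp_all add: smooth_mult test_function_smooth \<phi> test_function_cutoff)
    have "(\<lambda>t. \<phi> t * (cutoff n t * g t $ i - cutoff n t * h t $ i)) =
        (\<lambda>t. \<phi> t * cutoff n t * g t $ i - \<phi> t * cutoff n t * h t $ i)"
      by (simp add: algebra_simps)
    then show "integral {0..1} (\<lambda>t. \<phi> t * (cutoff n t * g t $ i - cutoff n t * h t $ i)) = 0"
      using has_weak_derivativeD[OF g t, of i] has_weak_derivativeD[OF h t, of i]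
        Henstock_Kurzweil_Integration.integral_diff[OF
          set_lebesgue_integral_eq_integral(1)[OF li[OF lg t, of i]]
          set_lebesgue_integral_eq_integral(1)[OF li[OF lh t, of i]]]
      by simp
  qed
  then have "negligible (\<Union>n. \<Union>i. ?N n i)"
    by (intro negligible_Union_nat negligible_Union) auto
  moreover have "{t\<in>{0<..<1}. g t \<noteq> h t} \<subseteq> (\<Union>n. \<Union>i. ?N n i)"
  proof
    fix t assume t: "t \<in> {t\<in>{0<..<1}. g t \<noteq> h t}"
    then obtain i where i: "g t $ i \<noteq> h t $ i" by (auto simp: vec_eq_iff)
    have "\<forall>\<^sub>F n in sequentially. cutoff n t > 0"
      using order_tendstoD(1)[OF cutoff_tendsto_1[of t], of 0] t by auto
    then obtain n where n: "cutoff n t > 0" by (auto simp: eventually_sequentially)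
    then have "cutoff n t * (g t $ i - h t $ i) \<noteq> 0" using i by simp
    then have "t \<in> ?N n i" using t by (simp add: right_diff_distrib)
    then show "t \<in> (\<Union>n. \<Union>i. ?N n i)" by blast
  qed
  ultimately show ?thesis by (rule negligible_subset)
qed

lemma weak_derivative_eq_ae:
  fixes f g :: "real \<Rightarrow> real^'n"
  assumes "has_weak_derivative f g"
  shows "negligible {t\<in>{0<..<1}. weak_derivative f t \<noteq> g t}"
proof (rule weak_derivative_unique[OF _ assms])
  show "has_weak_derivative f (weak_derivative f)"
    unfolding weak_derivative_def by (rule someI[of "has_weak_derivative f", OF assms])
qed

lemma abs_cont_imp_has_weak_derivative:
  fixes f g :: "real \<Rightarrow> real^'n"
  assumes "\<And>i. abs_cont (\<lambda>t. f t $ i) (\<lambda>t. g t $ i)"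
  shows "has_weak_derivative f g"
proof (rule has_weak_derivativeI)
  have "(\<lambda>t. f t $ i) absolutely_integrable_on {0..1}" for i
    by (rule absolutely_integrable_continuous_real[OF abs_cont_continuous[OF assms]])
  then have "f absolutely_integrable_on {0..1}" by (simp add: absolutely_integrable_vec_nth[where f = f])
  then show "locally_integrable f" by (rule locally_integrableI)
  have "g absolutely_integrable_on {0..1}"
    using abs_contD1[OF assms] by (simp add: absolutely_integrable_vec_nth[where f = g])
  then show "locally_integrable g" by (rule locally_integrableI)
qed (rule integral_by_parts_test[OF assms])

lemma continuous_ae_eq_imp_eq:
  fixes f g :: "real \<Rightarrow> real"
  assumes f: "continuous_on {0..1} f" and g: "continuous_on {0..1} g"
    and N: "negligible {t\<in>{0..1}. f t \<noteq> g t}" and t: "t \<in> {0..1}"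
  shows "f t = g t"
proof -
  have "integral {0..1} (\<lambda>t. \<bar>f t - g t\<bar>) = integral {0..1} (\<lambda>t::real. 0::real)"
    by (rule integral_spike[OF N]) auto
  then have "\<bar>f t - g t\<bar> = 0"
    using integral_eq_0_iff[of 0 1 "\<lambda>t. \<bar>f t - g t\<bar>"] t
    by (simp add: continuous_on_diff continuous_on_rabs f g)
  then show ?thesis by simp
qed

text \<open>The function f minus the primitive of g has weak derivative 0, so it is constant almost
  everywhere by du Bois-Reymond, and everywhere by continuity.\<close>

lemma has_weak_derivative_imp_abs_cont:
  fixes f g :: "real \<Rightarrow> real^'n"
  assumes w: "has_weak_derivative f g" and f: "continuous_on {0..1} f"
    and g: "g absolutely_integrable_on {0..1}"
  shows "abs_cont (\<lambda>t. f t $ i) (\<lambda>t. g t $ i)"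
proof -
  have gi: "(\<lambda>t. g t $ i) absolutely_integrable_on {0..1}" 
    using g by (simp add: absolutely_integrable_vec_nth[where f = g])
  let ?G = "\<lambda>t. integral {0..t} (\<lambda>t. g t $ i)"
  have G: "abs_cont ?G (\<lambda>t. g t $ i)" by (rule abs_cont_indefinite[OF gi])
  have fi: "continuous_on {0..1} (\<lambda>t. f t $ i)" by (intro continuous_intros f)
  have c: "continuous_on {0..1} (\<lambda>t. f t $ i - ?G t)"
    by (intro continuous_on_diff fi abs_cont_continuous[OF G])
  obtain c where c': "negligible {t\<in>{0..1}. f t $ i - ?G t \<noteq> c}"
  proof (rule du_bois_reymond)
    show "(\<lambda>t. f t $ i - ?G t) absolutely_integrable_on {0..1}"
      by (rule absolutely_integrable_continuous_real[OF c])
    fix \<phi> :: "real \<Rightarrow> real" assume \<phi>: "test_function \<phi>"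
    have i: "(\<lambda>t. vector_derivative \<phi> (at t) * u t) integrable_on {0..1}"
      if "continuous_on {0..1} u" for u
      by (intro integrable_continuous_real continuous_on_mult that smooth_continuous_on smooth_deriv
          test_function_smooth \<phi>)
    show "integral {0..1} (\<lambda>t. vector_derivative \<phi> (at t) * (f t $ i - ?G t)) = 0"
      using Henstock_Kurzweil_Integration.integral_diff[OF i[OF fi] i[OF abs_cont_continuous[OF G]]]
        has_weak_derivativeD[OF w \<phi>, of i] integral_by_parts_test[OF G \<phi>]
      by (simp add: right_diff_distrib)
  qed
  have "f t $ i - ?G t = c" if "t \<in> {0..1}" for t
    by (rule continuous_ae_eq_imp_eq[OF c continuous_on_const c' that])
  then show ?thesis
    by (intro abs_contI[where c = c, OF gi]) (simp add: algebra_simps)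
qed

section \<open>From the Sobolev class to a second derivative of the curve\<close>

lemma Lp_integrable:
  fixes f :: "real \<Rightarrow> 'a::euclidean_space"
  assumes f: "f \<in> Lp p" and p: "1 \<le> p"
  shows "f absolutely_integrable_on {0..1}"
    "(\<lambda>t. norm (f t) powr p) absolutely_integrable_on {0..1}"
proof -
  have m: "f \<in> borel_measurable (lebesgue_on {0<..<1})"
    and i: "integrable (lebesgue_on {0<..<1}) (\<lambda>t. norm (f t) powr p)"
    using f by (auto simp: Lp_def)
  have ai: "(\<lambda>t. norm (f t) powr p) absolutely_integrable_on {0<..<1}"
    using i by (simp add: set_integrable_def integrable_restrict_space)
  then show "(\<lambda>t. norm (f t) powr p) absolutely_integrable_on {0..1}"
    by (simp add: absolutely_integrable_on_Icc_iff_Ioo)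
  have "f absolutely_integrable_on {0<..<1}"
  proof (rule measurable_bounded_by_integrable_imp_absolutely_integrable[OF m])
    show "(\<lambda>t. 1 + norm (f t) powr p) integrable_on {0<..<1}"
      by (intro Henstock_Kurzweil_Integration.integrable_add
          set_lebesgue_integral_eq_integral(1)[OF ai])
        (simp add: integrable_on_open_interval_real integrable_const_ivl)
    show "norm (f t) \<le> 1 + norm (f t) powr p" for t
    proof (cases "norm (f t) \<le> 1")
      case False
      then have "norm (f t) powr 1 \<le> norm (f t) powr p" using p by (intro powr_mono) auto
      then show ?thesis using False by simp
    qed (simp add: add_increasing2)
  qed simp
  then show "f absolutely_integrable_on {0..1}"
    by (simp add: absolutely_integrable_on_Icc_iff_Ioo)
qed

lemma has_weak_derivative_cong_ae:
  fixes f g h :: "real \<Rightarrow> real^'n"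
  assumes w: "has_weak_derivative f g" and h: "h absolutely_integrable_on {0..1}"
    and N: "negligible {t\<in>{0<..<1}. f t \<noteq> h t}"
  shows "has_weak_derivative h g"
proof (rule has_weak_derivativeI)
  show "locally_integrable h" by (rule locally_integrableI[OF h])
  show "locally_integrable g" using w by (simp add: has_weak_derivative_def)
  fix \<phi> :: "real \<Rightarrow> real" and i assume \<phi>: "test_function \<phi>"
  have "integral {0..1} (\<lambda>t. vector_derivative \<phi> (at t) * h t $ i) =
      integral {0..1} (\<lambda>t. vector_derivative \<phi> (at t) * f t $ i)"
    by (rule integral_spike[OF negligible_Un[OF N negligible_finite[of "{0,1}"]]]) (auto simp: less_le)
  then show "integral {0..1} (\<lambda>t. vector_derivative \<phi> (at t) * h t $ i) =
      - integral {0..1} (\<lambda>t. \<phi> t * g t $ i)"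
    using has_weak_derivativeD[OF w \<phi>] by simp
qed

lemma curve_deriv_works:
  assumes "\<gamma> differentiable_on {0..1}" "t \<in> {0..1}"
  shows "(\<gamma> has_vector_derivative curve_deriv \<gamma> t) (at t within {0..1})"
  using assms by (simp add: differentiable_on_def vector_derivative_works)

lemma curve_deriv_eqI:
  assumes "(\<gamma> has_vector_derivative v) (at t within {0..1})" "t \<in> {0..1}"
  shows "curve_deriv \<gamma> t = v"
  using vector_derivative_within_cbox[of 0 1 t \<gamma> v] assms by simp

lemma has_vector_derivative_vec_nth:
  "(f has_vector_derivative f') F \<Longrightarrow> ((\<lambda>t. f t $ i) has_vector_derivative f' $ i) F"
  using bounded_linear.has_vector_derivative[OF bounded_linear_vec_nth] by fastforce

text \<open>The first weak derivative supplied by \<open>Sobolev\<close> agrees with the classical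
  gamma' only almost everywhere. Uniqueness transfers its own weak derivative a to gamma', and a
  then serves as a fixed representative of gamma''.\<close>

lemma immersed_curve_second_derivative:
  assumes im: "immersed_curve p \<gamma>" and p: "1 < p"
  obtains a where "a \<in> Lp p" "\<And>i. abs_cont (\<lambda>t. curve_deriv \<gamma> t $ i) (\<lambda>t. a t $ i)"
proof -
  let ?v = "curve_deriv \<gamma>"
  have diff: "\<gamma> differentiable_on {0..1}" and v: "continuous_on {0..1} ?v"
    using im by (auto simp: immersed_curve_def)
  obtain g a where g: "has_weak_derivative \<gamma> g" and a: "a \<in> Lp p" "has_weak_derivative g a"
    using im unfolding immersed_curve_def numeral_2_eq_2 by auto
  have "has_weak_derivative \<gamma> ?v"
  proof (rule abs_cont_imp_has_weak_derivative, rule abs_cont_C1)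
    show "((\<lambda>t. \<gamma> t $ i) has_vector_derivative ?v t $ i) (at t within {0..1})"
      if "t \<in> {0..1}" for t i
      by (rule has_vector_derivative_vec_nth[OF curve_deriv_works[OF diff that]])
    show "continuous_on {0..1} (\<lambda>t. ?v t $ i)" for i
      by (intro continuous_intros v)
  qed
  then have "has_weak_derivative ?v a"
    by (intro has_weak_derivative_cong_ae[OF a(2)] weak_derivative_unique[OF g]
        absolutely_integrable_continuous_real v)
  then have "abs_cont (\<lambda>t. ?v t $ i) (\<lambda>t. a t $ i)" for i
    using p by (intro has_weak_derivative_imp_abs_cont v Lp_integrable(1)[OF a(1)]) auto
  then show thesis using a(1) that by blast
qed

subsection \<open>The first variation\<close>

lemma has_real_derivative_abs_powr:
  assumes "1 < p"
  shows "((\<lambda>x::real. \<bar>x\<bar> powr p) has_real_derivative p * sgn x * \<bar>x\<bar> powr (p - 1)) (at x)"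
proof -
  consider "x > 0" | "x < 0" | "x = 0" by linarith
  then show ?thesis
  proof cases
    case 1
    have "((\<lambda>x. x powr p) has_real_derivative p * x powr (p - 1)) (at x)"
      using 1 by (rule has_real_derivative_powr)
    then have "((\<lambda>x. \<bar>x\<bar> powr p) has_real_derivative p * x powr (p - 1)) (at x)"
      by (rule has_field_derivative_transform_within_open[of _ _ _ "{0<..}"]) (use 1 in auto)
    then show ?thesis using 1 by simp
  next
    case 2
    have "((\<lambda>x. (- x) powr p) has_real_derivative - (p * (- x) powr (p - 1))) (at x)"
      using 2 by (auto intro!: derivative_eq_intros DERIV_chain2[OF has_real_derivative_powr])
    then have "((\<lambda>x. \<bar>x\<bar> powr p) has_real_derivative - (p * (- x) powr (p - 1))) (at x)"
      by (rule has_field_derivative_transform_within_open[of _ _ _ "{..<0}"]) (use 2 in auto)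
    then show ?thesis using 2 by simp
  next
    case 3
    \<comment> \<open>At 0 the difference quotient has absolute value |h|^(p-1), which tends to 0
      because p > 1.\<close>
    have "((\<lambda>h::real. \<bar>h\<bar> powr (p - 1)) \<longlongrightarrow> \<bar>0\<bar> powr (p - 1)) (at 0)"
      using assms by (intro tendsto_powr' tendsto_intros) auto
    then have "((\<lambda>h::real. \<bar>h\<bar> powr (p - 1)) \<longlongrightarrow> 0) (at 0)" using assms by simp
    then have "((\<lambda>h::real. \<bar>h\<bar> powr p / h) \<longlongrightarrow> 0) (at 0)"
    proof (rule Lim_null_comparison[rotated], intro always_eventually allI)
      fix h :: real
      show "norm (\<bar>h\<bar> powr p / h) \<le> \<bar>h\<bar> powr (p - 1)"
        by (cases "h = 0") (auto simp: powr_diff)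
    qed
    then show ?thesis using 3 assms by (simp add: has_field_derivative_iff)
  qed
qed

definition det2 :: "real^2 \<Rightarrow> real^2 \<Rightarrow> real" where
  "det2 x y = x $ 1 * y $ 2 - x $ 2 * y $ 1"

text \<open>With $v = \gamma'$ and $a = \gamma''$, \<open>bend p v a\<close> is the energy density $|k|^p |\gamma'|$, and
  \<open>bend_P\<close>, \<open>bend_Q\<close> are the factors that multiply the variations of the determinant and of
  $|v|^2/2$.\<close>

definition bend :: "real \<Rightarrow> real^2 \<Rightarrow> real^2 \<Rightarrow> real" where
  "bend p v a = \<bar>det2 v a\<bar> powr p * norm v powr (1 - 3 * p)"

definition bend_P :: "real \<Rightarrow> real^2 \<Rightarrow> real^2 \<Rightarrow> real" where
  "bend_P p v a = p * sgn (det2 v a) * \<bar>det2 v a\<bar> powr (p - 1) * norm v powr (1 - 3 * p)"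

definition bend_Q :: "real \<Rightarrow> real^2 \<Rightarrow> real^2 \<Rightarrow> real" where
  "bend_Q p v a = (1 - 3 * p) * \<bar>det2 v a\<bar> powr p * norm v powr (- 1 - 3 * p)"

definition bend_deriv :: "real \<Rightarrow> real^2 \<Rightarrow> real^2 \<Rightarrow> real^2 \<Rightarrow> real^2 \<Rightarrow> real" where
  "bend_deriv p v a n m = bend_P p v a * (det2 n a + det2 v m) + bend_Q p v a * (v \<bullet> n)"

lemma norm_powr_eq: "norm (v :: 'a::real_inner) powr s = (v \<bullet> v) powr (s / 2)"
  by (simp add: norm_eq_sqrt_inner powr_half_sqrt[symmetric] powr_powr)

lemma norm_powr_deriv:
  fixes v n :: "'a::real_inner"
  assumes "v + e *\<^sub>R n \<noteq> 0"
  shows "((\<lambda>e. norm (v + e *\<^sub>R n) powr s) has_real_derivative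
    s * norm (v + e *\<^sub>R n) powr (s - 2) * ((v + e *\<^sub>R n) \<bullet> n)) (at e)"
proof -
  have "((\<lambda>e. (v + e *\<^sub>R n) \<bullet> (v + e *\<^sub>R n)) has_real_derivative 2 * ((v + e *\<^sub>R n) \<bullet> n)) (at e)"
    by (auto intro!: derivative_eq_intros simp: inner_simps inner_commute algebra_simps
        has_real_derivative_iff_has_vector_derivative)
  then have "((\<lambda>e. ((v + e *\<^sub>R n) \<bullet> (v + e *\<^sub>R n)) powr (s / 2)) has_real_derivative
      s / 2 * ((v + e *\<^sub>R n) \<bullet> (v + e *\<^sub>R n)) powr (s / 2 - 1) * (2 * ((v + e *\<^sub>R n) \<bullet> n))) (at e)"
    using assms by (intro DERIV_chain2[OF has_real_derivative_powr]) auto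
  then show ?thesis by (simp add: norm_powr_eq diff_divide_distrib mult_ac)
qed

lemma bend_has_deriv:
  assumes "1 < p" "v + e *\<^sub>R n \<noteq> 0"
  shows "((\<lambda>e. bend p (v + e *\<^sub>R n) (a + e *\<^sub>R m)) has_real_derivative
    bend_deriv p (v + e *\<^sub>R n) (a + e *\<^sub>R m) n m) (at e)"
proof -
  have d: "((\<lambda>e. det2 (v + e *\<^sub>R n) (a + e *\<^sub>R m)) has_real_derivative
      det2 n (a + e *\<^sub>R m) + det2 (v + e *\<^sub>R n) m) (at e)"
    unfolding det2_def by (auto intro!: derivative_eq_intros simp: algebra_simps)
  note DERIV_chain2[OF has_real_derivative_abs_powr[OF assms(1)] d]
  from DERIV_mult[OF this norm_powr_deriv[OF assms(2), of "1 - 3 * p"]]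
  show ?thesis
    unfolding bend_def bend_deriv_def bend_P_def bend_Q_def by (simp add: algebra_simps)
qed

text \<open>By the mean value theorem each difference quotient in e is a value of G' at an
  intermediate parameter, so the bound on G' also dominates the quotients, and dominated convergence
  applies along every sequence tending to 0.\<close>

lemma has_real_derivative_integral_dominated:
  fixes G G' :: "real \<Rightarrow> real \<Rightarrow> real"
  assumes e0: "e0 > 0"
    and int: "\<And>e. \<bar>e\<bar> < e0 \<Longrightarrow> G e integrable_on S"
    and deriv: "\<And>e t. \<bar>e\<bar> < e0 \<Longrightarrow> t \<in> S \<Longrightarrow> ((\<lambda>e. G e t) has_real_derivative G' e t) (at e)"
    and bound: "\<And>e t. \<bar>e\<bar> < e0 \<Longrightarrow> t \<in> S \<Longrightarrow> \<bar>G' e t\<bar> \<le> h t"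
    and h: "h integrable_on S"
  shows "((\<lambda>e. integral S (G e)) has_real_derivative integral S (G' 0)) (at 0)"
proof -
  let ?U = "{-e0<..<e0}"
  have diffq: "\<bar>(G e t - G 0 t) / e\<bar> \<le> h t" if e: "\<bar>e\<bar> < e0" "e \<noteq> 0" and t: "t \<in> S" for e t
  proof -
    have "\<exists>z. \<bar>z\<bar> < e0 \<and> G e t - G 0 t = e * G' z t"
    proof (cases "e > 0")
      case True
      have "\<exists>z. 0 < z \<and> z < e \<and> G e t - G 0 t = (e - 0) * G' z t"
        using True e t by (intro MVT2 deriv) auto
      then show ?thesis using e by force
    next
      case False
      have "\<exists>z. e < z \<and> z < 0 \<and> G 0 t - G e t = (0 - e) * G' z t"
        using False e t by (intro MVT2 deriv) auto
      then obtain z where "e < z" "z < 0" "G 0 t - G e t = (0 - e) * G' z t" by blast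
      then show ?thesis using e by (intro exI[of _ z]) (auto simp: algebra_simps)
    qed
    then show ?thesis using bound t e by fastforce
  qed
  have "((\<lambda>e. (integral S (G e) - integral S (G 0)) / e) \<longlongrightarrow> integral S (G' 0)) (at 0 within ?U)"
    unfolding tendsto_at_iff_sequentially
  proof (intro allI impI)
    fix X :: "nat \<Rightarrow> real" assume X: "\<forall>i. X i \<in> ?U - {0}" "X \<longlonglongrightarrow> 0"
    have Xi: "\<bar>X i\<bar> < e0" "X i \<noteq> 0" for i 
      using X(1)[rule_format, of i] by (auto simp: abs_less_iff)
    have iG: "G (X i) integrable_on S" "G 0 integrable_on S" for i
      using int Xi e0 by auto
    have "(\<lambda>i. integral S (\<lambda>t. (G (X i) t - G 0 t) / X i)) \<longlonglongrightarrow> integral S (G' 0)"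
    proof (rule dominated_convergence(2)[OF _ h])
      show "(\<lambda>t. (G (X i) t - G 0 t) / X i) integrable_on S" for i
        using integrable_on_mult_right[OF Henstock_Kurzweil_Integration.integrable_diff[OF iG], of "1 / X i"]
        by simp
      show "norm ((G (X i) t - G 0 t) / X i) \<le> h t" if "t \<in> S" for i t
        using diffq[OF Xi that] by simp
      show "(\<lambda>i. (G (X i) t - G 0 t) / X i) \<longlonglongrightarrow> G' 0 t" if "t \<in> S" for t
      proof -
        have "((\<lambda>e. (G e t - G 0 t) / (e - 0)) \<longlongrightarrow> G' 0 t) (at 0)"
          using deriv[of 0 t] e0 that by (simp add: has_field_derivative_iff)
        moreover have "filterlim X (at 0) sequentially"
          using X(2) Xi(2) by (simp add: filterlim_at)
        ultimately show ?thesis using filterlim_compose by fastforce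
      qed
    qed
    moreover have "integral S (\<lambda>t. (G (X i) t - G 0 t) / X i) =
        (integral S (G (X i)) - integral S (G 0)) / X i" for i
      using Xi(2)[of i] by (simp add: Henstock_Kurzweil_Integration.integral_diff[OF iG])
    ultimately show "((\<lambda>e. (integral S (G e) - integral S (G 0)) / e) \<circ> X) \<longlonglongrightarrow> integral S (G' 0)"
      unfolding o_def by (simp only:)
  qed
  then show ?thesis
    using e0 by (simp add: has_field_derivative_iff at_within_open[of 0 ?U])
qed

section \<open>Domination of the varied bending density\<close>

lemma abs_det2_le: "\<bar>det2 x y\<bar> \<le> 2 * norm x * norm y"
proof -
  have "\<bar>det2 x y\<bar> \<le> \<bar>x $ 1\<bar> * \<bar>y $ 2\<bar> + \<bar>x $ 2\<bar> * \<bar>y $ 1\<bar>"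
    unfolding det2_def by (metis abs_mult abs_triangle_ineq4)
  also have "\<dots> \<le> norm x * norm y + norm x * norm y"
    by (intro add_mono mult_mono component_le_norm_cart) auto
  finally show ?thesis by simp
qed

lemma powr_nonpos_antimono:
  assumes "0 < c" "c \<le> x" "s \<le> (0::real)"
  shows "x powr s \<le> c powr s"
  using powr_mono2'[of s c x] assms by simp

lemma abs_det2_le_lin:
  assumes "norm v \<le> V" "norm a \<le> (1 + E) * R" "0 \<le> E" "0 \<le> R"
  shows "\<bar>det2 v a\<bar> \<le> 2 * V * (1 + E) * R"
proof -
  have "norm v * norm a \<le> V * ((1 + E) * R)"
    using assms order_trans[OF norm_ge_zero assms(1)] by (intro mult_mono) auto
  then show ?thesis using abs_det2_le[of v a] by (simp only: mult_ac)
qed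

text \<open>Later v and a are the perturbed gamma' and gamma'', R is 1 + |gamma''|, E bounds the
  variation, and c, V enclose |v|. The lower bound c is essential because the exponent 1 - 3p of |v|
  is negative. Only R depends on the point.\<close>

lemma bend_P_bound:
  assumes p: "1 < p" and c: "0 < c" "c \<le> norm v" and V: "norm v \<le> V"
    and a: "norm a \<le> (1 + E) * R" and E: "0 \<le> E" "0 \<le> R"
  shows "\<bar>bend_P p v a\<bar> \<le> p * (2 * V * (1 + E)) powr (p - 1) * c powr (1 - 3 * p) * R powr (p - 1)"
proof -
  have V0: "0 \<le> V" using V norm_ge_zero order_trans by blast
  have "\<bar>bend_P p v a\<bar> = \<bar>sgn (det2 v a)\<bar> * (p * \<bar>det2 v a\<bar> powr (p - 1) * norm v powr (1 - 3 * p))"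
    using p by (simp add: bend_P_def abs_mult)
  also have "\<dots> \<le> 1 * (p * \<bar>det2 v a\<bar> powr (p - 1) * norm v powr (1 - 3 * p))"
    using p by (intro mult_right_mono) (auto simp: sgn_if)
  also have "\<dots> \<le> 1 * (p * (2 * V * (1 + E) * R) powr (p - 1) * c powr (1 - 3 * p))"
    using p c abs_det2_le_lin[OF V a E]
    by (intro mult_mono powr_mono2 powr_nonpos_antimono) auto
  also have "\<dots> = p * (2 * V * (1 + E)) powr (p - 1) * c powr (1 - 3 * p) * R powr (p - 1)"
    using V0 E by (simp add: powr_mult)
  finally show ?thesis .
qed

lemma det_powr_bound:
  assumes p: "1 < p" and c: "0 < c" "c \<le> norm v" and V: "norm v \<le> V"
    and a: "norm a \<le> (1 + E) * R" and E: "0 \<le> E" "0 \<le> R" and s: "s \<le> 0"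
  shows "\<bar>det2 v a\<bar> powr p * norm v powr s \<le> (2 * V * (1 + E)) powr p * c powr s * R powr p"
proof -
  have V0: "0 \<le> V" using V norm_ge_zero order_trans by blast
  have "\<bar>det2 v a\<bar> powr p * norm v powr s \<le> (2 * V * (1 + E) * R) powr p * c powr s"
    using p c s abs_det2_le_lin[OF V a E]
    by (intro mult_mono powr_mono2 powr_nonpos_antimono) auto
  also have "\<dots> = (2 * V * (1 + E)) powr p * c powr s * R powr p"
    using V0 E by (simp add: powr_mult)
  finally show ?thesis .
qed

text \<open>Every term grows at most like R^p: \<open>bend_P\<close> contributes R^(p-1), and the
  variation of the determinant, affine in a, one more factor R. The part of it without a is absorbed
  by R >= 1.\<close>

lemma bend_deriv_bound:
  assumes p: "1 < p" and c: "0 < c" "c \<le> norm v" and V: "norm v \<le> V"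
    and a: "norm a \<le> (1 + E) * R" and E: "0 \<le> E" and R: "1 \<le> R"
    and n: "norm n \<le> E" and m: "norm m \<le> E"
  shows "\<bar>bend_deriv p v a n m\<bar> \<le>
    (p * (2 * V * (1 + E)) powr (p - 1) * c powr (1 - 3 * p) * (2 * E * (1 + E) + 2 * V * E)
     + (3 * p - 1) * ((2 * V * (1 + E)) powr p * c powr (- 1 - 3 * p)) * (V * E)) * R powr p"
proof -
  have V0: "0 \<le> V" using V norm_ge_zero order_trans by blast
  have R0: "0 \<le> R" using R by simp
  have "\<bar>det2 n a\<bar> \<le> 2 * E * (1 + E) * R" by (rule abs_det2_le_lin[OF n a E R0])
  moreover have "\<bar>det2 v m\<bar> \<le> 2 * V * E * R"
  proof -
    have "norm v * norm m \<le> V * E" using V m V0 by (intro mult_mono) auto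
    also have "\<dots> \<le> V * E * R" using V0 E R mult_left_mono[of 1 R "V * E"] by simp
    finally show ?thesis using abs_det2_le[of v m] by (simp add: mult_ac)
  qed
  ultimately have J: "\<bar>det2 n a + det2 v m\<bar> \<le> (2 * E * (1 + E) + 2 * V * E) * R"
    by (simp add: distrib_right)
  have vn: "\<bar>v \<bullet> n\<bar> \<le> V * E"
    by (rule order_trans[OF Cauchy_Schwarz_ineq2]) (use V n V0 in \<open>intro mult_mono; auto\<close>)
  have Q: "\<bar>bend_Q p v a\<bar> \<le> (3 * p - 1) * ((2 * V * (1 + E)) powr p * c powr (- 1 - 3 * p) * R powr p)"
  proof -
    have "\<bar>bend_Q p v a\<bar> = (3 * p - 1) * (\<bar>det2 v a\<bar> powr p * norm v powr (- 1 - 3 * p))"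
      using p by (simp add: bend_Q_def abs_mult)
    also have "\<dots> \<le> (3 * p - 1) * ((2 * V * (1 + E)) powr p * c powr (- 1 - 3 * p) * R powr p)"
      using p by (intro mult_left_mono det_powr_bound[OF p c V a E R0]) auto
    finally show ?thesis .
  qed
  have RR: "R powr (p - 1) * R = R powr p" using R by (simp add: powr_diff)
  have "\<bar>bend_deriv p v a n m\<bar> \<le> \<bar>bend_P p v a\<bar> * \<bar>det2 n a + det2 v m\<bar> + \<bar>bend_Q p v a\<bar> * \<bar>v \<bullet> n\<bar>"
    unfolding bend_deriv_def by (metis abs_mult abs_triangle_ineq)
  also have "\<dots> \<le> p * (2 * V * (1 + E)) powr (p - 1) * c powr (1 - 3 * p) * R powr (p - 1) *
      ((2 * E * (1 + E) + 2 * V * E) * R) +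
      (3 * p - 1) * ((2 * V * (1 + E)) powr p * c powr (- 1 - 3 * p) * R powr p) * (V * E)"
    using p E V0 R0 by (intro add_mono mult_mono bend_P_bound[OF p c V a E R0] J Q vn) auto
  also have "\<dots> = p * (2 * V * (1 + E)) powr (p - 1) * c powr (1 - 3 * p) *
      (2 * E * (1 + E) + 2 * V * E) * (R powr (p - 1) * R) +
      (3 * p - 1) * ((2 * V * (1 + E)) powr p * c powr (- 1 - 3 * p)) * (V * E) * R powr p"
    by (simp only: mult_ac)
  finally show ?thesis unfolding RR by (simp only: distrib_right)
qed

lemma Lp_measurable:
  assumes "a \<in> Lp p" "1 \<le> p"
  shows "a \<in> borel_measurable (lebesgue_on {0..1})"
  using Lp_integrable(1)[OF assms] absolutely_integrable_measurable[of "{0..1}" a] by auto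

lemma Lp_one_plus_powr_integrable:
  fixes a :: "real \<Rightarrow> 'a::euclidean_space"
  assumes a: "a \<in> Lp p" and p: "1 \<le> p"
  shows "(\<lambda>t. (1 + norm (a t)) powr p) absolutely_integrable_on {0..1}"
proof (rule measurable_bounded_by_integrable_imp_absolutely_integrable)
  note [measurable] = Lp_measurable[OF assms]
  show "(\<lambda>t. (1 + norm (a t)) powr p) \<in> borel_measurable (lebesgue_on {0..1})" by measurable
  show "(\<lambda>t. 2 powr p * (1 + norm (a t) powr p)) integrable_on {0..1}"
    using set_lebesgue_integral_eq_integral(1)[OF Lp_integrable(2)[OF a p]]
    by (intro integrable_on_mult_right Henstock_Kurzweil_Integration.integrable_add)
      (auto simp: integrable_const_ivl)
  show "norm ((1 + norm (a t)) powr p) \<le> 2 powr p * (1 + norm (a t) powr p)" for t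
  proof -
    let ?x = "norm (a t)"
    have "(1 + ?x) powr p \<le> (2 * max 1 ?x) powr p" using p by (intro powr_mono2) auto
    also have "\<dots> = 2 powr p * max 1 ?x powr p" by (simp add: powr_mult)
    also have "\<dots> \<le> 2 powr p * (1 + ?x powr p)" by (intro mult_left_mono) (auto simp: max_def)
    finally show ?thesis by simp
  qed
qed simp

lemma borel_measurable_vec_nth:
  fixes f :: "'a \<Rightarrow> real^'n"
  assumes "f \<in> borel_measurable M"
  shows "(\<lambda>x. f x $ i) \<in> borel_measurable M"
  using measurable_compose[OF assms borel_measurable_continuous_onI[of "\<lambda>x. x $ i"]]
  by (simp add: continuous_on_component)

lemma bend_measurable:
  fixes v a :: "real \<Rightarrow> real^2"
  assumes v: "v \<in> borel_measurable M" and a: "a \<in> borel_measurable M"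
  shows "(\<lambda>t. bend p (v t) (a t)) \<in> borel_measurable M"
    "(\<lambda>t. bend_P p (v t) (a t)) \<in> borel_measurable M"
    "(\<lambda>t. bend_Q p (v t) (a t)) \<in> borel_measurable M"
proof -
  note [measurable] = v a borel_measurable_vec_nth[OF v] borel_measurable_vec_nth[OF a]
  have [measurable]: "(\<lambda>t. det2 (v t) (a t)) \<in> borel_measurable M"
    unfolding det2_def by measurable
  show "(\<lambda>t. bend p (v t) (a t)) \<in> borel_measurable M"
    "(\<lambda>t. bend_P p (v t) (a t)) \<in> borel_measurable M"
    "(\<lambda>t. bend_Q p (v t) (a t)) \<in> borel_measurable M"
    unfolding bend_def bend_P_def bend_Q_def by measurable
qed

lemma curve_deriv_bounds:
  assumes "immersed_curve p \<gamma>"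
  obtains c V where "0 < c"
    "\<And>t. t \<in> {0..1} \<Longrightarrow> c \<le> norm (curve_deriv \<gamma> t)"
    "\<And>t. t \<in> {0..1} \<Longrightarrow> norm (curve_deriv \<gamma> t) \<le> V"
proof -
  have c: "continuous_on {0..1} (\<lambda>t. norm (curve_deriv \<gamma> t))"
    and nz: "\<And>t. t \<in> {0..1} \<Longrightarrow> curve_deriv \<gamma> t \<noteq> 0"
    using assms by (auto simp: immersed_curve_def intro: continuous_on_norm)
  have ne: "{0..1::real} \<noteq> {}" by simp
  obtain x where x: "x \<in> {0..1}" "\<forall>t\<in>{0..1}. norm (curve_deriv \<gamma> x) \<le> norm (curve_deriv \<gamma> t)"
    using continuous_attains_inf[OF compact_Icc ne c] by metis
  obtain y where y: "\<forall>t\<in>{0..1}. norm (curve_deriv \<gamma> t) \<le> norm (curve_deriv \<gamma> y)"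
    using continuous_attains_sup[OF compact_Icc ne c] by metis
  show thesis
    by (rule that[OF _ bspec[OF x(2)] bspec[OF y]]) (use nz[OF x(1)] in simp)
qed

lemma smooth_bounded_on_unit:
  fixes f :: "real \<Rightarrow> 'a::real_normed_vector"
  assumes "smooth f"
  obtains E where "0 \<le> E" "\<And>t. t \<in> {0..1} \<Longrightarrow> norm (f t) \<le> E"
proof -
  have "bounded (f ` {0..1})"
    by (intro compact_imp_bounded compact_continuous_image smooth_continuous_on assms) simp
  then obtain E where "\<forall>x\<in>f ` {0..1}. norm x \<le> E" by (auto simp: bounded_iff)
  then show thesis by (intro that[of "max 0 E"]) (auto simp: le_max_iff_disj)
qed

lemma curvature_density_eq_bend:
  assumes "v \<noteq> 0"
  shows "\<bar>det2 v a / norm v ^ 3\<bar> powr p * norm v = bend p v a"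
proof -
  have n: "norm v > 0" using assms by simp
  have "norm v powr 3 = norm v ^ 3"
    using powr_realpow[OF n, of 3] by simp
  then have "\<bar>det2 v a / norm v ^ 3\<bar> powr p = \<bar>det2 v a\<bar> powr p / (norm v powr (3 * p))"
    using n by (simp add: abs_divide powr_divide powr_powr[symmetric])
  then show ?thesis using n by (simp add: bend_def powr_diff)
qed

text \<open>The bound on e moves v by at most c/2, so the perturbed curves stay uniformly immersed.
  The summand in E + 1 keeps the quotient meaningful for E = 0.\<close>

lemma perturbed_norm_bounds:
  fixes v n :: "'a::real_normed_vector"
  assumes "c \<le> norm v" "norm v \<le> V" "norm n \<le> E" "0 < c" "0 \<le> E"
    and e: "\<bar>e\<bar> < min 1 (c / (2 * (E + 1)))"
  shows "c / 2 \<le> norm (v + e *\<^sub>R n)" "norm (v + e *\<^sub>R n) \<le> V + E"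
proof -
  have "norm (e *\<^sub>R n) \<le> \<bar>e\<bar> * E" using assms by (simp add: mult_left_mono)
  also have "\<dots> \<le> (c / (2 * (E + 1))) * (E + 1)" using assms by (intro mult_mono) auto
  also have "\<dots> = c / 2" using \<open>0 \<le> E\<close> by (simp add: field_simps)
  finally have 1: "norm (e *\<^sub>R n) \<le> c / 2" .
  show "c / 2 \<le> norm (v + e *\<^sub>R n)"
    using norm_diff_ineq[of v "e *\<^sub>R n"] 1 assms(1) by simp
  have "norm (e *\<^sub>R n) \<le> \<bar>e\<bar> * E" using assms by (simp add: mult_left_mono)
  also have "\<dots> \<le> 1 * E" using assms by (intro mult_right_mono) auto
  finally show "norm (v + e *\<^sub>R n) \<le> V + E"
    using norm_triangle_ineq[of v "e *\<^sub>R n"] assms(2) by simp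
qed

lemma perturbed_norm_le:
  fixes a m :: "'a::real_normed_vector"
  assumes "norm m \<le> E" "0 \<le> E" "\<bar>e\<bar> \<le> 1"
  shows "norm (a + e *\<^sub>R m) \<le> (1 + E) * (1 + norm a)"
proof -
  have "norm (e *\<^sub>R m) \<le> 1 * E" unfolding norm_scaleR using assms by (intro mult_mono) auto
  then have "norm (a + e *\<^sub>R m) \<le> norm a + E" using norm_triangle_ineq[of a "e *\<^sub>R m"] by simp
  also have "\<dots> \<le> (1 + E) * (1 + norm a)" using assms(2) by (simp add: algebra_simps)
  finally show ?thesis .
qed

text \<open>Difference quotients of the bending density are dominated by a multiple of
  $(1 + |\gamma''|)^p$.\<close>

theorem first_variation:
  assumes im: "immersed_curve p \<gamma>" and p: "1 < p" and a: "a \<in> Lp p"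
    and ac: "\<And>i. abs_cont (\<lambda>t. curve_deriv \<gamma> t $ i) (\<lambda>t. a t $ i)"
    and \<eta>: "test_function \<eta>" and \<eta>1: "\<And>t. (\<eta> has_vector_derivative \<eta>' t) (at t)"
    and \<eta>2: "\<And>t. (\<eta>' has_vector_derivative \<eta>'' t) (at t)"
  shows "((\<lambda>\<epsilon>. bending_energy p (\<lambda>t. \<gamma> t + \<epsilon> *\<^sub>R \<eta> t) +
      lam * curve_length (\<lambda>t. \<gamma> t + \<epsilon> *\<^sub>R \<eta> t)) has_real_derivative
    integral {0..1} (\<lambda>t. bend_deriv p (curve_deriv \<gamma> t) (a t) (\<eta>' t) (\<eta>'' t)) +
    lam * integral {0..1} (\<lambda>t. norm (curve_deriv \<gamma> t) powr (- 1) * (curve_deriv \<gamma> t \<bullet> \<eta>' t))) (at 0)"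
proof -
  let ?v = "curve_deriv \<gamma>"
  have diff: "\<gamma> differentiable_on {0..1}" and v: "continuous_on {0..1} ?v"
    using im by (auto simp: immersed_curve_def)
  have \<eta>'_eq: "\<eta>' = (\<lambda>t. vector_derivative \<eta> (at t))"
    using vector_derivative_at[OF \<eta>1] by auto
  have \<eta>''_eq: "\<eta>'' = (\<lambda>t. vector_derivative \<eta>' (at t))"
    using vector_derivative_at[OF \<eta>2] by auto
  have s1: "smooth \<eta>'" unfolding \<eta>'_eq by (intro smooth_deriv test_function_smooth \<eta>)
  have s2: "smooth \<eta>''" unfolding \<eta>''_eq by (intro smooth_deriv s1)
  obtain E1 where E1: "0 \<le> E1" "\<And>t. t \<in> {0..1} \<Longrightarrow> norm (\<eta>' t) \<le> E1"
    using smooth_bounded_on_unit[OF s1] by metis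
  obtain E2 where E2: "0 \<le> E2" "\<And>t. t \<in> {0..1} \<Longrightarrow> norm (\<eta>'' t) \<le> E2"
    using smooth_bounded_on_unit[OF s2] by metis
  define E where "E = max E1 E2"
  have E: "0 \<le> E" "\<And>t. t \<in> {0..1} \<Longrightarrow> norm (\<eta>' t) \<le> E" "\<And>t. t \<in> {0..1} \<Longrightarrow> norm (\<eta>'' t) \<le> E"
    using E1 E2 by (auto simp: E_def le_max_iff_disj)
  obtain c V where c: "0 < c" "\<And>t. t \<in> {0..1} \<Longrightarrow> c \<le> norm (?v t)"
    and V: "\<And>t. t \<in> {0..1} \<Longrightarrow> norm (?v t) \<le> V"
    using curve_deriv_bounds[OF im] by metis
  define e0 where "e0 = min 1 (c / (2 * (E + 1)))"
  have e0: "e0 > 0" using c E by (simp add: e0_def)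
  define w where "w e t = ?v t + e *\<^sub>R \<eta>' t" for e t
  define b where "b e t = a t + e *\<^sub>R \<eta>'' t" for e t
  define R where "R t = 1 + norm (a t)" for t
  have wl: "c / 2 \<le> norm (w e t)" and wu: "norm (w e t) \<le> V + E"
    if "\<bar>e\<bar> < e0" "t \<in> {0..1}" for e t
    using perturbed_norm_bounds[OF c(2)[OF that(2)] V[OF that(2)] E(2)[OF that(2)] c(1) E(1)]
      that(1) unfolding w_def e0_def by auto
  have wnz: "w e t \<noteq> 0" if "\<bar>e\<bar> < e0" "t \<in> {0..1}" for e t
    using wl[OF that] c(1) by auto
  have bu: "norm (b e t) \<le> (1 + E) * R t" if "\<bar>e\<bar> < e0" "t \<in> {0..1}" for e t
    unfolding b_def R_def by (rule perturbed_norm_le) (use that E in \<open>auto simp: e0_def\<close>)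
  have R1: "1 \<le> R t" for t by (simp add: R_def)
  have Rint: "(\<lambda>t. R t powr p) integrable_on {0..1}"
    unfolding R_def using p
    by (intro set_lebesgue_integral_eq_integral(1) Lp_one_plus_powr_integrable[OF a]) auto
  have contw: "continuous_on {0..1} (w e)" for e
    unfolding w_def by (intro continuous_intros v smooth_continuous_on s1)
  have mw: "w e \<in> borel_measurable (lebesgue_on {0..1})" for e
    by (intro continuous_imp_measurable_on_sets_lebesgue contw) simp
  have mb: "b e \<in> borel_measurable (lebesgue_on {0..1})" for e
    unfolding b_def using p
    by (intro borel_measurable_add Lp_measurable[OF a] borel_measurable_scaleR borel_measurable_const
        continuous_imp_measurable_on_sets_lebesgue smooth_continuous_on s2) auto
  have bint: "(\<lambda>t. bend p (w e t) (b e t)) absolutely_integrable_on {0..1}" if e: "\<bar>e\<bar> < e0" for e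
  proof (rule measurable_bounded_by_integrable_imp_absolutely_integrable[OF bend_measurable(1)[OF mw mb]])
    show "(\<lambda>t. ((2 * (V + E) * (1 + E)) powr p * (c / 2) powr (1 - 3 * p)) * R t powr p) integrable_on {0..1}"
      by (intro integrable_on_mult_right Rint)
    fix t :: real assume t: "t \<in> {0..1}"
    show "norm (bend p (w e t) (b e t)) \<le> ((2 * (V + E) * (1 + E)) powr p * (c / 2) powr (1 - 3 * p)) * R t powr p"
      using det_powr_bound[OF p _ wl[OF e t] wu[OF e t] bu[OF e t] E(1), of "1 - 3 * p"] c(1) R1[of t] p
      by (simp add: bend_def)
  qed simp
  have cd: "curve_deriv (\<lambda>t. \<gamma> t + e *\<^sub>R \<eta> t) t = w e t" if "t \<in> {0..1}" for e t
  proof (rule curve_deriv_eqI[OF _ that])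
    have "((\<lambda>t. e *\<^sub>R \<eta> t) has_vector_derivative e *\<^sub>R \<eta>' t) (at t within {0..1})"
      by (rule has_vector_derivative_at_within[OF
          bounded_linear.has_vector_derivative[OF bounded_linear_scaleR_right \<eta>1]])
    then show "((\<lambda>t. \<gamma> t + e *\<^sub>R \<eta> t) has_vector_derivative w e t) (at t within {0..1})"
      unfolding w_def by (intro has_vector_derivative_add curve_deriv_works[OF diff that])
  qed
  \<comment> \<open>Thus \<open>b e\<close> is one weak derivative of the perturbed tangent, and the
    arbitrary choice hidden in \<open>curvature\<close> agrees with it almost everywhere.\<close>
  have wd: "has_weak_derivative (curve_deriv (\<lambda>t. \<gamma> t + e *\<^sub>R \<eta> t)) (b e)" for e
  proof (rule abs_cont_imp_has_weak_derivative)
    fix i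
    have "abs_cont (\<lambda>t. \<eta>' t $ i) (\<lambda>t. \<eta>'' t $ i)"
      by (rule abs_cont_C1[OF has_vector_derivative_at_within[OF has_vector_derivative_vec_nth[OF \<eta>2]]])
        (intro continuous_intros smooth_continuous_on s2)
    then have "abs_cont (\<lambda>t. ?v t $ i + e * \<eta>' t $ i) (\<lambda>t. a t $ i + e * \<eta>'' t $ i)"
      by (intro abs_cont_add abs_cont_cmult ac)
    then have "abs_cont (\<lambda>t. ?v t $ i + e * \<eta>' t $ i) (\<lambda>t. b e t $ i)" by (simp add: b_def)
    then show "abs_cont (\<lambda>t. curve_deriv (\<lambda>t. \<gamma> t + e *\<^sub>R \<eta> t) t $ i) (\<lambda>t. b e t $ i)"
      by (rule abs_cont_cong) (simp add: cd w_def)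
  qed
  have BE: "bending_energy p (\<lambda>t. \<gamma> t + e *\<^sub>R \<eta> t) = integral {0..1} (\<lambda>t. bend p (w e t) (b e t))"
    if e: "\<bar>e\<bar> < e0" for e
    unfolding bending_energy_def
  proof (rule lebesgue_integral_Ioo_eq_ae[OF bint[OF e] weak_derivative_eq_ae[OF wd[of e]]])
    let ?g = "\<lambda>t. \<gamma> t + e *\<^sub>R \<eta> t"
    fix t assume t: "t \<in> {0<..<1} - {t \<in> {0<..<1}. weak_derivative (curve_deriv ?g) t \<noteq> b e t}"
    then have "t \<in> {0..1}" by auto
    moreover have "weak_derivative (curve_deriv ?g) t = b e t" using t by blast
    ultimately show "\<bar>curvature ?g t\<bar> powr p * norm (curve_deriv ?g t) = bend p (w e t) (b e t)"
      using curvature_density_eq_bend[OF wnz[OF e], of t "b e t" p]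
      by (simp add: curvature_def Let_def cd det2_def)
  qed
  have CL: "curve_length (\<lambda>t. \<gamma> t + e *\<^sub>R \<eta> t) = integral {0..1} (\<lambda>t. norm (w e t))" for e
  proof -
    have "curve_length (\<lambda>t. \<gamma> t + e *\<^sub>R \<eta> t) = (LINT t:{0..1}|lebesgue. norm (w e t))"
      unfolding curve_length_def arclength_def
      by (rule set_lebesgue_integral_cong) (auto simp: cd)
    also have "\<dots> = integral {0..1} (\<lambda>t. norm (w e t))"
      by (intro set_lebesgue_integral_eq_integral absolutely_integrable_continuous_real
          continuous_on_norm contw)
    finally show ?thesis .
  qed
  have d1: "((\<lambda>e. integral {0..1} (\<lambda>t. bend p (w e t) (b e t))) has_real_derivative
      integral {0..1} (\<lambda>t. bend_deriv p (w 0 t) (b 0 t) (\<eta>' t) (\<eta>'' t))) (at 0)"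
  proof (rule has_real_derivative_integral_dominated[OF e0])
    show "(\<lambda>t. bend p (w e t) (b e t)) integrable_on {0..1}" if "\<bar>e\<bar> < e0" for e
      by (rule set_lebesgue_integral_eq_integral(1)[OF bint[OF that]])
    fix e t :: real assume e: "\<bar>e\<bar> < e0" and t: "t \<in> {0..1}"
    show "((\<lambda>e. bend p (w e t) (b e t)) has_real_derivative
        bend_deriv p (w e t) (b e t) (\<eta>' t) (\<eta>'' t)) (at e)"
      using bend_has_deriv[OF p wnz[OF e t, unfolded w_def]] by (simp add: w_def b_def)
    show "\<bar>bend_deriv p (w e t) (b e t) (\<eta>' t) (\<eta>'' t)\<bar> \<le>
      (p * (2 * (V + E) * (1 + E)) powr (p - 1) * (c / 2) powr (1 - 3 * p) *
        (2 * E * (1 + E) + 2 * (V + E) * E)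
        + (3 * p - 1) * ((2 * (V + E) * (1 + E)) powr p * (c / 2) powr (- 1 - 3 * p)) * ((V + E) * E)) *
        R t powr p"
      using c(1) by (intro bend_deriv_bound p wl wu bu E R1 e t) auto
  qed (intro integrable_on_mult_right Rint)
  have d2: "((\<lambda>e. integral {0..1} (\<lambda>t. norm (w e t))) has_real_derivative
      integral {0..1} (\<lambda>t. norm (w 0 t) powr (- 1) * (w 0 t \<bullet> \<eta>' t))) (at 0)"
  proof (rule has_real_derivative_integral_dominated[OF e0])
    show "(\<lambda>t. norm (w e t)) integrable_on {0..1}" for e
      by (intro integrable_continuous_real continuous_on_norm contw)
    fix e t :: real assume e: "\<bar>e\<bar> < e0" and t: "t \<in> {0..1}"
    show "((\<lambda>e. norm (w e t)) has_real_derivative norm (w e t) powr (- 1) * (w e t \<bullet> \<eta>' t)) (at e)"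
      using norm_powr_deriv[OF wnz[OF e t, unfolded w_def], of 1] by (simp add: w_def)
    have "\<bar>w e t \<bullet> \<eta>' t\<bar> \<le> (V + E) * E"
      by (rule order_trans[OF Cauchy_Schwarz_ineq2], rule mult_mono)
        (use wu[OF e t] E t order_trans[OF norm_ge_zero wu[OF e t]] in auto)
    then show "\<bar>norm (w e t) powr (- 1) * (w e t \<bullet> \<eta>' t)\<bar> \<le> (c / 2) powr (- 1) * ((V + E) * E)"
      unfolding abs_mult using powr_nonpos_antimono[of "c / 2" "norm (w e t)" "- 1"] c(1) wl[OF e t]
      by (intro mult_mono) (simp_all del: powr_neg_one)
  qed (rule integrable_const_ivl)
  have "((\<lambda>e. integral {0..1} (\<lambda>t. bend p (w e t) (b e t)) + lam * integral {0..1} (\<lambda>t. norm (w e t)))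
      has_real_derivative
      integral {0..1} (\<lambda>t. bend_deriv p (?v t) (a t) (\<eta>' t) (\<eta>'' t)) +
      lam * integral {0..1} (\<lambda>t. norm (?v t) powr (- 1) * (?v t \<bullet> \<eta>' t))) (at 0)"
    using DERIV_add[OF d1 DERIV_cmult[OF d2, of lam]] by (simp add: w_def b_def)
  then show ?thesis
    by (rule has_field_derivative_transform_within_open[of _ _ _ "{-e0<..<e0}"])
      (use e0 in \<open>auto simp: BE CL\<close>)
qed

subsection \<open>The Euler--Lagrange system\<close>

text \<open>These are the coefficients of eta' and eta'' in the first variation, and du Bois-Reymond
  needs them in L^1. With R = 1 + |gamma''| they are bounded by multiples of R^(p-1) or R^p, and R^p
  is integrable.\<close>

lemma bend_coefficients_integrable:
  assumes im: "immersed_curve p \<gamma>" and p: "1 < p" and a: "a \<in> Lp p"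
  shows "(\<lambda>t. bend_P p (curve_deriv \<gamma> t) (a t)) absolutely_integrable_on {0..1}"
    "(\<lambda>t. bend_P p (curve_deriv \<gamma> t) (a t) * a t $ i) absolutely_integrable_on {0..1}"
    "(\<lambda>t. bend_Q p (curve_deriv \<gamma> t) (a t)) absolutely_integrable_on {0..1}"
proof -
  let ?v = "curve_deriv \<gamma>"
  have v: "continuous_on {0..1} ?v" using im by (simp add: immersed_curve_def)
  obtain c V where c: "0 < c" "\<And>t. t \<in> {0..1} \<Longrightarrow> c \<le> norm (?v t)"
    and V: "\<And>t. t \<in> {0..1} \<Longrightarrow> norm (?v t) \<le> V"
    using curve_deriv_bounds[OF im] by metis
  define R where "R t = 1 + norm (a t)" for t
  have R1: "1 \<le> R t" for t by (simp add: R_def)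
  have aR: "norm (a t) \<le> (1 + 0) * R t" for t by (simp add: R_def)
  have Rint: "(\<lambda>t. R t powr p) integrable_on {0..1}"
    unfolding R_def using p
    by (intro set_lebesgue_integral_eq_integral(1) Lp_one_plus_powr_integrable[OF a]) auto
  have mv: "?v \<in> borel_measurable (lebesgue_on {0..1})"
    by (intro continuous_imp_measurable_on_sets_lebesgue v) simp
  have ma: "a \<in> borel_measurable (lebesgue_on {0..1})" using p by (intro Lp_measurable[OF a]) simp
  note m = bend_measurable[OF mv ma, of p]
  define C where "C = p * (2 * V * (1 + 0)) powr (p - 1) * c powr (1 - 3 * p)"
  have C0: "0 \<le> C" using p by (simp add: C_def)
  have P: "\<bar>bend_P p (?v t) (a t)\<bar> \<le> C * R t powr (p - 1)" if "t \<in> {0..1}" for t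
    unfolding C_def using R1[of t] by (intro bend_P_bound p c V aR that) auto
  have Rp: "R t powr (p - 1) * R t = R t powr p" for t using R1[of t] by (simp add: powr_diff)
  show "(\<lambda>t. bend_P p (?v t) (a t)) absolutely_integrable_on {0..1}"
  proof (rule measurable_bounded_by_integrable_imp_absolutely_integrable[OF m(2)])
    show "(\<lambda>t. C * R t powr p) integrable_on {0..1}" by (intro integrable_on_mult_right Rint)
    show "norm (bend_P p (?v t) (a t)) \<le> C * R t powr p" if "t \<in> {0..1}" for t
    proof -
      have "C * R t powr (p - 1) \<le> C * R t powr p"
        using C0 R1[of t] by (intro mult_left_mono powr_mono) auto
      then show ?thesis using P[OF that] by simp
    qed
  qed simp
  show "(\<lambda>t. bend_P p (?v t) (a t) * a t $ i) absolutely_integrable_on {0..1}"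
  proof (rule measurable_bounded_by_integrable_imp_absolutely_integrable)
    show "(\<lambda>t. bend_P p (?v t) (a t) * a t $ i) \<in> borel_measurable (lebesgue_on {0..1})"
      by (intro borel_measurable_times m(2) borel_measurable_vec_nth ma)
    show "(\<lambda>t. C * R t powr p) integrable_on {0..1}" by (intro integrable_on_mult_right Rint)
    show "norm (bend_P p (?v t) (a t) * a t $ i) \<le> C * R t powr p" if t: "t \<in> {0..1}" for t
    proof -
      have "\<bar>a t $ i\<bar> \<le> R t" using component_le_norm_cart[of "a t" i] by (simp add: R_def)
      then have "\<bar>bend_P p (?v t) (a t)\<bar> * \<bar>a t $ i\<bar> \<le> C * R t powr (p - 1) * R t"
        using C0 R1[of t] by (intro mult_mono P t) auto
      then show ?thesis using Rp[of t] by (simp add: abs_mult mult.assoc)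
    qed
  qed simp
  show "(\<lambda>t. bend_Q p (?v t) (a t)) absolutely_integrable_on {0..1}"
  proof (rule measurable_bounded_by_integrable_imp_absolutely_integrable[OF m(3)])
    show "(\<lambda>t. (3 * p - 1) * ((2 * V * (1 + 0)) powr p * c powr (- 1 - 3 * p)) * R t powr p)
        integrable_on {0..1}"
      by (intro integrable_on_mult_right Rint)
    show "norm (bend_Q p (?v t) (a t)) \<le>
        (3 * p - 1) * ((2 * V * (1 + 0)) powr p * c powr (- 1 - 3 * p)) * R t powr p"
      if t: "t \<in> {0..1}" for t
    proof -
      have "\<bar>bend_Q p (?v t) (a t)\<bar> = (3 * p - 1) * (\<bar>det2 (?v t) (a t)\<bar> powr p * norm (?v t) powr (- 1 - 3 * p))"
        using p by (simp add: bend_Q_def abs_mult)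
      also have "\<dots> \<le> (3 * p - 1) * ((2 * V * (1 + 0)) powr p * c powr (- 1 - 3 * p) * R t powr p)"
        using p R1[of t] by (intro mult_left_mono det_powr_bound p c V aR t) auto
      finally show ?thesis by (simp add: mult.assoc)
    qed
  qed simp
qed

text \<open>Integrating the A term by parts leaves the second derivative of \<open>\<phi>\<close>
  tested against B minus the primitive of A, which must therefore be affine almost everywhere. Its
  slope d becomes a component of the conserved vector.\<close>

lemma weak_second_order_equation:
  assumes A: "A absolutely_integrable_on {0..1}" and B: "B absolutely_integrable_on {0..1}"
    and weak: "\<And>\<phi>. test_function \<phi> \<Longrightarrow>
      integral {0..1} (\<lambda>t. vector_derivative \<phi> (at t) * A t +
        vector_derivative (\<lambda>s. vector_derivative \<phi> (at s)) (at t) * B t) = 0"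
  obtains d F where "abs_cont F (\<lambda>t. A t + d)" "negligible {t\<in>{0..1}. B t \<noteq> F t}"
proof -
  let ?I = "\<lambda>t. integral {0..t} A"
  have I: "abs_cont ?I A" by (rule abs_cont_indefinite[OF A])
  have Ii: "?I absolutely_integrable_on {0..1}"
    by (rule absolutely_integrable_continuous_real[OF abs_cont_continuous[OF I]])
  have BI: "(\<lambda>t. B t - ?I t) absolutely_integrable_on {0..1}"
    by (intro set_integral_diff(1) B Ii)
  obtain c d where cd: "negligible {t\<in>{0..1}. B t - ?I t \<noteq> c + d * t}"
  proof (rule du_bois_reymond_2[OF BI])
    fix \<phi> :: "real \<Rightarrow> real" assume \<phi>: "test_function \<phi>"
    let ?d = "\<lambda>t. vector_derivative \<phi> (at t)" and ?dd = "\<lambda>t. vector_derivative (\<lambda>s. vector_derivative \<phi> (at s)) (at t)"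
    have t: "test_function ?d" "test_function ?dd" by (intro test_function_deriv \<phi>)+
    have i: "(\<lambda>t. \<psi> t * f t) integrable_on {0..1}"
      if "test_function \<psi>" "f absolutely_integrable_on {0..1}" for \<psi> f :: "real \<Rightarrow> real"
      by (intro set_lebesgue_integral_eq_integral(1) absolutely_integrable_mult_continuous that
          smooth_continuous_on test_function_smooth)
    have "integral {0..1} (\<lambda>t. ?dd t * (B t - ?I t)) =
        integral {0..1} (\<lambda>t. ?dd t * B t) - integral {0..1} (\<lambda>t. ?dd t * ?I t)"
      using Henstock_Kurzweil_Integration.integral_diff[OF i[OF t(2) B] i[OF t(2) Ii]]
      by (simp add: right_diff_distrib)
    also have "\<dots> = integral {0..1} (\<lambda>t. ?d t * A t) + integral {0..1} (\<lambda>t. ?dd t * B t)"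
      using integral_by_parts_test[OF I t(1)] by simp
    also have "\<dots> = 0"
      using weak[OF \<phi>] Henstock_Kurzweil_Integration.integral_add[OF i[OF t(1) A] i[OF t(2) B]]
      by simp
    finally show "integral {0..1} (\<lambda>t. ?dd t * (B t - ?I t)) = 0" .
  qed blast
  have "abs_cont (\<lambda>t. c + d * t) (\<lambda>t. d)"
    by (rule abs_cont_C1) (auto intro!: derivative_eq_intros)
  then have "abs_cont (\<lambda>t. ?I t + (c + d * t)) (\<lambda>t. A t + d)"
    by (rule abs_cont_add[OF I])
  moreover have "{t\<in>{0..1}. B t - ?I t \<noteq> c + d * t} = {t\<in>{0..1}. B t \<noteq> ?I t + (c + d * t)}"
    by auto
  ultimately show thesis using that cd by metis
qed

lemma test_function_scaleR_axis:
  assumes \<phi>: "test_function (\<phi> :: real \<Rightarrow> real)"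
  shows "test_function (\<lambda>t. \<phi> t *\<^sub>R (u :: real^2))"
    "((\<lambda>t. \<phi> t *\<^sub>R u) has_vector_derivative vector_derivative \<phi> (at t) *\<^sub>R u) (at t)"
proof -
  have s: "smooth \<phi>" by (rule test_function_smooth[OF \<phi>])
  have l: "bounded_linear (\<lambda>x::real. x *\<^sub>R u)" by (rule bounded_linear_scaleR_left)
  obtain a b where "0 < a" "a < b" "b < 1" "\<And>t. \<phi> t \<noteq> 0 \<Longrightarrow> a < t \<and> t < b"
    using test_function_supportE[OF \<phi>] by metis
  then show "test_function (\<lambda>t. \<phi> t *\<^sub>R u)"
    by (intro test_functionI[OF smooth_linear_image[OF s l], of a b]) (auto intro: less_imp_le)
  show "((\<lambda>t. \<phi> t *\<^sub>R u) has_vector_derivative vector_derivative \<phi> (at t) *\<^sub>R u) (at t)"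
    by (rule bounded_linear.has_vector_derivative[OF l smooth_imp_has_vector_derivative[OF s]])
qed

lemma det2_simps:
  "det2 (c *\<^sub>R x) y = c * det2 x y" "det2 x (c *\<^sub>R y) = c * det2 x y"
  "det2 (axis 1 1) y = y $ 2" "det2 (axis 2 1) y = - y $ 1"
  "det2 x (axis 1 1) = - x $ 2" "det2 x (axis 2 1) = x $ 1"
  by (auto simp: det2_def axis_def algebra_simps)

text \<open>The variations are \<open>\<phi>\<close> times a coordinate vector, one per component.
  F1 and F2 form the absolutely continuous representative of P times the rotated gamma', and c1, c2
  are the components of the conserved vector.\<close>

lemma euler_lagrange:
  assumes el: "p_elastica p \<gamma>" and p: "1 < p" and a: "a \<in> Lp p"
    and ac: "\<And>i. abs_cont (\<lambda>t. curve_deriv \<gamma> t $ i) (\<lambda>t. a t $ i)"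
  obtains Q F1 F2 c1 c2 where
    "abs_cont F1 (\<lambda>t. bend_P p (curve_deriv \<gamma> t) (a t) * a t $ 2 + Q t * curve_deriv \<gamma> t $ 1 + c1)"
    "abs_cont F2 (\<lambda>t. - bend_P p (curve_deriv \<gamma> t) (a t) * a t $ 1 + Q t * curve_deriv \<gamma> t $ 2 + c2)"
    "negligible {t\<in>{0..1}. - bend_P p (curve_deriv \<gamma> t) (a t) * curve_deriv \<gamma> t $ 2 \<noteq> F1 t}"
    "negligible {t\<in>{0..1}. bend_P p (curve_deriv \<gamma> t) (a t) * curve_deriv \<gamma> t $ 1 \<noteq> F2 t}"
proof -
  let ?v = "curve_deriv \<gamma>"
  let ?P = "\<lambda>t. bend_P p (?v t) (a t)"
  have im: "immersed_curve p \<gamma>" using el by (simp add: p_elastica_def)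
  obtain lam where crit: "\<And>\<eta>. test_function \<eta> \<Longrightarrow>
      ((\<lambda>\<epsilon>. bending_energy p (\<lambda>t. \<gamma> t + \<epsilon> *\<^sub>R \<eta> t) + lam * curve_length (\<lambda>t. \<gamma> t + \<epsilon> *\<^sub>R \<eta> t))
        has_real_derivative 0) (at 0)"
    using el unfolding p_elastica_def by blast
  have v: "continuous_on {0..1} ?v" and nz: "\<And>t. t \<in> {0..1} \<Longrightarrow> ?v t \<noteq> 0"
    using im by (auto simp: immersed_curve_def)
  have vi: "continuous_on {0..1} (\<lambda>t. ?v t $ i)" for i by (intro continuous_intros v)
  have r: "continuous_on {0..1} (\<lambda>t. norm (?v t) powr (- 1))"
    using nz by (intro continuous_intros v) auto
  \<comment> \<open>Q collects all that multiplies the inner product of gamma' with eta', including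
    the length term with its multiplier. Only its integrability is needed: Q gamma' is tangential
    and vanishes when paired with the normal.\<close>
  define Q where "Q t = bend_Q p (?v t) (a t) + lam * norm (?v t) powr (- 1)" for t
  have P: "?P absolutely_integrable_on {0..1}"
    and Pa: "\<And>i. (\<lambda>t. ?P t * a t $ i) absolutely_integrable_on {0..1}"
    and bQ: "(\<lambda>t. bend_Q p (?v t) (a t)) absolutely_integrable_on {0..1}"
    using bend_coefficients_integrable[OF im p a] by blast+
  have Q: "Q absolutely_integrable_on {0..1}"
    unfolding Q_def
    by (intro set_integral_add(1) bQ absolutely_integrable_continuous_real continuous_intros r)
  have mc: "(\<lambda>t. f t * ?v t $ i) absolutely_integrable_on {0..1}"
    if "f absolutely_integrable_on {0..1}" for f i
    using absolutely_integrable_mult_continuous[OF that vi] by (simp add: mult.commute)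
  have weak: "integral {0..1} (\<lambda>t. vector_derivative \<phi> (at t) * (?P t * det2 u (a t) + Q t * (?v t \<bullet> u)) +
      vector_derivative (\<lambda>s. vector_derivative \<phi> (at s)) (at t) * (?P t * det2 (?v t) u)) = 0"
    if \<phi>: "test_function \<phi>" for \<phi> :: "real \<Rightarrow> real" and u
  proof -
    let ?d = "\<lambda>t. vector_derivative \<phi> (at t)" and ?dd = "\<lambda>t. vector_derivative (\<lambda>s. vector_derivative \<phi> (at s)) (at t)"
    have td: "test_function ?d" by (rule test_function_deriv[OF \<phi>])
    have cd: "continuous_on {0..1} ?d" "continuous_on {0..1} ?dd"
      by (intro smooth_continuous_on test_function_smooth test_function_deriv \<phi>)+
    note fv = first_variation[where lam = lam, OF im p a ac test_function_scaleR_axis(1)[OF \<phi>, of u]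
        test_function_scaleR_axis(2)[OF \<phi>, of u] test_function_scaleR_axis(2)[OF td, of u]]
    from DERIV_unique[OF fv crit[OF test_function_scaleR_axis(1)[OF \<phi>, of u]]]
    have eq: "integral {0..1} (\<lambda>t. bend_deriv p (?v t) (a t) (?d t *\<^sub>R u) (?dd t *\<^sub>R u)) +
        lam * integral {0..1} (\<lambda>t. norm (?v t) powr (- 1) * (?v t \<bullet> (?d t *\<^sub>R u))) = 0" .
    have bd: "bend_deriv p (?v t) (a t) (?d t *\<^sub>R u) (?dd t *\<^sub>R u) =
        ?d t * (?P t * a t $ 2) * u $ 1 - ?d t * (?P t * a t $ 1) * u $ 2 +
        (?dd t * det2 (?v t) u) * ?P t + (?d t * (?v t \<bullet> u)) * bend_Q p (?v t) (a t)" for t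
      by (simp add: bend_deriv_def det2_simps) (simp add: det2_def algebra_simps)
    have i1: "(\<lambda>t. bend_deriv p (?v t) (a t) (?d t *\<^sub>R u) (?dd t *\<^sub>R u)) integrable_on {0..1}"
      unfolding bd det2_def
      by (intro set_lebesgue_integral_eq_integral(1) set_integral_add(1) set_integral_diff(1)
          set_integrable_mult_left absolutely_integrable_mult_continuous P Pa bQ continuous_intros cd vi v)
    have i2: "(\<lambda>t. norm (?v t) powr (- 1) * (?v t \<bullet> (?d t *\<^sub>R u))) integrable_on {0..1}"
      by (intro integrable_continuous_real continuous_on_mult r continuous_intros v cd)
    have "integral {0..1} (\<lambda>t. bend_deriv p (?v t) (a t) (?d t *\<^sub>R u) (?dd t *\<^sub>R u) +
        lam * (norm (?v t) powr (- 1) * (?v t \<bullet> (?d t *\<^sub>R u)))) = 0"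
      using Henstock_Kurzweil_Integration.integral_add[OF i1 integrable_on_mult_right[OF i2, of lam]] eq
      by (simp only: Henstock_Kurzweil_Integration.integral_mult_right)
    moreover have "bend_deriv p (?v t) (a t) (?d t *\<^sub>R u) (?dd t *\<^sub>R u) +
        lam * (norm (?v t) powr (- 1) * (?v t \<bullet> (?d t *\<^sub>R u))) =
        ?d t * (?P t * det2 u (a t) + Q t * (?v t \<bullet> u)) + ?dd t * (?P t * det2 (?v t) u)" for t
      by (simp add: bend_deriv_def det2_simps Q_def algebra_simps)
    ultimately show ?thesis by simp
  qed
  obtain d1 F1 where F1: "abs_cont F1 (\<lambda>t. (?P t * a t $ 2 + Q t * ?v t $ 1) + d1)"
    "negligible {t\<in>{0..1}. ?P t * - ?v t $ 2 \<noteq> F1 t}"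
  proof (rule weak_second_order_equation)
    show "(\<lambda>t. ?P t * a t $ 2 + Q t * ?v t $ 1) absolutely_integrable_on {0..1}"
      by (intro set_integral_add(1) Pa mc Q)
    show "(\<lambda>t. ?P t * - ?v t $ 2) absolutely_integrable_on {0..1}"
      using set_integrable_mult_right[of "- 1", OF mc[OF P, of 2]] by simp
  qed (use weak[of _ "axis 1 1"] in \<open>simp_all add: det2_simps inner_axis\<close>)
  obtain d2 F2 where F2: "abs_cont F2 (\<lambda>t. (?P t * - a t $ 1 + Q t * ?v t $ 2) + d2)"
    "negligible {t\<in>{0..1}. ?P t * ?v t $ 1 \<noteq> F2 t}"
  proof (rule weak_second_order_equation)
    show "(\<lambda>t. ?P t * - a t $ 1 + Q t * ?v t $ 2) absolutely_integrable_on {0..1}"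
      using set_integrable_mult_right[of "- 1", OF Pa[of 1]]
      by (intro set_integral_add(1) mc Q) simp
    show "(\<lambda>t. ?P t * ?v t $ 1) absolutely_integrable_on {0..1}" by (intro mc P)
  qed (use weak[of _ "axis 2 1"] in \<open>simp_all add: det2_simps inner_axis\<close>)
  show thesis using that[of F1 Q d1 F2 d2] F1 F2 by simp
qed

section \<open>Recovering a continuous curvature and a differentiable frame\<close>

lemma continuous_on_signed_powr:
  fixes f :: "'a::topological_space \<Rightarrow> real"
  assumes f: "continuous_on S f" and b: "0 < b"
  shows "continuous_on S (\<lambda>x. sgn (f x) * \<bar>f x\<bar> powr b)"
proof -
  have "continuous_on UNIV (\<lambda>x::real. sgn x * \<bar>x\<bar> powr b)"
  proof (rule continuous_at_imp_continuous_on, intro ballI)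
    fix x :: real
    show "isCont (\<lambda>x::real. sgn x * \<bar>x\<bar> powr b) x"
    proof (cases "x = 0")
      case False
      then show ?thesis by (intro continuous_intros) auto
    next
      case True
      have "((\<lambda>x::real. \<bar>x\<bar> powr b) \<longlongrightarrow> \<bar>0\<bar> powr b) (at 0)"
        using b by (intro tendsto_powr' tendsto_intros) auto
      then have "((\<lambda>x::real. \<bar>x\<bar> powr b) \<longlongrightarrow> 0) (at 0)" by simp
      then have "((\<lambda>x::real. sgn x * \<bar>x\<bar> powr b) \<longlongrightarrow> 0) (at 0)"
        by (rule Lim_null_comparison[rotated])
          (auto intro!: always_eventually simp: abs_mult sgn_if)
      then show ?thesis using True by (simp add: isCont_def)
    qed
  qed
  then show ?thesis by (rule continuous_on_compose2[OF _ f]) simp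
qed

lemma signed_power_inverse:
  fixes k p w :: real
  assumes p: "1 < p" and w: "w = p * sgn k * \<bar>k\<bar> powr (p - 1)"
  shows "sgn w * (\<bar>w\<bar> / p) powr (1 / (p - 1)) = k"
proof (cases "k = 0")
  case False
  have s: "sgn w = sgn k" unfolding w using False p by (simp add: sgn_mult)
  have "\<bar>w\<bar> / p = \<bar>k\<bar> powr (p - 1)" unfolding w using False p by (simp add: abs_mult abs_sgn_eq)
  then have "(\<bar>w\<bar> / p) powr (1 / (p - 1)) = \<bar>k\<bar>" using p False by (simp add: powr_powr)
  then show ?thesis unfolding s by (simp add: sgn_mult_abs)
qed (simp add: w)

text \<open>Here $W = \langle (\gamma')^\perp, F \rangle$ equals $p|k|^{p-2}k$ almost everywhere; all terms
  involving $\gamma''$ cancel in $W'$.\<close>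

lemma elastica_frame:
  assumes el: "p_elastica p \<gamma>" and p: "1 < p"
  obtains W c1 c2 where
    "\<And>t. t \<in> {0..1} \<Longrightarrow>
      (W has_vector_derivative (c2 * curve_deriv \<gamma> t $ 1 - c1 * curve_deriv \<gamma> t $ 2)) (at t within {0..1})"
    "\<And>t. t \<in> {0..1} \<Longrightarrow>
      ((\<lambda>t. curve_deriv \<gamma> t $ 1 / norm (curve_deriv \<gamma> t)) has_vector_derivative
        - (sgn (W t) * (\<bar>W t\<bar> / p) powr (1 / (p - 1)) * curve_deriv \<gamma> t $ 2)) (at t within {0..1})"
    "\<And>t. t \<in> {0..1} \<Longrightarrow>
      ((\<lambda>t. curve_deriv \<gamma> t $ 2 / norm (curve_deriv \<gamma> t)) has_vector_derivative
        sgn (W t) * (\<bar>W t\<bar> / p) powr (1 / (p - 1)) * curve_deriv \<gamma> t $ 1) (at t within {0..1})"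
proof -
  let ?v = "curve_deriv \<gamma>"
  have im: "immersed_curve p \<gamma>" using el by (simp add: p_elastica_def)
  obtain a where a: "a \<in> Lp p" and ac: "\<And>i. abs_cont (\<lambda>t. ?v t $ i) (\<lambda>t. a t $ i)"
    using immersed_curve_second_derivative[OF im p] by metis
  have v: "continuous_on {0..1} ?v" and nz: "\<And>t. t \<in> {0..1} \<Longrightarrow> ?v t \<noteq> 0"
    using im by (auto simp: immersed_curve_def)
  have vi: "continuous_on {0..1} (\<lambda>t. ?v t $ i)" for i by (intro continuous_intros v)
  let ?P = "\<lambda>t. bend_P p (?v t) (a t)" and ?D = "\<lambda>t. det2 (?v t) (a t)" and ?q = "\<lambda>t. norm (?v t)"
  obtain Q F1 F2 c1 c2 where
    F1: "abs_cont F1 (\<lambda>t. ?P t * a t $ 2 + Q t * ?v t $ 1 + c1)" and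
    F2: "abs_cont F2 (\<lambda>t. - ?P t * a t $ 1 + Q t * ?v t $ 2 + c2)" and
    N1: "negligible {t\<in>{0..1}. - ?P t * ?v t $ 2 \<noteq> F1 t}" and
    N2: "negligible {t\<in>{0..1}. ?P t * ?v t $ 1 \<noteq> F2 t}"
    by (rule euler_lagrange[OF el p a ac])
  define N where "N = {t\<in>{0..1}. - ?P t * ?v t $ 2 \<noteq> F1 t} \<union> {t\<in>{0..1}. ?P t * ?v t $ 1 \<noteq> F2 t}"
  have N: "negligible N" unfolding N_def by (intro negligible_Un N1 N2)
  have F: "F1 t = - ?P t * ?v t $ 2" "F2 t = ?P t * ?v t $ 1" if "t \<in> {0..1} - N" for t
    using that by (auto simp: N_def)
  define W where "W t = ?v t $ 1 * F2 t - ?v t $ 2 * F1 t" for t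
  define \<kappa> where "\<kappa> t = sgn (W t) * (\<bar>W t\<bar> / p) powr (1 / (p - 1))" for t
  have q2: "?q t ^ 2 = ?v t $ 1 * ?v t $ 1 + ?v t $ 2 * ?v t $ 2" for t
    by (simp add: power2_norm_eq_inner inner_vec_def sum_2)
  \<comment> \<open>The Q terms cancel as well, since they come from a tangential vector. The
    remaining density is continuous, so W is C^1 although its factors F1, F2 were only absolutely
    continuous.\<close>
  have ACW: "abs_cont W (\<lambda>t. c2 * ?v t $ 1 - c1 * ?v t $ 2)"
    unfolding W_def
    by (rule abs_cont_cong_ae[OF abs_cont_diff[OF abs_cont_mult[OF ac F2] abs_cont_mult[OF ac F1]] N])
      (simp add: F algebra_simps)
  have cW: "continuous_on {0..1} (\<lambda>t. c2 * ?v t $ 1 - c1 * ?v t $ 2)"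
    by (intro continuous_intros v)
  have W': "(W has_vector_derivative (c2 * ?v t $ 1 - c1 * ?v t $ 2)) (at t within {0..1})"
    if "t \<in> {0..1}" for t
    by (rule abs_cont_deriv[OF ACW cW that])
  have Wc: "continuous_on {0..1} W" by (rule abs_cont_continuous[OF ACW])
  have \<kappa>c: "continuous_on {0..1} \<kappa>"
  proof -
    have "\<kappa> = (\<lambda>t. sgn (W t / p) * \<bar>W t / p\<bar> powr (1 / (p - 1)))"
      using p by (auto simp: \<kappa>_def sgn_divide)
    moreover have "continuous_on {0..1} (\<lambda>t. sgn (W t / p) * \<bar>W t / p\<bar> powr (1 / (p - 1)))"
      by (rule continuous_on_signed_powr) (use p in \<open>auto intro!: continuous_intros Wc\<close>)
    ultimately show ?thesis by simp
  qed
  \<comment> \<open>As k = det(gamma', gamma'')/|gamma'|^3, the power |k|^(p-1) carries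
    |gamma'|^(3-3p) = |gamma'|^(1-3p) |gamma'|^2. This matches the weight in W = P |gamma'|^2, so W
    = p |k|^(p-1) sgn k can be inverted for k.\<close>
  have \<kappa>: "\<kappa> t = ?D t / ?q t ^ 3" if t: "t \<in> {0..1} - N" for t
  proof -
    let ?k = "?D t / ?q t ^ 3"
    have q: "?q t > 0" using nz t by simp
    have q23: "?q t powr 3 = ?q t ^ 3" "?q t powr 2 = ?q t ^ 2"
      using powr_realpow[OF q, of 3] powr_realpow[OF q, of 2] by simp_all
    have "\<bar>?k\<bar> powr (p - 1) = \<bar>?D t\<bar> powr (p - 1) / (?q t powr 3) powr (p - 1)"
      using q by (simp add: abs_divide powr_divide q23)
    also have "\<dots> = \<bar>?D t\<bar> powr (p - 1) / ?q t powr (3 * (p - 1))" by (simp only: powr_powr)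
    also have "\<dots> = \<bar>?D t\<bar> powr (p - 1) * ?q t powr (1 - 3 * p) * ?q t powr 2"
    proof -
      have "?q t powr (1 - 3 * p) * ?q t powr 2 = ?q t powr (- (3 * (p - 1)))"
        unfolding powr_add[symmetric] by (rule arg_cong[where f = "\<lambda>x. ?q t powr x"]) simp
      then show ?thesis by (simp only: powr_minus_divide mult.assoc times_divide_eq_right mult_1_right)
    qed
    finally have k: "\<bar>?k\<bar> powr (p - 1) = \<bar>?D t\<bar> powr (p - 1) * ?q t powr (1 - 3 * p) * ?q t ^ 2"
      using q23(2) by simp
    have "W t = ?P t * ?q t ^ 2" unfolding W_def F[OF t] q2 by (simp add: algebra_simps)
    also have "\<dots> = p * sgn (?D t) * \<bar>?k\<bar> powr (p - 1)"
      unfolding bend_P_def k by (simp only: mult_ac)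
    also have "\<dots> = p * sgn ?k * \<bar>?k\<bar> powr (p - 1)" using q by (simp add: sgn_divide)
    finally have W: "W t = p * sgn ?k * \<bar>?k\<bar> powr (p - 1)" .
    then show ?thesis unfolding \<kappa>_def by (rule signed_power_inverse[OF p])
  qed
  obtain c V where c: "0 < c" "\<And>t. t \<in> {0..1} \<Longrightarrow> c \<le> ?q t" and V: "\<And>t. t \<in> {0..1} \<Longrightarrow> ?q t \<le> V"
    using curve_deriv_bounds[OF im] by metis
  \<comment> \<open>1/|gamma'| is handled as the power -1/2 of the polynomial expression |gamma'|^2,
    whose values lie in [c^2, V^2], away from the singularity at 0.\<close>
  let ?u = "\<lambda>t. ?v t $ 1 * ?v t $ 1 + ?v t $ 2 * ?v t $ 2"
  let ?h = "\<lambda>x::real. x powr (- 1 / 2)" and ?h' = "\<lambda>x::real. (- 1 / 2) * x powr (- 3 / 2)"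
  have hu: "?h (?u t) = 1 / ?q t" "?h' (?u t) = - 1 / (2 * ?q t ^ 3)" if "t \<in> {0..1}" for t
  proof -
    have q: "?q t > 0" using nz that by simp
    have "?u t = ?q t powr 2" using powr_realpow[OF q, of 2] q2[of t] by simp
    then have u: "?u t powr s = ?q t powr (2 * s)" for s by (simp only: powr_powr)
    have 1: "?h (?u t) = ?q t powr (- 1)" and 2: "(?u t) powr (- 3 / 2) = ?q t powr (- 3)"
      unfolding u by simp_all
    show "?h (?u t) = 1 / ?q t" unfolding 1 using q by (simp add: powr_minus divide_inverse)
    have "?q t powr (- 3) = 1 / ?q t ^ 3"
      using powr_realpow[OF q, of 3] by (simp add: powr_minus divide_inverse)
    then show "?h' (?u t) = - 1 / (2 * ?q t ^ 3)" unfolding 2 by simp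
  qed
  have H: "abs_cont (\<lambda>t. ?h (?u t)) (\<lambda>t. ?h' (?u t) * ((?v t $ 1 * a t $ 1 + ?v t $ 1 * a t $ 1) +
      (?v t $ 2 * a t $ 2 + ?v t $ 2 * a t $ 2)))"
  proof (rule abs_cont_compose[where a = "c\<^sup>2" and b = "V\<^sup>2",
        OF abs_cont_add[OF abs_cont_mult[OF ac ac] abs_cont_mult[OF ac ac]]])
    show "?u ` {0..1} \<subseteq> {c\<^sup>2..V\<^sup>2}"
      using c V by (auto simp: q2[symmetric] intro!: power_mono)
    have c2: "0 < c\<^sup>2" using c(1) by simp
    show "(?h has_real_derivative ?h' x) (at x)" if "x \<in> {c\<^sup>2..V\<^sup>2}" for x
    proof -
      have "0 < x" using that c2 by (meson atLeastAtMost_iff less_le_trans)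
      then show ?thesis using has_real_derivative_powr[of x "- 1 / 2"] by simp
    qed
    show "continuous_on {c\<^sup>2..V\<^sup>2} ?h'"
      using c2 by (intro continuous_intros) auto
  qed
  have T: "((\<lambda>t. ?v t $ i / ?q t) has_vector_derivative \<kappa> t * (if i = 1 then - ?v t $ 2 else ?v t $ 1)) (at t within {0..1})"
    if t: "t \<in> {0..1}" for t and i :: 2
  proof -
    have "abs_cont (\<lambda>t. ?v t $ i * ?h (?u t)) (\<lambda>t. \<kappa> t * (if i = 1 then - ?v t $ 2 else ?v t $ 1))"
    proof (rule abs_cont_cong_ae[OF abs_cont_mult[OF ac H] N])
      fix t assume t: "t \<in> {0..1} - N"
      have q: "?q t > 0" using nz t by simp
      have i: "i = 1 \<or> i = 2" using exhaust_2 by blast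
      have "?h (?u t) * a t $ i + ?v t $ i * (?h' (?u t) * ((?v t $ 1 * a t $ 1 + ?v t $ 1 * a t $ 1) +
          (?v t $ 2 * a t $ 2 + ?v t $ 2 * a t $ 2))) =
          (?q t ^ 2 * a t $ i - ?v t $ i * (?v t $ 1 * a t $ 1 + ?v t $ 2 * a t $ 2)) / ?q t ^ 3"
        using hu[of t] t q by (simp add: field_simps power2_eq_square power3_eq_cube)
      \<comment> \<open>The tangential part of gamma'' drops out, leaving the curvature times the
        rotated gamma'. The curvature may be replaced by the continuous function
        \<open>\<kappa>\<close>, so the unit tangent is C^1.\<close>
      also have "\<dots> = ?D t / ?q t ^ 3 * (if i = 1 then - ?v t $ 2 else ?v t $ 1)"
        using i by (auto simp: q2 det2_def algebra_simps)
      finally show "\<kappa> t * (if i = 1 then - ?v t $ 2 else ?v t $ 1) =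
          ?h (?u t) * a t $ i + ?v t $ i * (?h' (?u t) * ((?v t $ 1 * a t $ 1 + ?v t $ 1 * a t $ 1) +
          (?v t $ 2 * a t $ 2 + ?v t $ 2 * a t $ 2)))"
        using \<kappa>[OF t] by simp
    qed
    then have "abs_cont (\<lambda>t. ?v t $ i / ?q t) (\<lambda>t. \<kappa> t * (if i = 1 then - ?v t $ 2 else ?v t $ 1))"
      by (rule abs_cont_cong) (use hu(1) in simp)
    then show ?thesis
      by (rule abs_cont_deriv[OF _ _ t]) (cases "i = 1"; auto intro!: continuous_intros \<kappa>c vi)
  qed
  show thesis
  proof (rule that[OF W'])
    fix t :: real assume t: "t \<in> {0..1}"
    show "((\<lambda>t. ?v t $ 1 / ?q t) has_vector_derivative
        - (sgn (W t) * (\<bar>W t\<bar> / p) powr (1 / (p - 1)) * ?v t $ 2)) (at t within {0..1})"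
      using T[OF t, of 1] by (simp add: \<kappa>_def)
    show "((\<lambda>t. ?v t $ 2 / ?q t) has_vector_derivative
        sgn (W t) * (\<bar>W t\<bar> / p) powr (1 / (p - 1)) * ?v t $ 1) (at t within {0..1})"
      using T[OF t, of 2] by (simp add: \<kappa>_def)
  qed
qed

subsection \<open>Analyticity from derivative bounds\<close>

text \<open>The Taylor remainder of order n is at most M (n+1) (R |y-x|)^(n+1), which tends to 0;
  the factor n+1 appears because the remainder estimate divides by n! only. Derivatives are relative
  to [0,L], so x may be an endpoint.\<close>

lemma taylor_sums:
  fixes Df :: "nat \<Rightarrow> real \<Rightarrow> real"
  assumes deriv: "\<And>m t. t \<in> {0..L} \<Longrightarrow>
      (Df m has_vector_derivative Df (Suc m) t) (at t within {0..L})"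
    and bound: "\<And>m t. t \<in> {0..L} \<Longrightarrow> \<bar>Df m t\<bar> \<le> M * R ^ m * fact m"
    and R: "0 < R" and x: "x \<in> {0..L}" and y: "y \<in> {0..L}" and xy: "\<bar>y - x\<bar> < 1 / R"
  shows "(\<lambda>n. (y - x) ^ n * (Df n x / fact n)) sums Df 0 y"
proof -
  have le: "norm (Df 0 y - (\<Sum>i\<le>n. Df i x * (y - x) ^ i / fact i)) \<le> M * (real (Suc n) * (R * \<bar>y - x\<bar>) ^ Suc n)" for n
  proof -
    have "norm (Df 0 y - (\<Sum>i\<le>n. Df i x * (y - x) ^ i / fact i)) \<le>
        (M * R ^ Suc n * fact (Suc n)) * norm (y - x) ^ Suc n / fact n"
    proof (rule field_Taylor[where S = "{0..L}", OF _ _ _ x y])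
      show "norm (Df (Suc n) t) \<le> M * R ^ Suc n * fact (Suc n)" if "t \<in> {0..L}" for t
        using bound[OF that, of "Suc n"] by simp
    qed (use deriv in \<open>auto simp: has_real_derivative_iff_has_vector_derivative\<close>)
    also have "\<dots> = M * (real (Suc n) * (R * \<bar>y - x\<bar>) ^ Suc n)"
      by (simp add: power_mult_distrib field_simps)
    finally show ?thesis by simp
  qed
  have "(\<lambda>n. M * (real (Suc n) * (R * \<bar>y - x\<bar>) ^ Suc n)) \<longlonglongrightarrow> M * 0"
  proof (intro tendsto_intros)
    have "R * \<bar>y - x\<bar> < 1" using xy R by (simp add: field_simps)
    then have "(\<lambda>n. real n * (R * \<bar>y - x\<bar>) ^ n) \<longlonglongrightarrow> 0"
      using R by (intro powser_times_n_limit_0) simp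
    then show "(\<lambda>n. real (Suc n) * (R * \<bar>y - x\<bar>) ^ Suc n) \<longlonglongrightarrow> 0" by (rule LIMSEQ_Suc)
  qed
  then have lim: "(\<lambda>n. M * (real (Suc n) * (R * \<bar>y - x\<bar>) ^ Suc n)) \<longlonglongrightarrow> 0" by simp
  have "(\<lambda>n. Df 0 y - (\<Sum>i\<le>n. Df i x * (y - x) ^ i / fact i)) \<longlonglongrightarrow> 0"
    by (rule Lim_null_comparison[OF always_eventually lim]) (use le in blast)
  from tendsto_diff[OF tendsto_const[of "Df 0 y"] this]
  have "(\<lambda>n. \<Sum>i\<le>n. (y - x) ^ i * (Df i x / fact i)) \<longlonglongrightarrow> Df 0 y"
    by (simp add: mult.commute)
  then show ?thesis by (simp add: sums_def_le)
qed

lemma real_analytic_on_vec: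
  fixes f :: "real \<Rightarrow> real^'n" and Df :: "'n \<Rightarrow> nat \<Rightarrow> real \<Rightarrow> real"
  assumes f: "\<And>i t. t \<in> {0..L} \<Longrightarrow> f t $ i = Df i 0 t"
    and deriv: "\<And>i m t. t \<in> {0..L} \<Longrightarrow>
      (Df i m has_vector_derivative Df i (Suc m) t) (at t within {0..L})"
    and bound: "\<And>i m t. t \<in> {0..L} \<Longrightarrow> \<bar>Df i m t\<bar> \<le> M * R ^ m * fact m" and R: "0 < R"
  shows "real_analytic_on f {0..L}"
  unfolding real_analytic_on_def
proof (intro ballI)
  fix x assume x: "x \<in> {0..L}"
  show "\<exists>r>0. \<exists>a. \<forall>y\<in>{0..L}. \<bar>y - x\<bar> < r \<longrightarrow> (\<lambda>n. (y - x) ^ n *\<^sub>R a n) sums f y"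
  proof (intro exI[of _ "1 / R"] conjI exI[of _ "\<lambda>n. \<chi> i. Df i n x / fact n"] ballI impI)
    show "1 / R > 0" using R by simp
    fix y assume y: "y \<in> {0..L}" "\<bar>y - x\<bar> < 1 / R"
    have "(\<lambda>n. (y - x) ^ n * (Df i n x / fact n)) sums f y $ i" for i
      using taylor_sums[of L "Df i", OF deriv bound R x y] f[OF y(1)] by simp
    then show "(\<lambda>n. (y - x) ^ n *\<^sub>R (\<chi> i. Df i n x / fact n)) sums f y"
      unfolding sums_def by (intro vec_tendstoI) (simp add: sum_component)
  qed
qed

text \<open>The $j$-th derivative of a solution of a polynomial system is a polynomial in the solution
  whose degree grows linearly in $j$, so the sum of its coefficients grows at most like $C^j j!$.\<close>

inductive poly_bound :: "(real \<Rightarrow> real) \<Rightarrow> (real \<Rightarrow> real) \<Rightarrow> (real \<Rightarrow> real) \<Rightarrow> nat \<Rightarrow> real \<Rightarrow> (real \<Rightarrow> real) \<Rightarrow> bool"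
  for x y w d where
  monom: "i + j + k \<le> d \<Longrightarrow> \<bar>c\<bar> \<le> C \<Longrightarrow> poly_bound x y w d C (\<lambda>s. c * (x s ^ i * y s ^ j * w s ^ k))"
| sum: "poly_bound x y w d C f \<Longrightarrow> poly_bound x y w d C' g \<Longrightarrow> C + C' \<le> C'' \<Longrightarrow>
    poly_bound x y w d C'' (\<lambda>s. f s + g s)"

lemma poly_bound_mono:
  "poly_bound x y w d C f \<Longrightarrow> C \<le> C' \<Longrightarrow> poly_bound x y w d C' f"
proof (induction arbitrary: C' rule: poly_bound.induct)
  case (monom i j k c C)
  then show ?case by (intro poly_bound.monom) auto
next
  case (sum C f D g E)
  show ?case by (rule poly_bound.sum[OF sum.hyps(1,2)]) (use sum in simp)
qed

lemma poly_bound_abs_le: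
  assumes "poly_bound x y w d C f" and M: "1 \<le> M"
    and s: "\<bar>x s\<bar> \<le> M" "\<bar>y s\<bar> \<le> M" "\<bar>w s\<bar> \<le> M"
  shows "\<bar>f s\<bar> \<le> C * M ^ d"
  using assms(1)
proof (induction rule: poly_bound.induct)
  case (monom i j k c C)
  have "\<bar>x s ^ i * y s ^ j * w s ^ k\<bar> \<le> M ^ i * M ^ j * M ^ k"
    unfolding abs_mult power_abs using s M by (intro mult_mono power_mono) auto
  also have "\<dots> = M ^ (i + j + k)" by (simp add: power_add)
  also have "\<dots> \<le> M ^ d" using M monom by (intro power_increasing) auto
  finally show ?case unfolding abs_mult[of c] using monom M by (intro mult_mono) auto
next
  case (sum C f D g E)
  have "\<bar>f s + g s\<bar> \<le> (C + D) * M ^ d" using sum.IH by (simp add: distrib_right)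
  also have "\<dots> \<le> E * M ^ d" using sum.hyps M by (intro mult_right_mono) auto
  finally show ?case .
qed

text \<open>A monomial of degree at most d has at most d factors to differentiate. Differentiating a
  factor x or y contributes coefficient 1, and a factor w contributes
  \<open>\<bar>\<alpha>\<bar> + \<bar>\<beta>\<bar>\<close>.\<close>

lemma poly_bound_deriv:
  assumes "poly_bound x y w d C f"
    and x': "\<And>s. s \<in> S \<Longrightarrow> (x has_real_derivative - (w s ^ n * y s)) (at s within S)"
    and y': "\<And>s. s \<in> S \<Longrightarrow> (y has_real_derivative w s ^ n * x s) (at s within S)"
    and w': "\<And>s. s \<in> S \<Longrightarrow> (w has_real_derivative \<alpha> * x s + \<beta> * y s) (at s within S)"
  shows "\<exists>f'. poly_bound x y w (d + (n + 1)) (C * (real d * (1 + \<bar>\<alpha>\<bar> + \<bar>\<beta>\<bar>))) f' \<and>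
    (\<forall>s\<in>S. (f has_real_derivative f' s) (at s within S))"
  using assms(1)
proof (induction rule: poly_bound.induct)
  case (monom i j k c C)
  \<comment> \<open>The true degree grows by at most n. The allowance n + 1 also covers the terms
    with coefficient 0 in which a subtraction such as i - 1 is truncated at 0.\<close>
  let ?A = "\<lambda>s. (- (c * i)) * (x s ^ (i - 1) * y s ^ (j + 1) * w s ^ (k + n))"
  let ?B = "\<lambda>s. (c * j) * (x s ^ (i + 1) * y s ^ (j - 1) * w s ^ (k + n))"
  let ?E = "\<lambda>s. (c * k * \<alpha>) * (x s ^ (i + 1) * y s ^ j * w s ^ (k - 1))"
  let ?F = "\<lambda>s. (c * k * \<beta>) * (x s ^ i * y s ^ (j + 1) * w s ^ (k - 1))"
  let ?f' = "\<lambda>s. (?A s + ?B s) + (?E s + ?F s)"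
  show ?case
  proof (intro exI[of _ ?f'] conjI ballI)
    have "\<bar>c\<bar> * real i + \<bar>c\<bar> * real j + (\<bar>c\<bar> * real k * \<bar>\<alpha>\<bar> + \<bar>c\<bar> * real k * \<bar>\<beta>\<bar>) \<le>
        \<bar>c\<bar> * (real (i + j + k) * (1 + \<bar>\<alpha>\<bar> + \<bar>\<beta>\<bar>))"
      by (simp add: algebra_simps)
    also have "\<dots> \<le> C * (real d * (1 + \<bar>\<alpha>\<bar> + \<bar>\<beta>\<bar>))"
      using monom by (intro mult_mono) auto
    finally have C: "(\<bar>c\<bar> * real i + \<bar>c\<bar> * real j) + (\<bar>c\<bar> * real k * \<bar>\<alpha>\<bar> + \<bar>c\<bar> * real k * \<bar>\<beta>\<bar>) \<le>
        C * (real d * (1 + \<bar>\<alpha>\<bar> + \<bar>\<beta>\<bar>))" .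
    have A: "poly_bound x y w (d + (n + 1)) (\<bar>c\<bar> * real i) ?A"
      by (rule poly_bound.monom) (use monom(1) in \<open>linarith, simp add: abs_mult\<close>)
    have B: "poly_bound x y w (d + (n + 1)) (\<bar>c\<bar> * real j) ?B"
      by (rule poly_bound.monom) (use monom(1) in \<open>linarith, simp add: abs_mult\<close>)
    have E: "poly_bound x y w (d + (n + 1)) (\<bar>c\<bar> * real k * \<bar>\<alpha>\<bar>) ?E"
      by (rule poly_bound.monom) (use monom(1) in \<open>linarith, simp add: abs_mult\<close>)
    have F: "poly_bound x y w (d + (n + 1)) (\<bar>c\<bar> * real k * \<bar>\<beta>\<bar>) ?F"
      by (rule poly_bound.monom) (use monom(1) in \<open>linarith, simp add: abs_mult\<close>)
    show "poly_bound x y w (d + (n + 1)) (C * (real d * (1 + \<bar>\<alpha>\<bar> + \<bar>\<beta>\<bar>))) ?f'"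
      by (rule poly_bound.sum[OF poly_bound.sum[OF A B order_refl] poly_bound.sum[OF E F order_refl] C])
    fix s assume s: "s \<in> S"
    show "((\<lambda>s. c * (x s ^ i * y s ^ j * w s ^ k)) has_real_derivative ?f' s) (at s within S)"
      by (rule derivative_eq_intros x'[OF s] y'[OF s] w'[OF s] refl)+
        (simp add: algebra_simps power_add)
  qed
next
  case (sum C f D g E)
  then obtain f' g' where fg: "poly_bound x y w (d + (n + 1)) (C * (real d * (1 + \<bar>\<alpha>\<bar> + \<bar>\<beta>\<bar>))) f'"
    "poly_bound x y w (d + (n + 1)) (D * (real d * (1 + \<bar>\<alpha>\<bar> + \<bar>\<beta>\<bar>))) g'"
    "\<forall>s\<in>S. (f has_real_derivative f' s) (at s within S)"
    "\<forall>s\<in>S. (g has_real_derivative g' s) (at s within S)" by blast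
  have "C * (real d * (1 + \<bar>\<alpha>\<bar> + \<bar>\<beta>\<bar>)) + D * (real d * (1 + \<bar>\<alpha>\<bar> + \<bar>\<beta>\<bar>)) \<le>
      E * (real d * (1 + \<bar>\<alpha>\<bar> + \<bar>\<beta>\<bar>))"
    unfolding distrib_right[symmetric] using sum.hyps by (intro mult_right_mono) auto
  note pb = poly_bound.sum[OF fg(1,2) this]
  have "((\<lambda>s. f s + g s) has_real_derivative f' s + g' s) (at s within S)" if "s \<in> S" for s
    using fg(3,4) that by (intro DERIV_add) blast+
  then show ?case using pb by (intro exI[of _ "\<lambda>s. f' s + g' s"]) simp
qed

text \<open>The m-th derivative has degree at most 1 + m(n+1) <= (n+2)(m+1). Hence the next
  differentiation multiplies the coefficient bound by at most K(m+1), with K =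
  \<open>(1 + \<bar>\<alpha>\<bar> + \<bar>\<beta>\<bar>) * (n + 2)\<close>, and these factors
  accumulate to K^m m!.\<close>

lemma poly_ode_derivative_bounds:
  assumes f: "poly_bound x y w 1 1 f"
    and x': "\<And>s. s \<in> S \<Longrightarrow> (x has_real_derivative - (w s ^ n * y s)) (at s within S)"
    and y': "\<And>s. s \<in> S \<Longrightarrow> (y has_real_derivative w s ^ n * x s) (at s within S)"
    and w': "\<And>s. s \<in> S \<Longrightarrow> (w has_real_derivative \<alpha> * x s + \<beta> * y s) (at s within S)"
    and M: "1 \<le> M" "\<And>s. s \<in> S \<Longrightarrow> \<bar>x s\<bar> \<le> M" "\<And>s. s \<in> S \<Longrightarrow> \<bar>y s\<bar> \<le> M"
      "\<And>s. s \<in> S \<Longrightarrow> \<bar>w s\<bar> \<le> M"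
  obtains Df where "Df 0 = f"
    "\<And>m s. s \<in> S \<Longrightarrow> (Df m has_real_derivative Df (Suc m) s) (at s within S)"
    "\<And>m s. s \<in> S \<Longrightarrow> \<bar>Df m s\<bar> \<le> M * ((1 + \<bar>\<alpha>\<bar> + \<bar>\<beta>\<bar>) * (n + 2) * M ^ (n + 1)) ^ m * fact m"
proof -
  let ?K = "(1 + \<bar>\<alpha>\<bar> + \<bar>\<beta>\<bar>) * (n + 2)"
  \<comment> \<open>The first conjunct ties the start of the chosen sequence to f, since dependent
    choice returns only what the predicate records.\<close>
  let ?P = "\<lambda>m g. (m = 0 \<longrightarrow> g = f) \<and> poly_bound x y w (1 + m * (n + 1)) (?K ^ m * fact m) g"
  have "\<exists>Df. \<forall>m. ?P m (Df m) \<and> (\<forall>s\<in>S. (Df m has_real_derivative Df (Suc m) s) (at s within S))"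
  proof (rule dependent_nat_choice)
    show "\<exists>g. ?P 0 g" using f by (intro exI[of _ f]) simp
    fix g m assume g: "?P m g"
    obtain g' where g': "poly_bound x y w (1 + m * (n + 1) + (n + 1))
        (?K ^ m * fact m * (real (1 + m * (n + 1)) * (1 + \<bar>\<alpha>\<bar> + \<bar>\<beta>\<bar>))) g'"
      "\<forall>s\<in>S. (g has_real_derivative g' s) (at s within S)"
      using poly_bound_deriv[OF conjunct2[OF g] x' y' w'] by blast
    have "real (1 + m * (n + 1)) * (1 + \<bar>\<alpha>\<bar> + \<bar>\<beta>\<bar>) \<le> (real (n + 2) * real (Suc m)) * (1 + \<bar>\<alpha>\<bar> + \<bar>\<beta>\<bar>)"
      by (intro mult_right_mono) (auto simp: algebra_simps)
    then have "?K ^ m * fact m * (real (1 + m * (n + 1)) * (1 + \<bar>\<alpha>\<bar> + \<bar>\<beta>\<bar>)) \<le>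
        ?K ^ m * fact m * ((real (n + 2) * real (Suc m)) * (1 + \<bar>\<alpha>\<bar> + \<bar>\<beta>\<bar>))"
      by (intro mult_left_mono) auto
    also have "\<dots> = ?K ^ Suc m * fact (Suc m)" by (simp add: algebra_simps)
    finally have "poly_bound x y w (1 + Suc m * (n + 1)) (?K ^ Suc m * fact (Suc m)) g'"
      using poly_bound_mono[OF g'(1)] by (simp add: algebra_simps)
    then show "\<exists>g'. ?P (Suc m) g' \<and> (\<forall>s\<in>S. (g has_real_derivative g' s) (at s within S))"
      using g'(2) by blast
  qed
  then obtain Df where Df: "\<And>m. ?P m (Df m)"
    "\<And>m s. s \<in> S \<Longrightarrow> (Df m has_real_derivative Df (Suc m) s) (at s within S)" by blast
  have "\<bar>Df m s\<bar> \<le> M * (?K * M ^ (n + 1)) ^ m * fact m" if s: "s \<in> S" for m s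
  proof -
    have "\<bar>Df m s\<bar> \<le> ?K ^ m * fact m * M ^ (1 + m * (n + 1))"
      using Df(1)[of m] M s by (intro poly_bound_abs_le) auto
    also have "\<dots> = M * (?K * M ^ (n + 1)) ^ m * fact m"
    proof -
      have "M ^ (1 + m * (n + 1)) = M * (M ^ (n + 1)) ^ m"
        unfolding power_mult[symmetric] mult.commute[of m] power_add[of M 1] power_one_right by (rule refl)
      then show ?thesis by (simp only: power_mult_distrib mult_ac)
    qed
    finally show ?thesis .
  qed
  then show thesis using that[of Df] Df by blast
qed

subsection \<open>Arclength parametrization\<close>

text \<open>Formulated relative to sets because arclength and its inverse are differentiated from
  one side at the endpoints. The difference quotients of g are the reciprocals of those of f along
  g.\<close>

lemma has_real_derivative_inverse_within:
  fixes f g :: "real \<Rightarrow> real"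
  assumes f: "(f has_real_derivative D) (at (g s) within S)" and D: "D \<noteq> 0"
    and g: "continuous (at s within T) g" and gf: "\<And>y. y \<in> T \<Longrightarrow> g y \<in> S \<and> f (g y) = y"
    and s: "s \<in> T"
  shows "(g has_real_derivative 1 / D) (at s within T)"
proof -
  have fg: "filterlim g (at (g s) within S) (at s within T)"
    unfolding filterlim_at
  proof
    show "(g \<longlongrightarrow> g s) (at s within T)" using g by (simp add: continuous_within)
    have "\<forall>\<^sub>F y in at s within T. y \<in> T \<and> y \<noteq> s" by (simp add: eventually_at_filter)
    then show "\<forall>\<^sub>F y in at s within T. g y \<in> S \<and> g y \<noteq> g s"
      by (rule eventually_mono) (use gf s in metis)
  qed
  have "((\<lambda>t. (f t - f (g s)) / (t - g s)) \<longlongrightarrow> D) (at (g s) within S)"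
    using f by (simp add: has_field_derivative_iff)
  from filterlim_compose[OF this fg]
  have "((\<lambda>y. (f (g y) - f (g s)) / (g y - g s)) \<longlongrightarrow> D) (at s within T)" .
  from tendsto_divide[OF tendsto_const[of 1] this D]
  have "((\<lambda>y. (g y - g s) / (f (g y) - f (g s))) \<longlongrightarrow> 1 / D) (at s within T)" by simp
  then have "((\<lambda>y. (g y - g s) / (y - s)) \<longlongrightarrow> 1 / D) (at s within T)"
    by (rule Lim_transform_eventually)
      (use gf s in \<open>auto simp: eventually_at_filter intro!: always_eventually\<close>)
  then show ?thesis by (simp add: has_field_derivative_iff)
qed

lemma arclength_eq:
  assumes "immersed_curve p \<gamma>" "t \<in> {0..1}"
  shows "arclength \<gamma> t = integral {0..t} (\<lambda>u. norm (curve_deriv \<gamma> u))"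
proof -
  have v: "continuous_on {0..1} (curve_deriv \<gamma>)" using assms by (simp add: immersed_curve_def)
  have "continuous_on {0..t} (curve_deriv \<gamma>)"
    by (rule continuous_on_subset[OF v]) (use assms in auto)
  then show ?thesis
    unfolding arclength_def
    by (intro set_lebesgue_integral_eq_integral(2) absolutely_integrable_continuous_real continuous_on_norm)
qed

lemma arclength_deriv:
  assumes im: "immersed_curve p \<gamma>" and t: "t \<in> {0..1}"
  shows "(arclength \<gamma> has_real_derivative norm (curve_deriv \<gamma> t)) (at t within {0..1})"
proof -
  have "((\<lambda>t. integral {0..t} (\<lambda>u. norm (curve_deriv \<gamma> u))) has_real_derivative norm (curve_deriv \<gamma> t))
      (at t within {0..1})"
    using im by (intro integral_has_real_derivative continuous_on_norm t) (auto simp: immersed_curve_def)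
  then show ?thesis
    unfolding has_real_derivative_iff_has_vector_derivative
    by (rule has_vector_derivative_transform[OF t, rotated]) (simp add: arclength_eq[OF im])
qed

lemma arclength_mvt:
  assumes im: "immersed_curve p \<gamma>" and "0 \<le> s" "s < t" "t \<le> 1"
  obtains z where "s < z" "z < t" "arclength \<gamma> t - arclength \<gamma> s = (t - s) * norm (curve_deriv \<gamma> z)"
proof -
  have "\<exists>z\<in>{s<..<t}. arclength \<gamma> t - arclength \<gamma> s = norm (curve_deriv \<gamma> z) * (t - s)"
  proof (rule mvt_simple[OF \<open>s < t\<close>, of "arclength \<gamma>" "\<lambda>z. (*) (norm (curve_deriv \<gamma> z))"])
    fix z assume z: "s \<le> z" "z \<le> t"
    have "(arclength \<gamma> has_real_derivative norm (curve_deriv \<gamma> z)) (at z within {s..t})"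
      by (rule DERIV_subset[OF arclength_deriv[OF im]]) (use z assms in auto)
    then show "(arclength \<gamma> has_derivative (*) (norm (curve_deriv \<gamma> z))) (at z within {s..t})"
      by (simp add: has_field_derivative_def)
  qed
  then show thesis using that by (auto simp: mult.commute)
qed

lemma arclength_strict_mono:
  assumes im: "immersed_curve p \<gamma>" and "0 \<le> s" "s < t" "t \<le> 1"
  shows "arclength \<gamma> s < arclength \<gamma> t"
proof -
  obtain z where z: "s < z" "z < t" "arclength \<gamma> t - arclength \<gamma> s = (t - s) * norm (curve_deriv \<gamma> z)"
    by (rule arclength_mvt[OF assms])
  have "curve_deriv \<gamma> z \<noteq> 0" using im z assms by (auto simp: immersed_curve_def)
  then have "(t - s) * norm (curve_deriv \<gamma> z) > 0" using assms by simp
  then show ?thesis using z(3) by linarith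
qed

lemma arclength_inj:
  assumes im: "immersed_curve p \<gamma>"
  shows "inj_on (arclength \<gamma>) {0..1}"
  by (rule inj_onI) (metis arclength_strict_mono[OF im] atLeastAtMost_iff linorder_neqE_linordered_idom order_less_irrefl)

lemma arclength_image:
  assumes im: "immersed_curve p \<gamma>"
  shows "arclength \<gamma> ` {0..1} = {0..curve_length \<gamma>}"
proof -
  have 0: "arclength \<gamma> 0 = 0" by (simp add: arclength_eq[OF im])
  have c: "continuous_on {0..1} (arclength \<gamma>)"
    by (rule DERIV_continuous_on[OF arclength_deriv[OF im]])
  have mono: "arclength \<gamma> s \<le> arclength \<gamma> t" if "0 \<le> s" "s \<le> t" "t \<le> 1" for s t
    using arclength_strict_mono[OF im, of s t] that by (cases "s = t") auto
  show ?thesis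
  proof (intro equalityI subsetI)
    fix s assume "s \<in> arclength \<gamma> ` {0..1}"
    then show "s \<in> {0..curve_length \<gamma>}" using mono[of 0] mono[of _ 1] 0 by (auto simp: curve_length_def)
  next
    fix s assume "s \<in> {0..curve_length \<gamma>}"
    then obtain t where "0 \<le> t" "t \<le> 1" "arclength \<gamma> t = s"
      using IVT'[of "arclength \<gamma>" 0 s 1] 0 c by (auto simp: curve_length_def)
    then show "s \<in> arclength \<gamma> ` {0..1}" by auto
  qed
qed

lemma arclength_inverse_deriv:
  assumes im: "immersed_curve p \<gamma>" and s: "s \<in> {0..curve_length \<gamma>}"
  defines "\<tau> \<equiv> inv_into {0..1} (arclength \<gamma>)"
  shows "\<tau> s \<in> {0..1}"
    "(\<tau> has_real_derivative 1 / norm (curve_deriv \<gamma> (\<tau> s))) (at s within {0..curve_length \<gamma>})"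
proof -
  let ?T = "{0..curve_length \<gamma>}"
  have \<tau>: "\<tau> y \<in> {0..1} \<and> arclength \<gamma> (\<tau> y) = y" if "y \<in> ?T" for y
    using that arclength_image[OF im] unfolding \<tau>_def by (metis f_inv_into_f inv_into_into)
  then show 1: "\<tau> s \<in> {0..1}" using s by blast
  have "continuous_on {0..1} (arclength \<gamma>)"
    by (rule DERIV_continuous_on[OF arclength_deriv[OF im]])
  then have "continuous_on ?T \<tau>"
    unfolding \<tau>_def arclength_image[OF im, symmetric]
    by (rule continuous_on_inv) (simp_all add: inv_into_f_f[OF arclength_inj[OF im]])
  then have c: "continuous (at s within ?T) \<tau>"
    using s by (simp add: continuous_on_eq_continuous_within)
  have "norm (curve_deriv \<gamma> (\<tau> s)) \<noteq> 0" using 1 im by (simp add: immersed_curve_def)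
  then show "(\<tau> has_real_derivative 1 / norm (curve_deriv \<gamma> (\<tau> s))) (at s within ?T)"
    by (rule has_real_derivative_inverse_within[where g = \<tau> and s = s, OF arclength_deriv[OF im 1] _ c \<tau> s])
qed

lemma arclength_reparam_deriv:
  fixes g :: "real \<Rightarrow> 'a::real_normed_vector"
  assumes im: "immersed_curve p \<gamma>" and s: "s \<in> {0..curve_length \<gamma>}"
    and g: "\<And>t. t \<in> {0..1} \<Longrightarrow> (g has_vector_derivative g' t) (at t within {0..1})"
  defines "\<tau> \<equiv> inv_into {0..1} (arclength \<gamma>)"
  shows "((\<lambda>s. g (\<tau> s)) has_vector_derivative (1 / norm (curve_deriv \<gamma> (\<tau> s))) *\<^sub>R g' (\<tau> s))
    (at s within {0..curve_length \<gamma>})"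
proof -
  note \<tau> = arclength_inverse_deriv[OF im, folded \<tau>_def]
  have "(g has_vector_derivative g' (\<tau> s)) (at (\<tau> s) within \<tau> ` {0..curve_length \<gamma>})"
    by (rule has_vector_derivative_within_subset[OF g[OF \<tau>(1)[OF s]]]) (use \<tau>(1) in blast)
  from vector_diff_chain_within[OF \<tau>(2)[OF s, unfolded has_real_derivative_iff_has_vector_derivative] this]
  show ?thesis by (simp add: o_def)
qed

text \<open>Here parity enters the positive direction: for even n >= 2 the signed power is not a
  polynomial, and the system for tangent and curvature would not be polynomial either.\<close>

lemma signed_power_odd:
  fixes x :: real
  assumes "odd n"
  shows "sgn x * \<bar>x\<bar> powr real n = x ^ n"
proof -
  have n: "n > 0" using assms by (rule odd_pos)
  consider "x = 0" | "x > 0" | "x < 0" by linarith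
  then show ?thesis
  proof cases
    case 1
    then show ?thesis using n by simp
  next
    case 2
    then show ?thesis by (simp add: powr_realpow)
  next
    case 3
    then have "\<bar>x\<bar> powr real n = (- x) ^ n" by (simp add: powr_realpow)
    then show ?thesis using 3 assms by (simp add: power_minus_odd)
  qed
qed

text \<open>In arclength the unit tangent (x, y) and w = W/p satisfy x' = -w^n y, y' = w^n x, with
  w' linear in x and y. A bound on w over the compact interval is all that the derivative estimates
  require.\<close>

theorem p_elastica_analytic:
  assumes el: "p_elastica p \<gamma>" and p: "1 < p" and n: "1 / (p - 1) = real n" "odd n"
  shows "analytic_curve \<gamma>"
proof -
  let ?v = "curve_deriv \<gamma>" and ?L = "curve_length \<gamma>"
  let ?S = "{0..?L}"
  let ?q = "\<lambda>t. norm (?v t)"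
  define \<tau> where "\<tau> = inv_into {0..1} (arclength \<gamma>)"
  have im: "immersed_curve p \<gamma>" using el by (simp add: p_elastica_def)
  have diff: "\<gamma> differentiable_on {0..1}" and nz: "\<And>t. t \<in> {0..1} \<Longrightarrow> ?v t \<noteq> 0"
    using im by (auto simp: immersed_curve_def)
  note \<tau>1 = arclength_inverse_deriv(1)[OF im, folded \<tau>_def]
  note reparam = arclength_reparam_deriv[OF im, folded \<tau>_def]
  obtain W c1 c2 where
    W: "\<And>t. t \<in> {0..1} \<Longrightarrow>
      (W has_vector_derivative (c2 * ?v t $ 1 - c1 * ?v t $ 2)) (at t within {0..1})" and
    T1: "\<And>t. t \<in> {0..1} \<Longrightarrow> ((\<lambda>t. ?v t $ 1 / ?q t) has_vector_derivative
        - (sgn (W t) * (\<bar>W t\<bar> / p) powr (1 / (p - 1)) * ?v t $ 2)) (at t within {0..1})" and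
    T2: "\<And>t. t \<in> {0..1} \<Longrightarrow> ((\<lambda>t. ?v t $ 2 / ?q t) has_vector_derivative
        sgn (W t) * (\<bar>W t\<bar> / p) powr (1 / (p - 1)) * ?v t $ 1) (at t within {0..1})"
    by (rule elastica_frame[OF el p]) (rule that)
  have kap: "sgn (W t) * (\<bar>W t\<bar> / p) powr (1 / (p - 1)) = (W t / p) ^ n" for t
    using signed_power_odd[OF n(2), of "W t / p"] p n(1) by (simp add: sgn_divide)
  define x where "x s = ?v (\<tau> s) $ 1 / ?q (\<tau> s)" for s
  define y where "y s = ?v (\<tau> s) $ 2 / ?q (\<tau> s)" for s
  define w where "w s = W (\<tau> s) / p" for s
  have x': "(x has_real_derivative - (w s ^ n * y s)) (at s within ?S)" if "s \<in> ?S" for s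
    using reparam[OF that T1] unfolding x_def[abs_def] y_def w_def kap
    by (simp add: has_real_derivative_iff_has_vector_derivative)
  have y': "(y has_real_derivative w s ^ n * x s) (at s within ?S)" if "s \<in> ?S" for s
    using reparam[OF that T2] unfolding y_def[abs_def] x_def w_def kap
    by (simp add: has_real_derivative_iff_has_vector_derivative)
  have w': "(w has_real_derivative (c2 / p) * x s + (- c1 / p) * y s) (at s within ?S)" if s: "s \<in> ?S" for s
  proof -
    have "((\<lambda>s. W (\<tau> s)) has_real_derivative (1 / ?q (\<tau> s)) * (c2 * ?v (\<tau> s) $ 1 - c1 * ?v (\<tau> s) $ 2))
        (at s within ?S)"
      using reparam[OF s W] by (simp add: has_real_derivative_iff_has_vector_derivative)
    from DERIV_cdivide[OF this, of p]
    show ?thesis unfolding w_def[abs_def] x_def y_def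
      by (simp add: diff_divide_distrib right_diff_distrib mult.commute)
  qed
  have xy: "\<bar>x s\<bar> \<le> 1" "\<bar>y s\<bar> \<le> 1" for s
    using component_le_norm_cart[of "?v (\<tau> s)"]
    by (auto simp: x_def y_def abs_divide divide_le_eq_1)
  have "continuous_on ?S w" by (rule DERIV_continuous_on[OF w'])
  then have "bounded (w ` ?S)" by (intro compact_imp_bounded compact_continuous_image) auto
  then obtain M0 where "\<forall>a\<in>w ` ?S. norm a \<le> M0" unfolding bounded_iff by blast
  then have M0: "\<bar>w s\<bar> \<le> M0" if "s \<in> ?S" for s using that by simp
  define M where "M = max 1 M0"
  have M: "1 \<le> M" "\<And>s. s \<in> ?S \<Longrightarrow> \<bar>x s\<bar> \<le> M" "\<And>s. s \<in> ?S \<Longrightarrow> \<bar>y s\<bar> \<le> M"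
    "\<And>s. s \<in> ?S \<Longrightarrow> \<bar>w s\<bar> \<le> M"
    using xy M0 by (auto simp: M_def le_max_iff_disj)
  \<comment> \<open>The growth constant of \<open>poly_ode_derivative_bounds\<close>. That it is at
    least 1 is used when the bounds for the tangent are shifted by one order to the curve.\<close>
  define R where "R = (1 + \<bar>c2 / p\<bar> + \<bar>- c1 / p\<bar>) * (n + 2) * M ^ (n + 1)"
  have R: "1 \<le> R"
  proof -
    have "1 * 1 * 1 \<le> R" unfolding R_def using M(1)
      by (intro mult_mono one_le_power) (auto simp: mult_le_one)
    then show ?thesis by simp
  qed
  have px: "poly_bound x y w 1 1 x"
    using poly_bound.monom[of 1 0 0 1 1 1 x y w] by simp
  have py: "poly_bound x y w 1 1 y"
    using poly_bound.monom[of 0 1 0 1 1 1 x y w] by simp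
  obtain X where X: "X 0 = x"
    "\<And>m s. s \<in> ?S \<Longrightarrow> (X m has_real_derivative X (Suc m) s) (at s within ?S)"
    "\<And>m s. s \<in> ?S \<Longrightarrow> \<bar>X m s\<bar> \<le> M * R ^ m * fact m"
    by (rule poly_ode_derivative_bounds[where S = ?S, OF px x' y' w' M, folded R_def])
      (assumption | rule that)+
  obtain Y where Y: "Y 0 = y"
    "\<And>m s. s \<in> ?S \<Longrightarrow> (Y m has_real_derivative Y (Suc m) s) (at s within ?S)"
    "\<And>m s. s \<in> ?S \<Longrightarrow> \<bar>Y m s\<bar> \<le> M * R ^ m * fact m"
    by (rule poly_ode_derivative_bounds[where S = ?S, OF py x' y' w' M, folded R_def])
      (assumption | rule that)+
  have g: "arclength_param \<gamma> = (\<lambda>s. \<gamma> (\<tau> s))"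
    by (simp add: arclength_param_def[abs_def] \<tau>_def)
  have \<gamma>': "((\<lambda>s. \<gamma> (\<tau> s)) has_vector_derivative (1 / ?q (\<tau> s)) *\<^sub>R ?v (\<tau> s)) (at s within ?S)"
    if "s \<in> ?S" for s
    by (rule reparam[OF that]) (rule curve_deriv_works[OF diff])
  \<comment> \<open>The curve lies one integration above its tangent: its derivative of order m >= 1
    is the tangent's derivative of order m - 1. Order 0 is bounded separately by G.\<close>
  define Df where "Df i m s = (if m = 0 then \<gamma> (\<tau> s) $ i else if i = 1 then X (m - 1) s else Y (m - 1) s)"
    for i :: 2 and m s
  have \<gamma>'i: "((\<lambda>s. \<gamma> (\<tau> s) $ i) has_vector_derivative Df i 1 s) (at s within ?S)"
    if s: "s \<in> ?S" for i :: 2 and s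
  proof -
    have "i = 1 \<or> i = 2" using exhaust_2 by blast
    then have "((1 / ?q (\<tau> s)) *\<^sub>R ?v (\<tau> s)) $ i = Df i 1 s"
      by (auto simp: Df_def X(1) Y(1) x_def y_def)
    then show ?thesis using has_vector_derivative_vec_nth[OF \<gamma>'[OF s], of i] by simp
  qed
  have "continuous_on ?S (\<lambda>s. \<gamma> (\<tau> s))"
    by (rule continuous_on_vector_derivative[OF \<gamma>'])
  then have "bounded ((\<lambda>s. \<gamma> (\<tau> s)) ` ?S)" by (intro compact_imp_bounded compact_continuous_image) auto
  then obtain G where "\<forall>a\<in>(\<lambda>s. \<gamma> (\<tau> s)) ` ?S. norm a \<le> G" unfolding bounded_iff by blast
  then have G: "norm (\<gamma> (\<tau> s)) \<le> G" if "s \<in> ?S" for s using that by simp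
  show ?thesis
    unfolding analytic_curve_def g
  proof (rule real_analytic_on_vec[where Df = Df and M = "max M G" and R = R])
    show "\<gamma> (\<tau> s) $ i = Df i 0 s" for i s by (simp add: Df_def)
    show "(Df i m has_vector_derivative Df i (Suc m) s) (at s within ?S)" if s: "s \<in> ?S" for i m s
    proof (cases m)
      case 0
      then show ?thesis using \<gamma>'i[OF s, of i] by (simp add: Df_def[abs_def])
    next
      case (Suc k)
      then show ?thesis using X(2)[OF s, of k] Y(2)[OF s, of k]
        by (cases "i = 1") (simp_all add: Df_def[abs_def] has_real_derivative_iff_has_vector_derivative)
    qed
    show "\<bar>Df i m s\<bar> \<le> max M G * R ^ m * fact m" if s: "s \<in> ?S" for i m s
    proof (cases m)
      case 0
      then show ?thesis using G[OF s] component_le_norm_cart[of "\<gamma> (\<tau> s)" i]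
        by (simp add: Df_def le_max_iff_disj)
    next
      case (Suc k)
      have "M * R ^ k * fact k \<le> max M G * R ^ m * fact m"
        using Suc M(1) R by (intro mult_mono power_increasing fact_mono) auto
      then show ?thesis using X(3)[OF s, of k] Y(3)[OF s, of k] Suc by (auto simp: Df_def)
    qed
    show "0 < R" using R by simp
  qed
qed

subsection \<open>The rectangular elastica\<close>

text \<open>With $\lambda = 0$ and $\alpha = p/(p-1)$, the graph $x'(y) = |y|^\alpha / \sqrt{1-|y|^{2\alpha}}$
  is a $p$-elastica. Its unit tangent is $(|y|^\alpha, \sqrt{1-|y|^{2\alpha}})$ and its curvature is
  $-\alpha |y|^{\alpha-1} \mathrm{sgn}\, y$.\<close>

definition rect_cos :: "real \<Rightarrow> real \<Rightarrow> real" where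
  "rect_cos \<alpha> u = \<bar>u\<bar> powr \<alpha>"

definition rect_sin :: "real \<Rightarrow> real \<Rightarrow> real" where
  "rect_sin \<alpha> u = sqrt (1 - rect_cos \<alpha> u ^ 2)"

text \<open>Minus the signed curvature at height u, and at the same time the derivative of
  \<open>rect_cos\<close>.\<close>

definition rect_curv :: "real \<Rightarrow> real \<Rightarrow> real" where
  "rect_curv \<alpha> u = \<alpha> * sgn u * \<bar>u\<bar> powr (\<alpha> - 1)"

definition rect_slope :: "real \<Rightarrow> real \<Rightarrow> real" where
  "rect_slope \<alpha> u = rect_cos \<alpha> u / rect_sin \<alpha> u"

text \<open>The parameter is the height shifted by 1/2, so the point of zero curvature is the
  interior point t = 1/2. For heights in [-1/2, 1/2] one has |y|^alpha <= 1/2, which keeps the slope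
  finite up to the ends.\<close>

definition rect_curve :: "real \<Rightarrow> real \<Rightarrow> real^2" where
  "rect_curve \<alpha> t = vector [integral {0..t} (\<lambda>r. rect_slope \<alpha> (r - 1 / 2)), t - 1 / 2]"

lemma rect_cos_bounds:
  assumes "1 < \<alpha>" "\<bar>u\<bar> \<le> 1 / 2"
  shows "0 \<le> rect_cos \<alpha> u" "rect_cos \<alpha> u \<le> 1 / 2"
proof -
  have "\<bar>u\<bar> powr \<alpha> \<le> \<bar>u\<bar> powr 1"
    using assms by (intro powr_mono') auto
  then show "0 \<le> rect_cos \<alpha> u" "rect_cos \<alpha> u \<le> 1 / 2"
    using assms by (auto simp: rect_cos_def)
qed

lemma rect_sin_pos:
  assumes "1 < \<alpha>" "\<bar>u\<bar> \<le> 1 / 2"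
  shows "0 < rect_sin \<alpha> u" "rect_sin \<alpha> u ^ 2 = 1 - rect_cos \<alpha> u ^ 2"
proof -
  have "rect_cos \<alpha> u ^ 2 \<le> (1 / 2) ^ 2"
    using rect_cos_bounds[OF assms] by (intro power_mono)
  then have "0 < 1 - rect_cos \<alpha> u ^ 2" by (simp add: power2_eq_square)
  then show "0 < rect_sin \<alpha> u" "rect_sin \<alpha> u ^ 2 = 1 - rect_cos \<alpha> u ^ 2"
    by (simp_all add: rect_sin_def)
qed

lemma rect_cos_deriv:
  assumes "1 < \<alpha>"
  shows "(rect_cos \<alpha> has_real_derivative rect_curv \<alpha> u) (at u)"
  using has_real_derivative_abs_powr[OF assms] unfolding rect_cos_def[abs_def] rect_curv_def .

text \<open>Euler's identity for the homogeneous function |u|^alpha, whose derivative is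
  \<open>rect_curv\<close>. It eliminates the curvature when the equilibrium equations are
  verified.\<close>

lemma rect_curv_mult: "u * rect_curv \<alpha> u = \<alpha> * rect_cos \<alpha> u"
proof (cases "u = 0")
  case False
  then have "\<bar>u\<bar> * \<bar>u\<bar> powr (\<alpha> - 1) = \<bar>u\<bar> powr \<alpha>" by (simp add: powr_diff)
  moreover have "u * rect_curv \<alpha> u = \<alpha> * ((u * sgn u) * \<bar>u\<bar> powr (\<alpha> - 1))"
    by (simp add: rect_curv_def)
  ultimately show ?thesis by (simp add: rect_cos_def abs_sgn[symmetric])
qed (simp add: rect_curv_def rect_cos_def)

lemma rect_sin_deriv:
  assumes "1 < \<alpha>" "\<bar>u\<bar> \<le> 1 / 2"
  shows "(rect_sin \<alpha> has_real_derivative - (rect_cos \<alpha> u * rect_curv \<alpha> u / rect_sin \<alpha> u)) (at u)"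
proof -
  have pos: "0 < 1 - rect_cos \<alpha> u ^ 2"
    using rect_sin_pos[OF assms] by (metis zero_less_power)
  have "((\<lambda>u. 1 - rect_cos \<alpha> u ^ 2) has_real_derivative - (2 * rect_cos \<alpha> u * rect_curv \<alpha> u)) (at u)"
    by (rule derivative_eq_intros rect_cos_deriv[OF assms(1)] refl)+ simp
  from DERIV_chain2[OF DERIV_real_sqrt[OF pos] this]
  show ?thesis unfolding rect_sin_def[abs_def] by (simp add: field_simps)
qed

lemma rect_slope_deriv:
  assumes "1 < \<alpha>" "\<bar>u\<bar> \<le> 1 / 2"
  shows "(rect_slope \<alpha> has_real_derivative rect_curv \<alpha> u / rect_sin \<alpha> u ^ 3) (at u)"
proof -
  note s = rect_sin_pos[OF assms]
  let ?c = "rect_cos \<alpha> u" and ?s = "rect_sin \<alpha> u" and ?k = "rect_curv \<alpha> u"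
  have "(rect_slope \<alpha> has_real_derivative (?k * ?s - ?c * - (?c * ?k / ?s)) / (?s * ?s)) (at u)"
    unfolding rect_slope_def[abs_def] using s(1)
    by (intro DERIV_divide rect_cos_deriv rect_sin_deriv assms) simp
  moreover have "(?k * ?s - ?c * - (?c * ?k / ?s)) / (?s * ?s) = ?k * (?s ^ 2 + ?c ^ 2) / ?s ^ 3"
    using s(1) by (simp add: field_simps power2_eq_square power3_eq_cube)
  ultimately show ?thesis using s(2) by simp
qed

section \<open>The rectangular elastica as an immersed curve\<close>

lemma unit_shift_abs_le: "t \<in> {0..1} \<Longrightarrow> \<bar>t - 1 / 2\<bar> \<le> (1 / 2 :: real)"
  unfolding abs_le_iff atLeastAtMost_iff by linarith

lemma shift_deriv:
  "(f has_real_derivative D) (at (t - 1 / 2)) \<Longrightarrow>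
    ((\<lambda>t. f (t - 1 / 2)) has_vector_derivative D) (at t within S)"
  unfolding has_real_derivative_iff_has_vector_derivative[symmetric]
  using DERIV_chain2[of f D "\<lambda>t. t - 1 / 2" t 1 S] by (simp add: DERIV_diff[OF DERIV_ident DERIV_const, simplified])

lemma rect_continuous:
  assumes "1 < \<alpha>"
  shows "continuous_on {0..1} (\<lambda>t. rect_cos \<alpha> (t - 1 / 2))"
    "continuous_on {0..1} (\<lambda>t. rect_sin \<alpha> (t - 1 / 2))"
    "continuous_on {0..1} (\<lambda>t. rect_slope \<alpha> (t - 1 / 2))"
    "continuous_on {0..1} (\<lambda>t. rect_curv \<alpha> (t - 1 / 2))"
proof -
  show "continuous_on {0..1} (\<lambda>t. rect_cos \<alpha> (t - 1 / 2))"
    by (rule continuous_on_vector_derivative[OF shift_deriv[OF rect_cos_deriv[OF assms]]])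
  show "continuous_on {0..1} (\<lambda>t. rect_sin \<alpha> (t - 1 / 2))"
    by (rule continuous_on_vector_derivative[OF shift_deriv[OF rect_sin_deriv[OF assms unit_shift_abs_le]]])
  show "continuous_on {0..1} (\<lambda>t. rect_slope \<alpha> (t - 1 / 2))"
    by (rule continuous_on_vector_derivative[OF shift_deriv[OF rect_slope_deriv[OF assms unit_shift_abs_le]]])
  have "continuous_on {0..1} (\<lambda>t. \<alpha> * (sgn (t - 1 / 2) * \<bar>t - 1 / 2\<bar> powr (\<alpha> - 1)))"
    using assms by (intro continuous_on_mult continuous_on_const continuous_on_signed_powr continuous_intros) auto
  then show "continuous_on {0..1} (\<lambda>t. rect_curv \<alpha> (t - 1 / 2))"
    by (simp add: rect_curv_def mult.assoc)
qed

lemma has_vector_derivative_vec2: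
  fixes f :: "real \<Rightarrow> real^2"
  assumes "((\<lambda>t. f t $ 1) has_vector_derivative d $ 1) F" "((\<lambda>t. f t $ 2) has_vector_derivative d $ 2) F"
  shows "(f has_vector_derivative d) F"
proof -
  have e: "x = x $ 1 *\<^sub>R axis 1 1 + x $ 2 *\<^sub>R axis 2 1" for x :: "real^2"
    by (simp add: vec_eq_iff forall_2 axis_def)
  have "((\<lambda>t. f t $ 1 *\<^sub>R axis 1 1 + f t $ 2 *\<^sub>R axis 2 1 :: real^2) has_vector_derivative
      d $ 1 *\<^sub>R axis 1 1 + d $ 2 *\<^sub>R axis 2 1) F"
    by (intro has_vector_derivative_add
        bounded_linear.has_vector_derivative[OF bounded_linear_scaleR_left] assms)
  then show ?thesis by (simp add: e[symmetric])
qed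

lemma rect_curve_deriv:
  assumes "1 < \<alpha>" "t \<in> {0..1}"
  shows "(rect_curve \<alpha> has_vector_derivative vector [rect_slope \<alpha> (t - 1 / 2), 1]) (at t within {0..1})"
proof (rule has_vector_derivative_vec2)
  show "((\<lambda>t. rect_curve \<alpha> t $ 1) has_vector_derivative
      (vector [rect_slope \<alpha> (t - 1 / 2), 1] :: real^2) $ 1) (at t within {0..1})"
    using integral_has_vector_derivative[OF rect_continuous(3)[OF assms(1)] assms(2)]
    by (simp add: rect_curve_def)
  have "((\<lambda>t. t - 1 / 2) has_vector_derivative (1::real)) (at t within {0..1})"
    by (auto intro!: derivative_eq_intros)
  then show "((\<lambda>t. rect_curve \<alpha> t $ 2) has_vector_derivative
      (vector [rect_slope \<alpha> (t - 1 / 2), 1] :: real^2) $ 2) (at t within {0..1})"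
    by (simp add: rect_curve_def)
qed

lemma curve_deriv_rect_curve:
  assumes "1 < \<alpha>" "t \<in> {0..1}"
  shows "curve_deriv (rect_curve \<alpha>) t = vector [rect_slope \<alpha> (t - 1 / 2), 1]"
  by (rule curve_deriv_eqI[OF rect_curve_deriv[OF assms] assms(2)])

lemma continuous_on_vec2:
  fixes f :: "real \<Rightarrow> real^2"
  assumes "continuous_on S (\<lambda>t. f t $ 1)" "continuous_on S (\<lambda>t. f t $ 2)"
  shows "continuous_on S f"
proof -
  have "continuous_on S (\<lambda>t. \<chi> i. f t $ i)"
    using assms by (intro continuous_on_vec_lambda) (metis exhaust_2)
  then show ?thesis by simp
qed

lemma continuous_imp_Lp:
  fixes f :: "real \<Rightarrow> 'a::euclidean_space"
  assumes f: "continuous_on {0..1} f" and p: "0 < p"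
  shows "f \<in> Lp p"
proof -
  have c: "continuous_on {0..1} (\<lambda>t. norm (f t) powr p)"
    using p by (intro continuous_on_powr' continuous_on_norm f continuous_on_const) auto
  have "(\<lambda>t. norm (f t) powr p) absolutely_integrable_on {0<..<1}"
    using absolutely_integrable_continuous_real[OF c] by (simp add: absolutely_integrable_on_Icc_iff_Ioo)
  then have "integrable (lebesgue_on {0<..<1}) (\<lambda>t. norm (f t) powr p)"
    by (simp add: set_integrable_def integrable_restrict_space)
  moreover have "f \<in> borel_measurable (lebesgue_on {0<..<1})"
    by (intro continuous_imp_measurable_on_sets_lebesgue continuous_on_subset[OF f]) auto
  ultimately show ?thesis by (simp add: Lp_def)
qed

definition rect_second :: "real \<Rightarrow> real \<Rightarrow> real^2" where
  "rect_second \<alpha> t = vector [rect_curv \<alpha> (t - 1 / 2) / rect_sin \<alpha> (t - 1 / 2) ^ 3, 0]"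

lemma continuous_rect_second:
  assumes "1 < \<alpha>"
  shows "continuous_on {0..1} (rect_second \<alpha>)"
proof (rule continuous_on_vec2)
  have "rect_sin \<alpha> (t - 1 / 2) \<noteq> 0" if "t \<in> {0..1}" for t
    using rect_sin_pos(1)[OF assms unit_shift_abs_le[OF that]] by simp
  then show "continuous_on {0..1} (\<lambda>t. rect_second \<alpha> t $ 1)"
    unfolding rect_second_def by (auto intro!: continuous_intros rect_continuous[OF assms])
qed (simp add: rect_second_def)

lemma abs_cont_rect_curve_deriv:
  assumes "1 < \<alpha>"
  shows "abs_cont (\<lambda>t. curve_deriv (rect_curve \<alpha>) t $ i) (\<lambda>t. rect_second \<alpha> t $ i)"
proof (rule abs_cont_cong)
  show "abs_cont (\<lambda>t. (vector [rect_slope \<alpha> (t - 1 / 2), 1] :: real^2) $ i) (\<lambda>t. rect_second \<alpha> t $ i)"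
  proof (rule abs_cont_C1)
    show "continuous_on {0..1} (\<lambda>t. rect_second \<alpha> t $ i)"
      by (intro continuous_intros continuous_rect_second assms)
    fix t :: real assume t: "t \<in> {0..1}"
    have "i = 1 \<or> i = 2" using exhaust_2 by blast
    then show "((\<lambda>t. (vector [rect_slope \<alpha> (t - 1 / 2), 1] :: real^2) $ i) has_vector_derivative
        rect_second \<alpha> t $ i) (at t within {0..1})"
      using shift_deriv[OF rect_slope_deriv[OF assms unit_shift_abs_le[OF t]]]
      by (auto simp: rect_second_def)
  qed
qed (simp add: curve_deriv_rect_curve[OF assms])

lemma immersed_rect_curve:
  assumes \<alpha>: "1 < \<alpha>" and p: "1 < p"
  shows "immersed_curve p (rect_curve \<alpha>)"
proof -
  let ?\<gamma> = "rect_curve \<alpha>"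
  have diff: "?\<gamma> differentiable_on {0..1}"
    unfolding differentiable_on_def using rect_curve_deriv[OF \<alpha>] differentiableI_vector by blast
  have "continuous_on {0..1} (\<lambda>t. vector [rect_slope \<alpha> (t - 1 / 2), 1] :: real^2)"
    by (rule continuous_on_vec2) (simp_all add: rect_continuous[OF \<alpha>])
  then have cv: "continuous_on {0..1} (curve_deriv ?\<gamma>)"
    by (rule continuous_on_eq) (simp add: curve_deriv_rect_curve[OF \<alpha>])
  have "abs_cont (\<lambda>t. ?\<gamma> t $ i) (\<lambda>t. curve_deriv ?\<gamma> t $ i)" for i
    by (rule abs_cont_C1[OF has_vector_derivative_vec_nth[OF curve_deriv_works[OF diff]]])
      (auto intro!: continuous_intros cv)
  then have w1: "has_weak_derivative ?\<gamma> (curve_deriv ?\<gamma>)" by (rule abs_cont_imp_has_weak_derivative)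
  have w2: "has_weak_derivative (curve_deriv ?\<gamma>) (rect_second \<alpha>)"
    by (rule abs_cont_imp_has_weak_derivative[OF abs_cont_rect_curve_deriv[OF \<alpha>]])
  have "?\<gamma> \<in> Lp p" "curve_deriv ?\<gamma> \<in> Lp p" "rect_second \<alpha> \<in> Lp p"
    using p differentiable_imp_continuous_on[OF diff] cv continuous_rect_second[OF \<alpha>]
    by (auto intro!: continuous_imp_Lp)
  then have "?\<gamma> \<in> Sobolev 2 p" unfolding numeral_2_eq_2 using w1 w2 by auto
  moreover have "curve_deriv ?\<gamma> t \<noteq> 0" if "t \<in> {0..1}" for t
  proof
    assume "curve_deriv ?\<gamma> t = 0"
    then have "curve_deriv ?\<gamma> t $ 2 = 0" by simp
    then show False by (simp add: curve_deriv_rect_curve[OF \<alpha> that])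
  qed
  ultimately show ?thesis using diff cv by (simp add: immersed_curve_def)
qed

section \<open>Equilibrium of the rectangular elastica\<close>

lemma norm_rect_curve_deriv:
  assumes "1 < \<alpha>" "t \<in> {0..1}"
  shows "norm (curve_deriv (rect_curve \<alpha>) t) = 1 / rect_sin \<alpha> (t - 1 / 2)"
proof -
  note s = rect_sin_pos[OF assms(1) unit_shift_abs_le[OF assms(2)]]
  let ?c = "rect_cos \<alpha> (t - 1 / 2)" and ?s = "rect_sin \<alpha> (t - 1 / 2)"
  have "(?c / ?s) ^ 2 + 1 = (1 / ?s) ^ 2" using s by (simp add: field_simps power_divide)
  then have "norm (curve_deriv (rect_curve \<alpha>) t) = sqrt ((1 / ?s) ^ 2)"
    by (simp add: curve_deriv_rect_curve[OF assms] norm_vec_def L2_set_def sum_2 rect_slope_def)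
  then show ?thesis using s(1) by simp
qed

text \<open>alpha is the exponent conjugate to p, 1/p + 1/alpha = 1. The identity (alpha-1)(p-1) = 1
  makes |k|^(p-1) proportional to the height, and (alpha-1)p = alpha makes |k|^p proportional to
  |y|^alpha.\<close>

lemma rect_exponents:
  fixes p \<alpha> :: real
  assumes "1 < p" "\<alpha> = p / (p - 1)"
  shows "1 < \<alpha>" "(\<alpha> - 1) * (p - 1) = 1" "(\<alpha> - 1) * p = \<alpha>" "p * \<alpha> = p + \<alpha>"
proof -
  have "p - 1 \<noteq> 0" using assms(1) by simp
  then show "1 < \<alpha>" "(\<alpha> - 1) * (p - 1) = 1" "(\<alpha> - 1) * p = \<alpha>" "p * \<alpha> = p + \<alpha>"
    unfolding assms(2) using assms(1) by (simp_all add: divide_simps) (simp_all add: algebra_simps)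
qed

lemma sgn_rect_curv:
  assumes "1 < \<alpha>"
  shows "sgn (rect_curv \<alpha> u) = sgn u"
  using assms by (cases "u = 0") (simp_all add: rect_curv_def sgn_mult)

lemma det2_rect:
  assumes "1 < \<alpha>" "t \<in> {0..1}"
  shows "det2 (curve_deriv (rect_curve \<alpha>) t) (rect_second \<alpha> t) =
    - (rect_curv \<alpha> (t - 1 / 2) / rect_sin \<alpha> (t - 1 / 2) ^ 3)"
  by (simp add: curve_deriv_rect_curve[OF assms] rect_second_def det2_def)

lemma abs_det2_rect_powr:
  assumes "1 < \<alpha>" "t \<in> {0..1}"
  shows "\<bar>det2 (curve_deriv (rect_curve \<alpha>) t) (rect_second \<alpha> t)\<bar> powr r *
      norm (curve_deriv (rect_curve \<alpha>) t) powr s =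
    \<alpha> powr r * \<bar>t - 1 / 2\<bar> powr ((\<alpha> - 1) * r) * rect_sin \<alpha> (t - 1 / 2) powr (- s - 3 * r)"
proof -
  let ?s = "rect_sin \<alpha> (t - 1 / 2)" and ?u = "t - 1 / 2"
  have s: "0 < ?s" by (rule rect_sin_pos(1)[OF assms(1) unit_shift_abs_le[OF assms(2)]])
  have s3: "?s ^ 3 = ?s powr 3" using powr_realpow[OF s, of 3] by simp
  have "\<bar>rect_curv \<alpha> ?u\<bar> = \<alpha> * \<bar>?u\<bar> powr (\<alpha> - 1)"
    using assms(1) by (cases "?u = 0") (simp_all add: rect_curv_def abs_mult)
  then have "\<bar>det2 (curve_deriv (rect_curve \<alpha>) t) (rect_second \<alpha> t)\<bar> powr r =
      (\<alpha> * \<bar>?u\<bar> powr (\<alpha> - 1) / ?s powr 3) powr r"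
    using s unfolding det2_rect[OF assms] s3 by (simp add: abs_divide)
  also have "\<dots> = \<alpha> powr r * \<bar>?u\<bar> powr ((\<alpha> - 1) * r) / ?s powr (3 * r)"
    using assms(1) by (simp add: powr_divide powr_mult powr_powr)
  finally have 1: "\<bar>det2 (curve_deriv (rect_curve \<alpha>) t) (rect_second \<alpha> t)\<bar> powr r = \<dots>" .
  have 2: "norm (curve_deriv (rect_curve \<alpha>) t) powr s = ?s powr (- s)"
    using s by (simp add: norm_rect_curve_deriv[OF assms] powr_divide powr_minus_divide)
  show ?thesis unfolding 1 2 powr_diff by simp
qed

text \<open>Multiplied by |gamma'|^2 = 1/\<open>rect_sin\<close>^2, this says that p |k|^(p-2) k is
  a multiple of the height, the property for which the curve was chosen.\<close>

lemma bend_P_rect: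
  assumes p: "1 < p" and \<alpha>: "\<alpha> = p / (p - 1)" and t: "t \<in> {0..1}"
  shows "bend_P p (curve_deriv (rect_curve \<alpha>) t) (rect_second \<alpha> t) =
    - (p * \<alpha> powr (p - 1) * ((t - 1 / 2) * rect_sin \<alpha> (t - 1 / 2) ^ 2))"
proof -
  let ?s = "rect_sin \<alpha> (t - 1 / 2)" and ?u = "t - 1 / 2"
  note e = rect_exponents[OF p \<alpha>]
  have s: "0 < ?s" by (rule rect_sin_pos(1)[OF e(1) unit_shift_abs_le[OF t]])
  have s2: "?s powr 2 = ?s ^ 2" using powr_realpow[OF s, of 2] by simp
  have "sgn (det2 (curve_deriv (rect_curve \<alpha>) t) (rect_second \<alpha> t)) = - sgn ?u"
    unfolding det2_rect[OF e(1) t] sgn_minus sgn_divide sgn_rect_curv[OF e(1)] using s by simp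
  moreover have "\<bar>det2 (curve_deriv (rect_curve \<alpha>) t) (rect_second \<alpha> t)\<bar> powr (p - 1) *
      norm (curve_deriv (rect_curve \<alpha>) t) powr (1 - 3 * p) = \<alpha> powr (p - 1) * \<bar>?u\<bar> * ?s ^ 2"
  proof -
    have x: "- (1 - 3 * p) - 3 * (p - 1) = 2" by simp
    show ?thesis unfolding abs_det2_rect_powr[OF e(1) t] e(2) x s2 by simp
  qed
  ultimately have "bend_P p (curve_deriv (rect_curve \<alpha>) t) (rect_second \<alpha> t) =
      - (p * \<alpha> powr (p - 1) * ((sgn ?u * \<bar>?u\<bar>) * ?s ^ 2))"
    unfolding bend_P_def by (simp add: mult.assoc)
  then show ?thesis by (simp only: sgn_mult_abs)
qed

lemma bend_Q_rect:
  assumes p: "1 < p" and \<alpha>: "\<alpha> = p / (p - 1)" and t: "t \<in> {0..1}"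
  shows "bend_Q p (curve_deriv (rect_curve \<alpha>) t) (rect_second \<alpha> t) =
    (1 - 3 * p) * (\<alpha> * \<alpha> powr (p - 1)) * (rect_cos \<alpha> (t - 1 / 2) * rect_sin \<alpha> (t - 1 / 2))"
proof -
  let ?s = "rect_sin \<alpha> (t - 1 / 2)" and ?u = "t - 1 / 2"
  note e = rect_exponents[OF p \<alpha>]
  have s: "0 < ?s" by (rule rect_sin_pos(1)[OF e(1) unit_shift_abs_le[OF t]])
  have a: "\<alpha> powr p = \<alpha> * \<alpha> powr (p - 1)" using e(1) by (simp add: powr_diff)
  have x: "- (- 1 - 3 * p) - 3 * p = 1" by simp
  have "bend_Q p (curve_deriv (rect_curve \<alpha>) t) (rect_second \<alpha> t) =
      (1 - 3 * p) * (\<alpha> powr p * \<bar>?u\<bar> powr \<alpha> * ?s powr 1)"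
    unfolding bend_Q_def mult.assoc[of "1 - 3 * p"] abs_det2_rect_powr[OF e(1) t] e(3) x ..
  then show ?thesis using s by (simp add: a rect_cos_def)
qed

text \<open>Up to the factor alpha^(p-1), these are the two components of the Euler-Lagrange system:
  the differentiated functions are the coefficients of eta'', and their derivatives are those of
  eta' plus a constant. The constants p and 0 show that the conserved vector is horizontal. The
  relation p alpha = p + alpha makes both sides match.\<close>

lemma rect_first_integral_deriv:
  assumes p: "1 < p" and \<alpha>: "\<alpha> = p / (p - 1)" and u: "\<bar>u\<bar> \<le> 1 / 2"
  shows "((\<lambda>u. p * (u * rect_sin \<alpha> u ^ 2)) has_real_derivative
      (1 - 3 * p) * \<alpha> * rect_cos \<alpha> u ^ 2 + p) (at u)" (is ?A)
    "((\<lambda>u. - (p * (u * (rect_cos \<alpha> u * rect_sin \<alpha> u)))) has_real_derivative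
      p * \<alpha> * (rect_cos \<alpha> u / rect_sin \<alpha> u) + (1 - 3 * p) * \<alpha> * (rect_cos \<alpha> u * rect_sin \<alpha> u)) (at u)" (is ?B)
proof -
  note e = rect_exponents[OF p \<alpha>]
  note s = rect_sin_pos[OF e(1) u]
  let ?c = "rect_cos \<alpha> u" and ?s = "rect_sin \<alpha> u" and ?k = "rect_curv \<alpha> u"
  note d = rect_cos_deriv[OF e(1), of u] rect_sin_deriv[OF e(1) u]
  have "((\<lambda>u. p * (u * rect_sin \<alpha> u ^ 2)) has_real_derivative
      p * (?s ^ 2 + u * (2 * ?s * - (?c * ?k / ?s)))) (at u)"
    by (rule derivative_eq_intros d refl)+ (simp add: power2_eq_square)
  moreover have "p * (?s ^ 2 + u * (2 * ?s * - (?c * ?k / ?s))) = (1 - 3 * p) * \<alpha> * ?c ^ 2 + p"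
  proof -
    have "p * (?s ^ 2 + u * (2 * ?s * - (?c * ?k / ?s))) = p * (?s ^ 2 - 2 * ?c * (u * ?k))"
      using s(1) by (simp add: field_simps)
    also have "\<dots> = p - p * ?c ^ 2 - 2 * (p * \<alpha>) * ?c ^ 2"
      unfolding rect_curv_mult s(2) by (simp add: algebra_simps power2_eq_square)
    also have "\<dots> = (\<alpha> - 3 * (p * \<alpha>)) * ?c ^ 2 + p" unfolding e(4) by (simp add: algebra_simps)
    finally show ?thesis by (simp add: algebra_simps)
  qed
  ultimately show ?A by simp
  have "((\<lambda>u. - (p * (u * (rect_cos \<alpha> u * rect_sin \<alpha> u)))) has_real_derivative
      - (p * (?c * ?s + u * (?k * ?s + ?c * - (?c * ?k / ?s))))) (at u)"
    by (rule derivative_eq_intros d refl)+ simp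
  moreover have "- (p * (?c * ?s + u * (?k * ?s + ?c * - (?c * ?k / ?s)))) =
      p * \<alpha> * (?c / ?s) + (1 - 3 * p) * \<alpha> * (?c * ?s)"
  proof -
    have "- (p * (?c * ?s + u * (?k * ?s + ?c * - (?c * ?k / ?s)))) =
        - (p * ?c * ?s) - p * (u * ?k) * ?s + p * (u * ?k) * (?c ^ 2 / ?s)"
      by (simp add: algebra_simps power2_eq_square)
    also have "\<dots> = (?c / ?s) * (- p * ?s ^ 2 - p * \<alpha> * ?s ^ 2 + p * \<alpha> * ?c ^ 2)"
      unfolding rect_curv_mult using s(1) by (simp add: field_simps power2_eq_square)
    also have "?c ^ 2 = 1 - ?s ^ 2" using s(2) by simp
    also have "(?c / ?s) * (- p * ?s ^ 2 - p * \<alpha> * ?s ^ 2 + p * \<alpha> * (1 - ?s ^ 2)) =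
        (?c / ?s) * (p * \<alpha> - (p + 2 * (p * \<alpha>)) * ?s ^ 2)" by (simp add: algebra_simps)
    also have "p + 2 * (p * \<alpha>) = - ((1 - 3 * p) * \<alpha>)" using e(4) by (simp add: algebra_simps)
    also have "(?c / ?s) * (p * \<alpha> - (- ((1 - 3 * p) * \<alpha>)) * ?s ^ 2) =
        p * \<alpha> * (?c / ?s) + (1 - 3 * p) * \<alpha> * (?c * ?s)"
      using s(1) by (simp add: field_simps power2_eq_square)
    finally show ?thesis .
  qed
  ultimately show ?B by simp
qed

text \<open>A converse of \<open>weak_second_order_equation\<close> for regular data. The constant d
  does no harm because it integrates to 0 against the derivative of a test function.\<close>

lemma integral_test_exact:
  assumes F: "\<And>t. t \<in> {0..1} \<Longrightarrow> (F has_vector_derivative A t + d) (at t within {0..1})"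
    and A: "continuous_on {0..1} A" and \<phi>: "test_function \<phi>"
  shows "integral {0..1} (\<lambda>t. vector_derivative \<phi> (at t) * A t +
    vector_derivative (\<lambda>s. vector_derivative \<phi> (at s)) (at t) * F t) = (0 :: real)"
proof -
  let ?d = "\<lambda>t. vector_derivative \<phi> (at t)" and ?dd = "\<lambda>t. vector_derivative (\<lambda>s. vector_derivative \<phi> (at s)) (at t)"
  have t: "test_function ?d" "test_function ?dd" by (intro test_function_deriv \<phi>)+
  have c: "continuous_on {0..1} ?d" "continuous_on {0..1} ?dd"
    by (intro smooth_continuous_on test_function_smooth t)+
  have ac: "abs_cont F (\<lambda>t. A t + d)" by (rule abs_cont_C1[OF F]) (auto intro!: continuous_intros A)
  have i: "(\<lambda>t. ?d t * A t) integrable_on {0..1}" "(\<lambda>t. ?dd t * F t) integrable_on {0..1}"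
    "(\<lambda>t. ?d t * d) integrable_on {0..1}"
    by (intro integrable_continuous_real continuous_on_mult c A abs_cont_continuous[OF ac] continuous_on_const)+
  have "abs_cont (\<lambda>t. d) (\<lambda>t. 0)" by (rule abs_cont_C1) auto
  from integral_by_parts_test[OF this \<phi>] have 0: "integral {0..1} (\<lambda>t. ?d t * d) = 0" by simp
  have "integral {0..1} (\<lambda>t. ?dd t * F t) = - integral {0..1} (\<lambda>t. ?d t * (A t + d))"
    by (rule integral_by_parts_test[OF ac t(1)])
  also have "integral {0..1} (\<lambda>t. ?d t * (A t + d)) = integral {0..1} (\<lambda>t. ?d t * A t)"
    using Henstock_Kurzweil_Integration.integral_add[OF i(1,3)] 0 by (simp add: distrib_left)
  finally show ?thesis using Henstock_Kurzweil_Integration.integral_add[OF i(1,2)] by simp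
qed

lemma test_function_vec_nth:
  fixes \<eta> :: "real \<Rightarrow> real^'n"
  assumes \<eta>: "test_function \<eta>"
  shows "test_function (\<lambda>t. \<eta> t $ i)"
    "vector_derivative (\<lambda>t. \<eta> t $ i) (at t) = vector_derivative \<eta> (at t) $ i"
proof -
  obtain a b where ab: "0 < a" "a < b" "b < 1" "\<And>t. \<eta> t \<noteq> 0 \<Longrightarrow> a < t \<and> t < b"
    using test_function_supportE[OF \<eta>] by metis
  show "test_function (\<lambda>t. \<eta> t $ i)"
  proof (rule test_functionI[OF smooth_linear_image[OF test_function_smooth[OF \<eta>] bounded_linear_vec_nth] ab(1,3)])
    show "a \<le> t \<and> t \<le> b" if "\<eta> t $ i \<noteq> 0" for t
      using ab(4)[of t] that by force
  qed
  show "vector_derivative (\<lambda>t. \<eta> t $ i) (at t) = vector_derivative \<eta> (at t) $ i"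
    by (intro vector_derivative_at has_vector_derivative_vec_nth smooth_imp_has_vector_derivative
        test_function_smooth \<eta>)
qed

text \<open>The first variation splits by components into integrands eta_i' A_i + eta_i'' B_i with
  B_i' = A_i + const, so each of the two integrals vanishes by
  \<open>integral_test_exact\<close>.\<close>

theorem p_elastica_rect_curve:
  assumes p: "1 < p" and \<alpha>: "\<alpha> = p / (p - 1)"
  shows "p_elastica p (rect_curve \<alpha>)"
  unfolding p_elastica_def
proof (intro conjI exI[of _ 0] allI impI)
  let ?\<gamma> = "rect_curve \<alpha>"
  let ?v = "curve_deriv ?\<gamma>" and ?a = "rect_second \<alpha>"
  note e = rect_exponents[OF p \<alpha>]
  show im: "immersed_curve p ?\<gamma>" by (rule immersed_rect_curve[OF e(1) p])
  fix \<eta> :: "real \<Rightarrow> real^2" assume \<eta>: "test_function \<eta>"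
  define \<eta>' where "\<eta>' t = vector_derivative \<eta> (at t)" for t
  define \<eta>'' where "\<eta>'' t = vector_derivative \<eta>' (at t)" for t
  have \<eta>'t: "test_function \<eta>'"
    unfolding \<eta>'_def[abs_def] by (rule test_function_deriv[OF \<eta>])
  define \<beta> where "\<beta> = \<alpha> powr (p - 1)"
  let ?c = "\<lambda>t. rect_cos \<alpha> (t - 1 / 2)" and ?s = "\<lambda>t. rect_sin \<alpha> (t - 1 / 2)"
  let ?A1 = "\<lambda>t. \<beta> * ((1 - 3 * p) * \<alpha> * ?c t ^ 2)" and ?B1 = "\<lambda>t. \<beta> * (p * ((t - 1 / 2) * ?s t ^ 2))"
  let ?A2 = "\<lambda>t. \<beta> * (p * \<alpha> * (?c t / ?s t) + (1 - 3 * p) * \<alpha> * (?c t * ?s t))"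
  let ?B2 = "\<lambda>t. \<beta> * - (p * ((t - 1 / 2) * (?c t * ?s t)))"
  have snz: "?s t \<noteq> 0" if "t \<in> {0..1}" for t
    using rect_sin_pos(1)[OF e(1) unit_shift_abs_le[OF that]] by simp
  note cont = rect_continuous[OF e(1)]
  have cA: "continuous_on {0..1} ?A1" "continuous_on {0..1} ?A2"
    "continuous_on {0..1} ?B1" "continuous_on {0..1} ?B2"
    by (intro continuous_intros cont ballI snz; assumption)+
  have B1: "(?B1 has_vector_derivative ?A1 t + \<beta> * p) (at t within {0..1})" if "t \<in> {0..1}" for t
    using shift_deriv[OF DERIV_cmult[OF rect_first_integral_deriv(1)[OF p \<alpha> unit_shift_abs_le[OF that]], of \<beta>]]
    by (simp add: distrib_left)
  have B2: "(?B2 has_vector_derivative ?A2 t + 0) (at t within {0..1})" if "t \<in> {0..1}" for t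
    using shift_deriv[OF DERIV_cmult[OF rect_first_integral_deriv(2)[OF p \<alpha> unit_shift_abs_le[OF that]], of \<beta>]]
    by simp
  \<comment> \<open>The products of height and curvature that arise from the determinant term are
    turned into multiples of \<open>rect_cos\<close> by \<open>rect_curv_mult\<close>; only then do
    the coefficients take the form A_i, B_i.\<close>
  have eq: "bend_deriv p (?v t) (?a t) n m =
      (n $ 1 * ?A1 t + m $ 1 * ?B1 t) + (n $ 2 * ?A2 t + m $ 2 * ?B2 t)"
    if t: "t \<in> {0..1}" for t and n m :: "real^2"
  proof -
    let ?k = "rect_curv \<alpha> (t - 1 / 2)"
    have d: "det2 n (?a t) = - (n $ 2 * (?k / ?s t ^ 3))" "det2 (?v t) m = (?c t / ?s t) * m $ 2 - m $ 1"
      "?v t \<bullet> n = (?c t / ?s t) * n $ 1 + n $ 2"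
      by (simp_all add: det2_def rect_second_def curve_deriv_rect_curve[OF e(1) t] rect_slope_def
          inner_vec_def sum_2)
    have "bend_deriv p (?v t) (?a t) n m =
        - (p * \<beta> * ((t - 1 / 2) * ?s t ^ 2)) * (- (n $ 2 * (?k / ?s t ^ 3)) + ((?c t / ?s t) * m $ 2 - m $ 1))
        + (1 - 3 * p) * (\<alpha> * \<beta>) * (?c t * ?s t) * ((?c t / ?s t) * n $ 1 + n $ 2)"
      unfolding bend_deriv_def d bend_P_rect[OF p \<alpha> t] bend_Q_rect[OF p \<alpha> t] \<beta>_def ..
    also have "\<dots> = p * \<beta> * ((t - 1 / 2) * ?k) * n $ 2 / ?s t - p * \<beta> * (t - 1 / 2) * (?c t * ?s t) * m $ 2
        + p * \<beta> * ((t - 1 / 2) * ?s t ^ 2) * m $ 1 + (1 - 3 * p) * (\<alpha> * \<beta>) * ?c t ^ 2 * n $ 1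
        + (1 - 3 * p) * (\<alpha> * \<beta>) * (?c t * ?s t) * n $ 2"
      using snz[OF t] by (simp add: field_simps power2_eq_square power3_eq_cube)
    also have "\<dots> = (n $ 1 * ?A1 t + m $ 1 * ?B1 t) + (n $ 2 * ?A2 t + m $ 2 * ?B2 t)"
      unfolding rect_curv_mult by (simp add: algebra_simps)
    finally show ?thesis .
  qed
  have comp: "\<eta>' t $ i = vector_derivative (\<lambda>t. \<eta> t $ i) (at t)"
    "\<eta>'' t $ i = vector_derivative (\<lambda>s. vector_derivative (\<lambda>t. \<eta> t $ i) (at s)) (at t)" for t i
    using test_function_vec_nth(2)[OF \<eta>, of i] test_function_vec_nth(2)[OF \<eta>'t, of i]
    by (simp_all add: \<eta>'_def[symmetric] \<eta>''_def)
  have s': "smooth \<eta>'" "smooth \<eta>''"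
    unfolding \<eta>''_def[abs_def] by (intro smooth_deriv test_function_smooth \<eta>'t)+
  have c': "continuous_on {0..1} (\<lambda>t. \<eta>' t $ i)" "continuous_on {0..1} (\<lambda>t. \<eta>'' t $ i)" for i
    by (intro continuous_intros smooth_continuous_on s')+
  have "integral {0..1} (\<lambda>t. bend_deriv p (?v t) (?a t) (\<eta>' t) (\<eta>'' t)) =
      integral {0..1} (\<lambda>t. (\<eta>' t $ 1 * ?A1 t + \<eta>'' t $ 1 * ?B1 t) + (\<eta>' t $ 2 * ?A2 t + \<eta>'' t $ 2 * ?B2 t))"
    by (intro Henstock_Kurzweil_Integration.integral_cong eq)
  also have "\<dots> = integral {0..1} (\<lambda>t. \<eta>' t $ 1 * ?A1 t + \<eta>'' t $ 1 * ?B1 t) +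
      integral {0..1} (\<lambda>t. \<eta>' t $ 2 * ?A2 t + \<eta>'' t $ 2 * ?B2 t)"
    by (intro Henstock_Kurzweil_Integration.integral_add integrable_continuous_real
        continuous_on_add continuous_on_mult c' cA)
  also have "\<dots> = 0"
    using integral_test_exact[OF B1 cA(1) test_function_vec_nth(1)[OF \<eta>, of 1]]
      integral_test_exact[OF B2 cA(2) test_function_vec_nth(1)[OF \<eta>, of 2]]
    by (simp only: comp)
  finally have 0: "integral {0..1} (\<lambda>t. bend_deriv p (?v t) (?a t) (\<eta>' t) (\<eta>'' t)) = 0" .
  have "(\<eta> has_vector_derivative \<eta>' t) (at t)" "(\<eta>' has_vector_derivative \<eta>'' t) (at t)" for t
    unfolding \<eta>'_def \<eta>''_def
    by (intro smooth_imp_has_vector_derivative test_function_smooth \<eta>,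
        fold \<eta>'_def, intro smooth_imp_has_vector_derivative s')
  note first_variation[where lam = 0, OF im p _ abs_cont_rect_curve_deriv[OF e(1)] \<eta> this]
  moreover have "?a \<in> Lp p" using p by (intro continuous_imp_Lp continuous_rect_second e(1)) simp
  ultimately show "((\<lambda>\<epsilon>. bending_energy p (\<lambda>t. ?\<gamma> t + \<epsilon> *\<^sub>R \<eta> t) +
      0 * curve_length (\<lambda>t. ?\<gamma> t + \<epsilon> *\<^sub>R \<eta> t)) has_real_derivative 0) (at 0)"
    using 0 by simp
qed

text \<open>If n is the order of vanishing at 0, then g(h)/h^n has a nonzero limit, while for h > 0
  it is comparable to h^(alpha-n), so alpha = n. Positivity of g on both sides of 0 excludes odd
  n.\<close>

lemma power_series_two_sided_power_bound:
  fixes g :: "real \<Rightarrow> real" and b :: "nat \<Rightarrow> real"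
  assumes r: "0 < r" and c: "0 < c"
    and g: "\<And>h. \<bar>h\<bar> < r \<Longrightarrow> (\<lambda>n. b n * h ^ n) sums g h"
    and lower: "\<And>h. \<bar>h\<bar> < r \<Longrightarrow> c * \<bar>h\<bar> powr \<alpha> \<le> g h"
    and upper: "\<And>h. \<bar>h\<bar> < r \<Longrightarrow> g h \<le> \<bar>h\<bar> powr \<alpha>"
  obtains n where "even n" "\<alpha> = real n"
proof -
  have pos: "0 < g h" if "\<bar>h\<bar> < r" "h \<noteq> 0" for h
    using lower[OF that(1)] c that(2) by (smt (verit, best) mult_pos_pos powr_gt_zero)
  have "\<exists>n. b n \<noteq> 0"
  proof (rule ccontr)
    assume "\<not> (\<exists>n. b n \<noteq> 0)"
    then have "(\<lambda>n. 0) sums g (r / 2)" using g[of "r / 2"] r by simp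
    then have "g (r / 2) = 0" using sums_unique2[OF _ sums_zero] by blast
    then show False using pos[of "r / 2"] r by simp
  qed
  define n where "n = (LEAST n. b n \<noteq> 0)"
  have n: "b n \<noteq> 0" "\<And>i. i < n \<Longrightarrow> b i = 0"
    using LeastI_ex[OF \<open>\<exists>n. b n \<noteq> 0\<close>] not_less_Least unfolding n_def by blast+
  \<comment> \<open>The quotient g(h)/h^n, given its limit as value at 0 so that it is the sum of
    the shifted series on the whole interval.\<close>
  define K where "K h = (if h = 0 then b n else g h / h ^ n)" for h
  have K: "(\<lambda>k. b (k + n) * h ^ k) sums K h" if "\<bar>h\<bar> < r" for h
  proof (cases "h = 0")
    case True
    then show ?thesis using powser_sums_zero[of "\<lambda>k. b (k + n)"] by (simp add: K_def)
  next
    case False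
    have "(\<Sum>i<n. b i * h ^ i) = 0" using n(2) by simp
    then have "(\<lambda>k. b (k + n) * h ^ (k + n)) sums g h"
      using g[OF that] sums_iff_shift[of "\<lambda>i. b i * h ^ i" n "g h"] by simp
    from sums_divide[OF this, of "h ^ n"] show ?thesis
      using False by (simp add: K_def power_add)
  qed
  have lim: "(K \<longlongrightarrow> b n) (at 0)"
    using powser_limit_0[OF r, of "\<lambda>k. b (k + n)" K] K by simp
  then have limr: "(K \<longlongrightarrow> b n) (at_right 0)" and liml: "(K \<longlongrightarrow> b n) (at_left 0)"
    by (simp_all add: filterlim_at_split)
  have nearr: "\<forall>\<^sub>F h in at_right 0. 0 < h \<and> h < r"
    using r by (auto simp: eventually_at_right_field)
  have Kpos: "c * h powr (\<alpha> - n) \<le> K h \<and> K h \<le> h powr (\<alpha> - n)" if h: "0 < h \<and> h < r" for h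
  proof -
    have e: "h powr (\<alpha> - n) = \<bar>h\<bar> powr \<alpha> / h ^ n"
      using h by (simp add: powr_diff powr_realpow)
    have "c * \<bar>h\<bar> powr \<alpha> / h ^ n \<le> g h / h ^ n" "g h / h ^ n \<le> \<bar>h\<bar> powr \<alpha> / h ^ n"
      using lower[of h] upper[of h] h by (auto intro!: divide_right_mono)
    then show ?thesis unfolding e using h by (simp add: K_def)
  qed
  have "\<not> real n < \<alpha>"
  proof
    assume "real n < \<alpha>"
    then have "((\<lambda>h::real. h powr (\<alpha> - n)) \<longlongrightarrow> 0 powr (\<alpha> - n)) (at_right 0)"
      by (intro tendsto_powr' tendsto_intros)
        (auto simp: eventually_at_right_field intro!: exI[of _ 1])
    then have "((\<lambda>h::real. h powr (\<alpha> - n)) \<longlongrightarrow> 0) (at_right 0)" by simp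
    then have "(K \<longlongrightarrow> 0) (at_right 0)"
    proof (rule tendsto_sandwich[rotated 3])
      show "\<forall>\<^sub>F h in at_right 0. 0 \<le> K h"
        using nearr by (rule eventually_mono) (use Kpos c in \<open>smt (verit) mult_nonneg_nonneg powr_ge_zero\<close>)
      show "\<forall>\<^sub>F h in at_right 0. K h \<le> h powr (\<alpha> - n)"
        using nearr by (rule eventually_mono) (use Kpos in blast)
    qed simp
    then have "b n = 0" using tendsto_unique[OF _ limr] by (metis trivial_limit_at_right_real)
    then show False using n(1) by simp
  qed
  moreover have "\<not> \<alpha> < real n"
  proof
    assume "\<alpha> < real n"
    then have "((\<lambda>h::real. h powr (n - \<alpha>)) \<longlongrightarrow> 0 powr (n - \<alpha>)) (at_right 0)"
      by (intro tendsto_powr' tendsto_intros)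
        (auto simp: eventually_at_right_field intro!: exI[of _ 1])
    from tendsto_mult[OF this limr]
    have "((\<lambda>h::real. h powr (n - \<alpha>) * K h) \<longlongrightarrow> 0) (at_right 0)" by simp
    moreover have "\<forall>\<^sub>F h in at_right 0. c \<le> h powr (n - \<alpha>) * K h"
      using nearr
    proof (rule eventually_mono)
      fix h assume h: "0 < h \<and> h < r"
      have "h powr (n - \<alpha>) * (c * h powr (\<alpha> - n)) \<le> h powr (n - \<alpha>) * K h"
        using Kpos[OF h] by (intro mult_left_mono) auto
      moreover have "h powr (n - \<alpha>) * (c * h powr (\<alpha> - n)) = c"
        using h by (simp add: powr_diff)
      ultimately show "c \<le> h powr (n - \<alpha>) * K h" by simp
    qed
    ultimately have "c \<le> 0" using tendsto_lowerbound trivial_limit_at_right_real by blast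
    then show False using c by simp
  qed
  moreover have "even n"
  proof (rule ccontr)
    assume odd: "odd n"
    have "0 \<le> b n"
      by (rule tendsto_lowerbound[OF limr])
        (auto intro!: eventually_mono[OF nearr] simp: K_def intro!: divide_nonneg_pos less_imp_le[OF pos])
    moreover have "b n \<le> 0"
    proof (rule tendsto_upperbound[OF liml])
      have "\<forall>\<^sub>F h in at_left 0. - r < h \<and> h < 0"
        using r by (auto simp: eventually_at_left_field intro!: exI[of _ "- r"])
      then show "\<forall>\<^sub>F h in at_left 0. K h \<le> 0"
      proof (rule eventually_mono)
        fix h assume h: "- r < h \<and> h < 0"
        then have "h ^ n < 0" using odd by (simp add: power_less_zero_eq)
        moreover have "0 < g h" using pos[of h] h by simp
        ultimately show "K h \<le> 0" using h by (simp add: K_def divide_nonneg_neg less_imp_le)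
      qed
    qed simp
    ultimately show False using n(1) by simp
  qed
  ultimately show thesis using that[of n] by simp
qed

text \<open>Near the midpoint, where the curvature vanishes, the first component of the unit tangent is
  $|y|^\alpha$ and $|y|$ is comparable to the arclength distance to the midpoint.\<close>

theorem rect_curve_analytic_imp_even:
  fixes p :: real
  assumes \<alpha>: "1 < \<alpha>" and p: "1 < p" and an: "analytic_curve (rect_curve \<alpha>)"
  obtains n where "even n" "\<alpha> = real n"
proof -
  let ?\<gamma> = "rect_curve \<alpha>"
  let ?L = "curve_length ?\<gamma>" and ?\<sigma> = "arclength ?\<gamma>"
  define \<tau> where "\<tau> = inv_into {0..1} ?\<sigma>"
  have im: "immersed_curve p ?\<gamma>" by (rule immersed_rect_curve[OF \<alpha> p])
  obtain c0 V where V: "\<And>t. t \<in> {0..1} \<Longrightarrow> norm (curve_deriv ?\<gamma> t) \<le> V"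
    using curve_deriv_bounds[OF im] by metis
  have q1: "1 \<le> norm (curve_deriv ?\<gamma> t)" if "t \<in> {0..1}" for t
    using component_le_norm_cart[of "curve_deriv ?\<gamma> t" 2] by (simp add: curve_deriv_rect_curve[OF \<alpha> that])
  have V1: "1 \<le> V" using q1[of 0] V[of 0] by simp
  define s0 where "s0 = ?\<sigma> (1 / 2)"
  have "?\<sigma> 0 = 0" by (simp add: arclength_eq[OF im])
  then have s0: "0 < s0" "s0 < ?L"
    using arclength_strict_mono[OF im, of 0 "1/2"] arclength_strict_mono[OF im, of "1/2" 1]
    by (auto simp: s0_def curve_length_def)
  have \<tau>: "\<tau> s \<in> {0..1}" "?\<sigma> (\<tau> s) = s" if "s \<in> {0..?L}" for s
    using that arclength_image[OF im] unfolding \<tau>_def by (metis f_inv_into_f inv_into_into)+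
  \<comment> \<open>The speed lies between 1 and V, so arclength distance to the midpoint and height
    differ by bounded factors only.\<close>
  have dist: "\<bar>\<tau> s - 1 / 2\<bar> \<le> \<bar>s - s0\<bar> \<and> \<bar>s - s0\<bar> \<le> V * \<bar>\<tau> s - 1 / 2\<bar>" if s: "s \<in> {0..?L}" for s
  proof -
    let ?t = "\<tau> s"
    have t: "0 \<le> ?t" "?t \<le> 1" using \<tau>(1)[OF s] by auto
    have *: "t2 - t1 \<le> ?\<sigma> t2 - ?\<sigma> t1 \<and> ?\<sigma> t2 - ?\<sigma> t1 \<le> V * (t2 - t1)"
      if tt: "0 \<le> t1" "t1 < t2" "t2 \<le> 1" for t1 t2
    proof -
      obtain z where z: "t1 < z" "z < t2" "?\<sigma> t2 - ?\<sigma> t1 = (t2 - t1) * norm (curve_deriv ?\<gamma> z)"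
        by (rule arclength_mvt[OF im tt])
      have "z \<in> {0..1}" using z that by auto
      then have "(t2 - t1) * 1 \<le> ?\<sigma> t2 - ?\<sigma> t1" "?\<sigma> t2 - ?\<sigma> t1 \<le> (t2 - t1) * V"
        unfolding z(3) using that q1 V by (auto intro!: mult_left_mono)
      then show ?thesis by (simp add: mult.commute)
    qed
    consider "?t < 1 / 2" | "?t = 1 / 2" | "1 / 2 < ?t" by linarith
    then show ?thesis
    proof cases
      case 1
      then show ?thesis using *[of ?t "1 / 2"] t \<tau>(2)[OF s] by (auto simp: s0_def abs_if)
    next
      case 2
      then have "s = s0" using \<tau>(2)[OF s] unfolding s0_def by metis
      moreover have "\<tau> s - 1 / 2 = 0" using 2 by simp
      ultimately show ?thesis by (simp only: diff_self abs_zero mult_zero_right order_refl)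
    next
      case 3
      then show ?thesis using *[of "1 / 2" ?t] t \<tau>(2)[OF s] by (auto simp: s0_def abs_if)
    qed
  qed
  have "s0 \<in> {0..?L}" using s0 by simp
  then obtain r1 a where r1: "r1 > 0" and a: "\<And>y. y \<in> {0..?L} \<Longrightarrow> \<bar>y - s0\<bar> < r1 \<Longrightarrow>
      (\<lambda>n. (y - s0) ^ n *\<^sub>R a n) sums arclength_param ?\<gamma> y"
    using an unfolding analytic_curve_def real_analytic_on_def by metis
  \<comment> \<open>Besides r1, the distances from s0 to both ends enter: the expansion is used on
    both sides of s0 and with two-sided derivatives.\<close>
  define r where "r = min r1 (min s0 (?L - s0))"
  have r: "r > 0" "r \<le> r1" "r \<le> s0" "r \<le> ?L - s0" using r1 s0 by (auto simp: r_def)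
  have dom: "s0 + h \<in> {0<..<?L}" "s0 + h \<in> {0..?L}" if "\<bar>h\<bar> < r" for h
    using that r by auto
  define x where "x h = ?\<gamma> (\<tau> (s0 + h)) $ 1" for h
  define u where "u h = \<tau> (s0 + h) - 1 / 2" for h
  have xs: "(\<lambda>n. a n $ 1 * h ^ n) sums x h" if h: "\<bar>h\<bar> < r" for h
  proof -
    have "(\<lambda>n. h ^ n *\<^sub>R a n) sums ?\<gamma> (\<tau> (s0 + h))"
      using a[OF dom(2)[OF h]] h r by (simp add: arclength_param_def \<tau>_def)
    from bounded_linear.sums[OF bounded_linear_vec_nth this, of 1]
    show ?thesis by (simp add: x_def mult.commute)
  qed
  have xd: "(x has_real_derivative rect_cos \<alpha> (u h)) (at h)" if h: "\<bar>h\<bar> < r" for h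
  proof -
    let ?s = "s0 + h"
    let ?t = "\<tau> ?s"
    have t: "?t \<in> {0..1}" by (rule \<tau>(1)[OF dom(2)[OF h]])
    have "((\<lambda>s. ?\<gamma> (\<tau> s) $ 1) has_vector_derivative
        (1 / norm (curve_deriv ?\<gamma> ?t)) *\<^sub>R curve_deriv ?\<gamma> ?t $ 1) (at ?s within {0..?L})"
      unfolding \<tau>_def
      by (rule arclength_reparam_deriv[OF im dom(2)[OF h]])
        (rule has_vector_derivative_vec_nth[OF curve_deriv_works], use im in \<open>auto simp: immersed_curve_def\<close>)
    then have "((\<lambda>s. ?\<gamma> (\<tau> s) $ 1) has_vector_derivative
        (1 / norm (curve_deriv ?\<gamma> ?t)) *\<^sub>R curve_deriv ?\<gamma> ?t $ 1) (at ?s within {0<..<?L})"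
      by (rule has_vector_derivative_within_subset) auto
    then have 1: "((\<lambda>s. ?\<gamma> (\<tau> s) $ 1) has_real_derivative
        (1 / norm (curve_deriv ?\<gamma> ?t)) * curve_deriv ?\<gamma> ?t $ 1) (at ?s)"
      unfolding has_vector_derivative_within_open[OF dom(1)[OF h] open_greaterThanLessThan]
        has_real_derivative_iff_has_vector_derivative real_scaleR_def .
    have 2: "(1 / norm (curve_deriv ?\<gamma> ?t)) * curve_deriv ?\<gamma> ?t $ 1 = rect_cos \<alpha> (u h)"
      using rect_sin_pos(1)[OF \<alpha> unit_shift_abs_le[OF t]]
      unfolding norm_rect_curve_deriv[OF \<alpha> t] unfolding curve_deriv_rect_curve[OF \<alpha> t]
      by (simp add: rect_slope_def u_def)
    have "((\<lambda>h. s0 + h) has_real_derivative 1) (at h)" by (auto intro!: derivative_eq_intros)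
    from DERIV_chain2[where g = "\<lambda>h. s0 + h" and x = h, OF 1[unfolded 2] this]
    show ?thesis unfolding x_def[abs_def] by simp
  qed
  \<comment> \<open>Analyticity is assumed for the curve, whereas the power law concerns x_s.
    Termwise differentiation passes from one to the other.\<close>
  have "(\<lambda>n. diffs (\<lambda>n. a n $ 1) n * h ^ n) sums rect_cos \<alpha> (u h)" if "\<bar>h\<bar> < r" for h
    using termdiffs_sums_strong[of r "\<lambda>n. a n $ 1" x, OF _ xd[OF that]] xs that by simp
  moreover have "(1 / V) powr \<alpha> * \<bar>h\<bar> powr \<alpha> \<le> rect_cos \<alpha> (u h)" if h: "\<bar>h\<bar> < r" for h
  proof -
    have "\<bar>h\<bar> / V \<le> \<bar>u h\<bar>"
      using dist[OF dom(2)[OF h]] V1 by (simp add: u_def field_simps)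
    then have "(1 / V * \<bar>h\<bar>) powr \<alpha> \<le> \<bar>u h\<bar> powr \<alpha>"
      using \<alpha> V1 by (intro powr_mono2) auto
    then show ?thesis unfolding powr_mult rect_cos_def .
  qed
  moreover have "rect_cos \<alpha> (u h) \<le> \<bar>h\<bar> powr \<alpha>" if h: "\<bar>h\<bar> < r" for h
    unfolding rect_cos_def using dist[OF dom(2)[OF h]] \<alpha> by (intro powr_mono2) (auto simp: u_def)
  moreover have "0 < (1 / V) powr \<alpha>" using V1 by simp
  ultimately show thesis
    using power_series_two_sided_power_bound[OF r(1), of "(1 / V) powr \<alpha>" "diffs (\<lambda>n. a n $ 1)"
        "\<lambda>h. rect_cos \<alpha> (u h)" \<alpha>] that by blast
qed

section \<open>Translation between p, its conjugate exponent and the integer m\<close>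

theorem corollary1p12:
  fixes p :: real
  assumes "1 < p"
  shows "(\<forall>\<gamma>. p_elastica p \<gamma> \<longrightarrow> analytic_curve \<gamma>) \<longleftrightarrow>
         (\<exists>m::int. m \<ge> 1 \<and> p = 2 * real_of_int m / (2 * real_of_int m - 1))"
proof
  define \<alpha> where "\<alpha> = p / (p - 1)"
  note e = rect_exponents[OF assms \<alpha>_def]
  assume "\<forall>\<gamma>. p_elastica p \<gamma> \<longrightarrow> analytic_curve \<gamma>"
  then have "analytic_curve (rect_curve \<alpha>)"
    using p_elastica_rect_curve[OF assms \<alpha>_def] by blast
  then obtain n where "even n" "\<alpha> = real n"
    by (rule rect_curve_analytic_imp_even[OF e(1) assms])
  then obtain k where k: "\<alpha> = 2 * real k" by (auto elim!: evenE)
  \<comment> \<open>Conjugation of exponents is an involution, so p = alpha/(alpha-1) with alpha =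
    2k; the case k = 0 is excluded by alpha > 1.\<close>
  have "p * (\<alpha> - 1) = \<alpha>" using e(4) by (simp add: algebra_simps)
  then have "p = 2 * real k / (2 * real k - 1)" using e(1) k by (simp add: field_simps)
  moreover have "int k \<ge> 1" using e(1) k by (cases k) auto
  ultimately show "\<exists>m::int. m \<ge> 1 \<and> p = 2 * real_of_int m / (2 * real_of_int m - 1)"
    by (intro exI[of _ "int k"]) simp
next
  assume "\<exists>m::int. m \<ge> 1 \<and> p = 2 * real_of_int m / (2 * real_of_int m - 1)"
  then obtain m :: int where m: "m \<ge> 1" "p = 2 * real_of_int m / (2 * real_of_int m - 1)" by blast
  \<comment> \<open>From p = 2m/(2m-1) one gets p - 1 = 1/(2m-1), so 1/(p-1) is the odd number 2m -
    1.\<close>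
  define n where "n = nat (2 * m - 1)"
  have "odd n" using m(1) unfolding n_def by (simp add: even_nat_iff)
  have rn: "real n = 2 * real_of_int m - 1" using m(1) by (simp add: n_def)
  have "2 * real_of_int m - 1 \<noteq> 0" using m(1) by linarith
  then have "p - 1 = 1 / real n" unfolding m(2) rn by (simp add: field_simps)
  then have "1 / (p - 1) = real n" by simp
  then show "\<forall>\<gamma>. p_elastica p \<gamma> \<longrightarrow> analytic_curve \<gamma>"
    using p_elastica_analytic[OF _ assms _ \<open>odd n\<close>] by blast
qed

end
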